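(* For any simplicial set $K$ with vertices $a$ and $b$, $\mathfrak{C}[K](a,b)$ is isomorphic to the weighted colimit in $\mathrm{SSet}$ $$\mathrm{colim}^{K_\bullet(a,b)}\,N\mathcal{P}_{(-)}$$ of $N\mathcal{P}_{(-)}:\mathcal{N}ec\to\mathrm{SSet}$ with weight $K_\bullet(a,b):\mathcal{N}ec^{op}\to\mathrm{Set}$.
   Context: Necklaces. $\mathrm{SSet}_{*,*}$ is the category of bipointed simplicial sets $K_{a,b}=(K,a,b)$; the wedge $K_{a,b}\vee L_{c,d}$ glues $b$ to $c$ and has distinguished points $(a,d)$. The simplex $\Delta^n$ is bipointed by $(0,n)$. $\mathcal{N}ec\subseteq\mathrm{SSet}_{*,*}$ is the full subcategory on necklaces $\Delta^{n_1}\vee\dots\vee\Delta^{n_k}$ ($k\ge0$, $n_i>0$; $\Delta^0$ for $k=0$). It is identified with the category whose objects are pairs $(T,p)$ with $p\ge0$ and $\{0,p\}\subseteq T\subseteq[p]=\{0,\dots,p\}$ and whose morphisms $(T,p)\to(U,q)$ are order-preserving maps $f:[p]\to[q]$ with $f(0)=0$, $f(p)=q$ and $U\subseteq f(T)$; here $T=\{0=t_0<\dots<t_k=p\}$ corresponds to $\Delta^{t_1}\vee\Delta^{t_2-t_1}\vee\dots\vee\Delta^{p-t_{k-1}}$, $[p]$ is its vertex set, and $(T,p)\vee(U,q)=(T\cup(p+U),p+q)$. For a simplicial set $K$ and $a,b\in K_0$, the functor $K_\bullet(a,b):\mathcal{N}ec^{op}\to\mathrm{Set}$ sends $T=\{0=t_0<\dots<t_k=p\}$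 to the set $K_T(a,b)$ of sequences $(x_1,\dots,x_k)$ of simplices $x_i\in K_{t_i-t_{i-1}}$ such that $x_1$ has first vertex $a$, $x_k$ has last vertex $b$, and the last vertex of $x_i$ is the first vertex of $x_{i+1}$ (for $T=\{0\}$ it is a singleton if $a=b$ and empty otherwise); canonically $K_T(a,b)\simeq\mathrm{SSet}_{*,*}(T,K_{a,b})$, with functoriality by precomposition. For a necklace $(T,p)$, $\mathcal{P}_T=\{V\subseteq[p]\mid T\subseteq V\}$ is ordered by inclusion; a necklace map $f:T\to U$ induces $\mathcal{P}_T\to\mathcal{P}_U$, $V\mapsto f(V)$. $N:\mathrm{Cat}\to\mathrm{SSet}$ is the nerve. Categorification. $\mathrm{Cat}_\Delta$ is the category of small simplicially enriched categories. $\mathfrak{C}[\Delta^n]$ has objects $[n]$, $\mathfrak{C}[\Delta^n](i,j)=N(\mathcal{P}_{\{0<j-i\}})$ for $i\le j$ (which is $N(\mathcal{P}_{\{0\}})=\Delta^0$ for $i=j$) and $\emptyset$ for $i>j$, with composition $\mathfrak{C}[\Delta^n](i,j)\times\mathfrak{C}[\Delta^n](j,k)\to\mathfrak{C}[\Delta^n](i,k)$ induced by $(T,U)\mapsto T\vee U$. This gives a functor $\mathbf{\Delta}\to\mathrm{Cat}_\Delta$, and $\mathfrak{C}:\mathrm{SSet}\to\mathrm{Cat}_\Delta$ is its left Kan extension along the Yoneda embedding $\mathbf{\Delta}\hookrightarrow\mathrm{SSet}$. The objects of $\mathfrak{C}[K]$ are the vertices of $K$. *)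

theory Defs
  imports Main "HOL-Library.FuncSet"
begin

section \<open>Simplicial sets\<close>

text \<open>The morphisms \<open>[m] \<rightarrow> [n]\<close> of the simplex category are represented by extensional functions
  on \<open>{..m}\<close>, so that equality of morphisms is equality in HOL; composition is
  \<^term>\<open>compose {..m} \<beta> \<alpha>\<close>.\<close>

definition Delta :: "nat \<Rightarrow> nat \<Rightarrow> (nat \<Rightarrow> nat) set" where
  "Delta m n = {\<alpha> \<in> {..m} \<rightarrow>\<^sub>E {..n}. mono_on {..m} \<alpha>}"

abbreviation idD :: "nat \<Rightarrow> nat \<Rightarrow> nat" where
  "idD n \<equiv> restrict (\<lambda>i. i) {..n}"

abbreviation constD :: "nat \<Rightarrow> nat \<Rightarrow> nat \<Rightarrow> nat" where
  "constD n i \<equiv> restrict (\<lambda>_. i) {..n}"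

text \<open>\<open>act X m n \<alpha> : X\<^sub>n \<rightarrow> X\<^sub>m\<close> is the action of \<open>\<alpha> : [m] \<rightarrow> [n]\<close>.\<close>

record 'a sset =
  simplices :: "nat \<Rightarrow> 'a set"
  act :: "nat \<Rightarrow> nat \<Rightarrow> (nat \<Rightarrow> nat) \<Rightarrow> 'a \<Rightarrow> 'a"

locale simplicial_set =
  fixes X :: "'a sset"
  assumes act_closed: "\<lbrakk>\<alpha> \<in> Delta m n; x \<in> simplices X n\<rbrakk> \<Longrightarrow> act X m n \<alpha> x \<in> simplices X m"
    and act_id: "x \<in> simplices X n \<Longrightarrow> act X n n (idD n) x = x"
    and act_compose: "\<lbrakk>\<alpha> \<in> Delta l m; \<beta> \<in> Delta m n; x \<in> simplices X n\<rbrakk>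
      \<Longrightarrow> act X l n (compose {..l} \<beta> \<alpha>) x = act X l m \<alpha> (act X m n \<beta> x)"

definition sset_map :: "'a sset \<Rightarrow> 'b sset \<Rightarrow> (nat \<Rightarrow> 'a \<Rightarrow> 'b) \<Rightarrow> bool" where
  "sset_map X Y \<phi> \<longleftrightarrow>
     (\<forall>n. \<forall>x\<in>simplices X n. \<phi> n x \<in> simplices Y n) \<and>
     (\<forall>m n. \<forall>\<alpha>\<in>Delta m n. \<forall>x\<in>simplices X n. \<phi> m (act X m n \<alpha> x) = act Y m n \<alpha> (\<phi> n x))"

definition sset_isomorphic :: "'a sset \<Rightarrow> 'b sset \<Rightarrow> bool" where
  "sset_isomorphic X Y \<longleftrightarrow> (\<exists>\<phi> \<psi>. sset_map X Y \<phi> \<and> sset_map Y X \<psi> \<and>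
     (\<forall>n. \<forall>x\<in>simplices X n. \<psi> n (\<phi> n x) = x) \<and> (\<forall>n. \<forall>y\<in>simplices Y n. \<phi> n (\<psi> n y) = y))"

text \<open>The \<open>i\<close>-th vertex of an \<open>n\<close>-simplex, and the totally degenerate \<open>n\<close>-simplex on a vertex.\<close>

definition vert :: "'a sset \<Rightarrow> nat \<Rightarrow> nat \<Rightarrow> 'a \<Rightarrow> 'a" where
  "vert X n i x = act X 0 n (constD 0 i) x"

definition degen :: "'a sset \<Rightarrow> nat \<Rightarrow> 'a \<Rightarrow> 'a" where
  "degen X n v = act X n 0 (constD n 0) v"

definition empty_sset :: "'a sset" where
  "empty_sset = \<lparr>simplices = \<lambda>_. {}, act = \<lambda>_ _ _ x. x\<rparr>"

text \<open>The nerve of a poset of type class \<^class>\<open>order\<close>: its \<open>n\<close>-simplices are the functors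
  \<open>[n] \<rightarrow> P\<close>, that is, the order preserving maps.\<close>

definition nerve :: "'a::order set \<Rightarrow> (nat \<Rightarrow> 'a) sset" where
  "nerve P = \<lparr>simplices = \<lambda>n. {c \<in> {..n} \<rightarrow>\<^sub>E P. mono_on {..n} c},
              act = \<lambda>m n \<alpha> c. compose {..m} c \<alpha>\<rparr>"

definition nerve_map :: "('a \<Rightarrow> 'b) \<Rightarrow> nat \<Rightarrow> (nat \<Rightarrow> 'a) \<Rightarrow> nat \<Rightarrow> 'b" where
  "nerve_map h n c = compose {..n} h c"


section \<open>Small categories, and weighted colimits of simplicial sets\<close>

text \<open>\<open>Cp J i j k g f\<close> is the composite of \<open>f : i \<rightarrow> j\<close> and \<open>g : j \<rightarrow> k\<close>.\<close>

record ('j, 'f) cat =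
  Ob :: "'j set"
  Ar :: "'j \<Rightarrow> 'j \<Rightarrow> 'f set"
  Id :: "'j \<Rightarrow> 'f"
  Cp :: "'j \<Rightarrow> 'j \<Rightarrow> 'j \<Rightarrow> 'f \<Rightarrow> 'f \<Rightarrow> 'f"

locale small_category =
  fixes J :: "('j, 'f) cat"
  assumes Id_closed: "j \<in> Ob J \<Longrightarrow> Id J j \<in> Ar J j j"
    and Cp_closed: "\<lbrakk>i \<in> Ob J; j \<in> Ob J; k \<in> Ob J; f \<in> Ar J i j; g \<in> Ar J j k\<rbrakk>
      \<Longrightarrow> Cp J i j k g f \<in> Ar J i k"
    and Cp_Id_right: "\<lbrakk>i \<in> Ob J; j \<in> Ob J; f \<in> Ar J i j\<rbrakk> \<Longrightarrow> Cp J i i j f (Id J i) = f"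
    and Cp_Id_left: "\<lbrakk>i \<in> Ob J; j \<in> Ob J; f \<in> Ar J i j\<rbrakk> \<Longrightarrow> Cp J i j j (Id J j) f = f"
    and Cp_assoc: "\<lbrakk>i \<in> Ob J; j \<in> Ob J; k \<in> Ob J; l \<in> Ob J; f \<in> Ar J i j; g \<in> Ar J j k; h \<in> Ar J k l\<rbrakk>
      \<Longrightarrow> Cp J i k l h (Cp J i j k g f) = Cp J i j l (Cp J j k l h g) f"

text \<open>Presheaves \<open>J\<^sup>o\<^sup>p \<rightarrow> Set\<close>; \<open>psh_map W j k f : W(k) \<rightarrow> W(j)\<close> for \<open>f : j \<rightarrow> k\<close>.\<close>

record ('j, 'f, 'w) psh =
  psh_ob :: "'j \<Rightarrow> 'w set"
  psh_map :: "'j \<Rightarrow> 'j \<Rightarrow> 'f \<Rightarrow> 'w \<Rightarrow> 'w"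

locale presheaf =
  fixes J :: "('j, 'f) cat" and W :: "('j, 'f, 'w) psh"
  assumes psh_closed: "\<lbrakk>j \<in> Ob J; k \<in> Ob J; f \<in> Ar J j k; w \<in> psh_ob W k\<rbrakk>
      \<Longrightarrow> psh_map W j k f w \<in> psh_ob W j"
    and psh_Id: "\<lbrakk>j \<in> Ob J; w \<in> psh_ob W j\<rbrakk> \<Longrightarrow> psh_map W j j (Id J j) w = w"
    and psh_Cp: "\<lbrakk>i \<in> Ob J; j \<in> Ob J; k \<in> Ob J; f \<in> Ar J i j; g \<in> Ar J j k; w \<in> psh_ob W k\<rbrakk>
      \<Longrightarrow> psh_map W i k (Cp J i j k g f) w = psh_map W i j f (psh_map W j k g w)"

text \<open>Functors \<open>J \<rightarrow> SSet\<close>.\<close>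

record ('j, 'f, 'a) sdiag =
  sd_ob :: "'j \<Rightarrow> 'a sset"
  sd_map :: "'j \<Rightarrow> 'j \<Rightarrow> 'f \<Rightarrow> nat \<Rightarrow> 'a \<Rightarrow> 'a"

locale sset_diagram =
  fixes J :: "('j, 'f) cat" and F :: "('j, 'f, 'a) sdiag"
  assumes sd_sset: "j \<in> Ob J \<Longrightarrow> simplicial_set (sd_ob F j)"
    and sd_map: "\<lbrakk>j \<in> Ob J; k \<in> Ob J; f \<in> Ar J j k\<rbrakk>
      \<Longrightarrow> sset_map (sd_ob F j) (sd_ob F k) (sd_map F j k f)"
    and sd_Id: "\<lbrakk>j \<in> Ob J; x \<in> simplices (sd_ob F j) n\<rbrakk> \<Longrightarrow> sd_map F j j (Id J j) n x = x"
    and sd_Cp: "\<lbrakk>i \<in> Ob J; j \<in> Ob J; k \<in> Ob J; f \<in> Ar J i j; g \<in> Ar J j k; x \<in> simplices (sd_ob F i) n\<rbrakk>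
      \<Longrightarrow> sd_map F i k (Cp J i j k g f) n x = sd_map F j k g n (sd_map F i j f n x)"

text \<open>The weighted colimit \<open>colim\<^sup>W F\<close> is the coend of \<open>W(j) \<times> F(j)\<close>, formed degreewise: the
  quotient of the disjoint union of the \<open>W(j) \<times> F(j)\<^sub>n\<close> by the equivalence relation generated by
  \<open>(W(f)(w), y) \<sim> (w, F(f)(y))\<close>. Its universal property is \<open>weighted_diagram.weighted_colimit_universal\<close> below.\<close>

inductive wcolim_step ::
    "('j, 'f) cat \<Rightarrow> ('j, 'f, 'w) psh \<Rightarrow> ('j, 'f, 'a) sdiag \<Rightarrow> nat \<Rightarrow> 'j \<times> 'w \<times> 'a \<Rightarrow> 'j \<times> 'w \<times> 'a \<Rightarrow> bool"
  for J W F n where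
  "\<lbrakk>j \<in> Ob J; k \<in> Ob J; f \<in> Ar J j k; w \<in> psh_ob W k; y \<in> simplices (sd_ob F j) n\<rbrakk>
    \<Longrightarrow> wcolim_step J W F n (j, psh_map W j k f w, y) (k, w, sd_map F j k f n y)"

definition wcolim_class ::
    "('j, 'f) cat \<Rightarrow> ('j, 'f, 'w) psh \<Rightarrow> ('j, 'f, 'a) sdiag \<Rightarrow> nat \<Rightarrow> 'j \<times> 'w \<times> 'a \<Rightarrow> ('j \<times> 'w \<times> 'a) set" where
  "wcolim_class J W F n p = {q. equivclp (wcolim_step J W F n) p q}"

definition weighted_colimit ::
    "('j, 'f) cat \<Rightarrow> ('j, 'f, 'w) psh \<Rightarrow> ('j, 'f, 'a) sdiag \<Rightarrow> ('j \<times> 'w \<times> 'a) set sset" where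
  "weighted_colimit J W F =
    \<lparr>simplices = \<lambda>n. {wcolim_class J W F n (j, w, y) | j w y.
        j \<in> Ob J \<and> w \<in> psh_ob W j \<and> y \<in> simplices (sd_ob F j) n},
     act = \<lambda>m n \<alpha> c. \<Union>(j, w, y)\<in>c. wcolim_class J W F m (j, w, act (sd_ob F j) m n \<alpha> y)\<rparr>"

text \<open>Natural transformations \<open>W \<Rightarrow> SSet(F(-), Y)\<close>.\<close>

definition weighted_cocone ::
    "('j, 'f) cat \<Rightarrow> ('j, 'f, 'w) psh \<Rightarrow> ('j, 'f, 'a) sdiag \<Rightarrow> 'b sset \<Rightarrow> ('j \<Rightarrow> 'w \<Rightarrow> nat \<Rightarrow> 'a \<Rightarrow> 'b) \<Rightarrow> bool" where
  "weighted_cocone J W F Y \<mu> \<longleftrightarrow>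
    (\<forall>j\<in>Ob J. \<forall>w\<in>psh_ob W j. sset_map (sd_ob F j) Y (\<mu> j w)) \<and>
    (\<forall>j\<in>Ob J. \<forall>k\<in>Ob J. \<forall>f\<in>Ar J j k. \<forall>w\<in>psh_ob W k. \<forall>n. \<forall>y\<in>simplices (sd_ob F j) n.
       \<mu> j (psh_map W j k f w) n y = \<mu> k w n (sd_map F j k f n y))"


section \<open>Simplicially enriched categories\<close>

text \<open>Composition is in diagrammatic order: \<open>cmp C x y z : C(x,y) \<times> C(y,z) \<rightarrow> C(x,z)\<close>, given
  degreewise. The identity of \<open>x\<close>, a map \<open>\<Delta>\<^sup>0 \<rightarrow> C(x,x)\<close>, is given by the vertex \<open>idn C x\<close>.\<close>

record ('o, 'm) scat =
  obj :: "'o set"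
  hom :: "'o \<Rightarrow> 'o \<Rightarrow> 'm sset"
  idn :: "'o \<Rightarrow> 'm"
  cmp :: "'o \<Rightarrow> 'o \<Rightarrow> 'o \<Rightarrow> nat \<Rightarrow> 'm \<Rightarrow> 'm \<Rightarrow> 'm"

locale simplicial_category =
  fixes C :: "('o, 'm) scat"
  assumes hom_sset: "\<lbrakk>x \<in> obj C; y \<in> obj C\<rbrakk> \<Longrightarrow> simplicial_set (hom C x y)"
    and idn_closed: "x \<in> obj C \<Longrightarrow> idn C x \<in> simplices (hom C x x) 0"
    and cmp_closed: "\<lbrakk>x \<in> obj C; y \<in> obj C; z \<in> obj C;
        g \<in> simplices (hom C x y) n; h \<in> simplices (hom C y z) n\<rbrakk>
      \<Longrightarrow> cmp C x y z n g h \<in> simplices (hom C x z) n"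
    and cmp_act: "\<lbrakk>x \<in> obj C; y \<in> obj C; z \<in> obj C; \<alpha> \<in> Delta m n;
        g \<in> simplices (hom C x y) n; h \<in> simplices (hom C y z) n\<rbrakk>
      \<Longrightarrow> cmp C x y z m (act (hom C x y) m n \<alpha> g) (act (hom C y z) m n \<alpha> h)
          = act (hom C x z) m n \<alpha> (cmp C x y z n g h)"
    and cmp_idn_left: "\<lbrakk>x \<in> obj C; y \<in> obj C; g \<in> simplices (hom C x y) n\<rbrakk>
      \<Longrightarrow> cmp C x x y n (degen (hom C x x) n (idn C x)) g = g"
    and cmp_idn_right: "\<lbrakk>x \<in> obj C; y \<in> obj C; g \<in> simplices (hom C x y) n\<rbrakk>
      \<Longrightarrow> cmp C x y y n g (degen (hom C y y) n (idn C y)) = g"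
    and cmp_assoc: "\<lbrakk>w \<in> obj C; x \<in> obj C; y \<in> obj C; z \<in> obj C; f \<in> simplices (hom C w x) n;
        g \<in> simplices (hom C x y) n; h \<in> simplices (hom C y z) n\<rbrakk>
      \<Longrightarrow> cmp C w y z n (cmp C w x y n f g) h = cmp C w x z n f (cmp C x y z n g h)"

record ('o, 'm, 'p, 'q) sfun =
  fob :: "'o \<Rightarrow> 'p"
  fmo :: "'o \<Rightarrow> 'o \<Rightarrow> nat \<Rightarrow> 'm \<Rightarrow> 'q"

locale simplicial_functor =
  fixes C :: "('o, 'm) scat" and D :: "('p, 'q) scat" and F :: "('o, 'm, 'p, 'q) sfun"
  assumes fob_closed: "x \<in> obj C \<Longrightarrow> fob F x \<in> obj D"
    and fmo_map: "\<lbrakk>x \<in> obj C; y \<in> obj C\<rbrakk>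
      \<Longrightarrow> sset_map (hom C x y) (hom D (fob F x) (fob F y)) (fmo F x y)"
    and fmo_idn: "x \<in> obj C \<Longrightarrow> fmo F x x 0 (idn C x) = idn D (fob F x)"
    and fmo_cmp: "\<lbrakk>x \<in> obj C; y \<in> obj C; z \<in> obj C;
        g \<in> simplices (hom C x y) n; h \<in> simplices (hom C y z) n\<rbrakk>
      \<Longrightarrow> fmo F x z n (cmp C x y z n g h)
          = cmp D (fob F x) (fob F y) (fob F z) n (fmo F x y n g) (fmo F y z n h)"

text \<open>Functors are not extensional functions, so they are compared on their source only.\<close>

definition sfun_eq :: "('o, 'm) scat \<Rightarrow> ('o, 'm, 'p, 'q) sfun \<Rightarrow> ('o, 'm, 'p, 'q) sfun \<Rightarrow> bool" where
  "sfun_eq C F G \<longleftrightarrow> (\<forall>x\<in>obj C. fob F x = fob G x) \<and>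
     (\<forall>x\<in>obj C. \<forall>y\<in>obj C. \<forall>n. \<forall>g\<in>simplices (hom C x y) n. fmo F x y n g = fmo G x y n g)"

definition sfun_id :: "('o, 'm, 'o, 'm) sfun" where
  "sfun_id = \<lparr>fob = \<lambda>x. x, fmo = \<lambda>_ _ _ g. g\<rparr>"

definition sfun_comp :: "('p, 'q, 'r, 's) sfun \<Rightarrow> ('o, 'm, 'p, 'q) sfun \<Rightarrow> ('o, 'm, 'r, 's) sfun" where
  "sfun_comp G F = \<lparr>fob = \<lambda>x. fob G (fob F x),
                    fmo = \<lambda>x y n g. fmo G (fob F x) (fob F y) n (fmo F x y n g)\<rparr>"

text \<open>Functors from \<open>J\<close> to simplicial categories.\<close>

record ('j, 'f, 'o, 'm) cdiag =
  cd_ob :: "'j \<Rightarrow> ('o, 'm) scat"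
  cd_map :: "'j \<Rightarrow> 'j \<Rightarrow> 'f \<Rightarrow> ('o, 'm, 'o, 'm) sfun"

locale scat_diagram =
  fixes J :: "('j, 'f) cat" and D :: "('j, 'f, 'o, 'm) cdiag"
  assumes cd_scat: "j \<in> Ob J \<Longrightarrow> simplicial_category (cd_ob D j)"
    and cd_functor: "\<lbrakk>j \<in> Ob J; k \<in> Ob J; f \<in> Ar J j k\<rbrakk>
      \<Longrightarrow> simplicial_functor (cd_ob D j) (cd_ob D k) (cd_map D j k f)"
    and cd_Id: "j \<in> Ob J \<Longrightarrow> sfun_eq (cd_ob D j) (cd_map D j j (Id J j)) sfun_id"
    and cd_Cp: "\<lbrakk>i \<in> Ob J; j \<in> Ob J; k \<in> Ob J; f \<in> Ar J i j; g \<in> Ar J j k\<rbrakk>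
      \<Longrightarrow> sfun_eq (cd_ob D i) (cd_map D i k (Cp J i j k g f))
            (sfun_comp (cd_map D j k g) (cd_map D i j f))"

definition scat_cocone ::
    "('j, 'f) cat \<Rightarrow> ('j, 'f, 'o, 'm) cdiag \<Rightarrow> ('p, 'q) scat \<Rightarrow> ('j \<Rightarrow> ('o, 'm, 'p, 'q) sfun) \<Rightarrow> bool" where
  "scat_cocone J D E \<kappa> \<longleftrightarrow>
    (\<forall>j\<in>Ob J. simplicial_functor (cd_ob D j) E (\<kappa> j)) \<and>
    (\<forall>j\<in>Ob J. \<forall>k\<in>Ob J. \<forall>f\<in>Ar J j k. sfun_eq (cd_ob D j) (sfun_comp (\<kappa> k) (cd_map D j k f)) (\<kappa> j))"


section \<open>Colimits of simplicially enriched categories\<close>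

text \<open>The colimit of a diagram \<open>D\<close> is presented by generators and relations. Its set of objects is
  the colimit of the sets of objects. In degree \<open>n\<close> a morphism is represented by a composable
  word in the \<open>n\<close>-simplices \<open>(j, x, y, g)\<close>, \<open>g \<in> D\<^sub>j(x,y)\<^sub>n\<close>, of the categories \<open>D\<^sub>j\<close>; words are
  identified along the congruence generated by the identities and composites in each \<open>D\<^sub>j\<close> and by
  the functors \<open>D\<^sub>f : D\<^sub>j \<rightarrow> D\<^sub>k\<close>. Its universal property is
  \<open>scat_diagram.scat_colim_universal\<close> below.\<close>

inductive colim_ob_step :: "('j, 'f) cat \<Rightarrow> ('j, 'f, 'o, 'm) cdiag \<Rightarrow> 'j \<times> 'o \<Rightarrow> 'j \<times> 'o \<Rightarrow> bool"
  for J D where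
  "\<lbrakk>j \<in> Ob J; k \<in> Ob J; f \<in> Ar J j k; x \<in> obj (cd_ob D j)\<rbrakk>
    \<Longrightarrow> colim_ob_step J D (j, x) (k, fob (cd_map D j k f) x)"

definition colim_ob :: "('j, 'f) cat \<Rightarrow> ('j, 'f, 'o, 'm) cdiag \<Rightarrow> 'j \<Rightarrow> 'o \<Rightarrow> ('j \<times> 'o) set" where
  "colim_ob J D j x = {q. equivclp (colim_ob_step J D) (j, x) q}"

type_synonym ('j, 'o, 'm) word = "('j \<times> 'o \<times> 'o \<times> 'm) list"

inductive colim_word ::
    "('j, 'f) cat \<Rightarrow> ('j, 'f, 'o, 'm) cdiag \<Rightarrow> nat \<Rightarrow> ('j \<times> 'o) set \<Rightarrow> ('j \<times> 'o) set \<Rightarrow> ('j, 'o, 'm) word \<Rightarrow> bool"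
  for J D n where
  Nil: "\<lbrakk>j \<in> Ob J; x \<in> obj (cd_ob D j)\<rbrakk> \<Longrightarrow> colim_word J D n (colim_ob J D j x) (colim_ob J D j x) []"
| Cons: "\<lbrakk>j \<in> Ob J; x \<in> obj (cd_ob D j); y \<in> obj (cd_ob D j); g \<in> simplices (hom (cd_ob D j) x y) n;
      colim_word J D n (colim_ob J D j y) Z u\<rbrakk>
    \<Longrightarrow> colim_word J D n (colim_ob J D j x) Z ((j, x, y, g) # u)"

inductive colim_eq ::
    "('j, 'f) cat \<Rightarrow> ('j, 'f, 'o, 'm) cdiag \<Rightarrow> nat \<Rightarrow> ('j \<times> 'o) set \<Rightarrow> ('j \<times> 'o) set \<Rightarrow>
      ('j, 'o, 'm) word \<Rightarrow> ('j, 'o, 'm) word \<Rightarrow> bool"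
  for J D n where
  refl: "colim_word J D n X Y u \<Longrightarrow> colim_eq J D n X Y u u"
| sym: "colim_eq J D n X Y u v \<Longrightarrow> colim_eq J D n X Y v u"
| trans: "\<lbrakk>colim_eq J D n X Y u v; colim_eq J D n X Y v w\<rbrakk> \<Longrightarrow> colim_eq J D n X Y u w"
| append: "\<lbrakk>colim_eq J D n X Y u u'; colim_eq J D n Y Z v v'\<rbrakk> \<Longrightarrow> colim_eq J D n X Z (u @ v) (u' @ v')"
| identity: "\<lbrakk>j \<in> Ob J; x \<in> obj (cd_ob D j)\<rbrakk>
    \<Longrightarrow> colim_eq J D n (colim_ob J D j x) (colim_ob J D j x)
          [(j, x, x, degen (hom (cd_ob D j) x x) n (idn (cd_ob D j) x))] []"
| composite: "\<lbrakk>j \<in> Ob J; x \<in> obj (cd_ob D j); y \<in> obj (cd_ob D j); z \<in> obj (cd_ob D j);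
      g \<in> simplices (hom (cd_ob D j) x y) n; h \<in> simplices (hom (cd_ob D j) y z) n\<rbrakk>
    \<Longrightarrow> colim_eq J D n (colim_ob J D j x) (colim_ob J D j z)
          [(j, x, y, g), (j, y, z, h)] [(j, x, z, cmp (cd_ob D j) x y z n g h)]"
| arrow: "\<lbrakk>j \<in> Ob J; k \<in> Ob J; f \<in> Ar J j k; x \<in> obj (cd_ob D j); y \<in> obj (cd_ob D j);
      g \<in> simplices (hom (cd_ob D j) x y) n\<rbrakk>
    \<Longrightarrow> colim_eq J D n (colim_ob J D j x) (colim_ob J D j y)
          [(j, x, y, g)]
          [(k, fob (cd_map D j k f) x, fob (cd_map D j k f) y, fmo (cd_map D j k f) x y n g)]"

definition word_act ::
    "('j, 'f, 'o, 'm) cdiag \<Rightarrow> nat \<Rightarrow> nat \<Rightarrow> (nat \<Rightarrow> nat) \<Rightarrow> ('j, 'o, 'm) word \<Rightarrow> ('j, 'o, 'm) word" where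
  "word_act D m n \<alpha> u = map (\<lambda>(j, x, y, g). (j, x, y, act (hom (cd_ob D j) x y) m n \<alpha> g)) u"

definition colim_class ::
    "('j, 'f) cat \<Rightarrow> ('j, 'f, 'o, 'm) cdiag \<Rightarrow> nat \<Rightarrow> ('j \<times> 'o) set \<Rightarrow> ('j \<times> 'o) set \<Rightarrow>
      ('j, 'o, 'm) word \<Rightarrow> ('j, 'o, 'm) word set" where
  "colim_class J D n X Y u = {v. colim_eq J D n X Y u v}"

definition scat_colim ::
    "('j, 'f) cat \<Rightarrow> ('j, 'f, 'o, 'm) cdiag \<Rightarrow> (('j \<times> 'o) set, ('j, 'o, 'm) word set) scat" where
  "scat_colim J D =
    \<lparr>obj = {colim_ob J D j x | j x. j \<in> Ob J \<and> x \<in> obj (cd_ob D j)},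
     hom = \<lambda>X Y. \<lparr>simplices = \<lambda>n. {colim_class J D n X Y u | u. colim_word J D n X Y u},
                  act = \<lambda>m n \<alpha> c. \<Union>u\<in>c. colim_class J D m X Y (word_act D m n \<alpha> u)\<rparr>,
     idn = \<lambda>X. colim_class J D 0 X X [],
     cmp = \<lambda>X Y Z n c d. \<Union>u\<in>c. \<Union>v\<in>d. colim_class J D n X Z (u @ v)\<rparr>"

definition scat_colim_inj ::
    "('j, 'f) cat \<Rightarrow> ('j, 'f, 'o, 'm) cdiag \<Rightarrow> 'j \<Rightarrow> ('o, 'm, ('j \<times> 'o) set, ('j, 'o, 'm) word set) sfun" where
  "scat_colim_inj J D j =
    \<lparr>fob = colim_ob J D j,
     fmo = \<lambda>x y n g. colim_class J D n (colim_ob J D j x) (colim_ob J D j y) [(j, x, y, g)]\<rparr>"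


section \<open>Necklaces\<close>

type_synonym necklace = "nat set \<times> nat"

text \<open>The object \<open>(T, p)\<close> has \<open>T = {0 = t\<^sub>0 < \<dots> < t\<^sub>k = p}\<close>, with \<open>t\<^sub>i = joint T i\<close> and
  \<open>k = beads T\<close>; its \<open>i\<close>-th bead (counting from \<open>0\<close>) is a simplex of dimension \<open>t\<^sub>i\<^sub>+\<^sub>1 - t\<^sub>i\<close>.\<close>

definition Nec :: "(necklace, nat \<Rightarrow> nat) cat" where
  "Nec = \<lparr>Ob = {(T, p). {0, p} \<subseteq> T \<and> T \<subseteq> {..p}},
          Ar = \<lambda>(T, p) (U, q). {f \<in> Delta p q. f 0 = 0 \<and> f p = q \<and> U \<subseteq> f ` T},
          Id = \<lambda>(T, p). idD p,
          Cp = \<lambda>(T, p) (U, q) (V, r) g f. compose {..p} g f\<rparr>"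

definition joint :: "nat set \<Rightarrow> nat \<Rightarrow> nat" where
  "joint T i = sorted_list_of_set T ! i"

definition beads :: "nat set \<Rightarrow> nat" where
  "beads T = card T - 1"

definition bead_dim :: "nat set \<Rightarrow> nat \<Rightarrow> nat" where
  "bead_dim T i = joint T (Suc i) - joint T i"

definition nec_simplices :: "'a sset \<Rightarrow> 'a \<Rightarrow> 'a \<Rightarrow> nat set \<Rightarrow> 'a list set" where
  "nec_simplices K a b T =
    (if T = {0} then (if a = b then {[]} else {})
     else {xs. length xs = beads T \<and>
       (\<forall>i<beads T. xs ! i \<in> simplices K (bead_dim T i)) \<and>
       vert K (bead_dim T 0) 0 (xs ! 0) = a \<and>
       vert K (bead_dim T (beads T - 1)) (bead_dim T (beads T - 1)) (xs ! (beads T - 1)) = b \<and>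
       (\<forall>i. Suc i < beads T \<longrightarrow> vert K (bead_dim T i) (bead_dim T i) (xs ! i)
                              = vert K (bead_dim T (Suc i)) 0 (xs ! Suc i))})"

text \<open>The necklace \<open>(T, p)\<close>, as a simplicial set, is the subcomplex of \<open>\<Delta>\<^sup>p\<close> of those \<open>\<alpha> : [n] \<rightarrow> [p]\<close>
  whose image lies in a single interval \<open>[t\<^sub>i, t\<^sub>i\<^sub>+\<^sub>1]\<close>. A sequence \<open>xs \<in> K\<^sub>T(a,b)\<close> corresponds to the
  simplicial map \<open>nec_eval K a T xs\<close> from this necklace to \<open>K\<close>, given by restricting the simplices in
  \<open>xs\<close>. If \<open>\<alpha>\<close> is constant at a joint, any of the two choices of \<open>i\<close> gives the same simplex. For
  \<open>T = {0}\<close> the map is constant at \<open>a\<close>.\<close>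

definition in_bead :: "nat set \<Rightarrow> nat \<Rightarrow> nat \<Rightarrow> (nat \<Rightarrow> nat) \<Rightarrow> bool" where
  "in_bead T i n \<alpha> \<longleftrightarrow> i < beads T \<and> \<alpha> ` {..n} \<subseteq> {joint T i..joint T (Suc i)}"

definition nec_eval :: "'a sset \<Rightarrow> 'a \<Rightarrow> nat set \<Rightarrow> 'a list \<Rightarrow> nat \<Rightarrow> (nat \<Rightarrow> nat) \<Rightarrow> 'a" where
  "nec_eval K a T xs n \<alpha> =
    (if T = {0} then degen K n a
     else let i = (LEAST i. in_bead T i n \<alpha>)
          in act K n (bead_dim T i) (\<lambda>r\<in>{..n}. \<alpha> r - joint T i) (xs ! i))"

definition bead_incl :: "nat set \<Rightarrow> nat \<Rightarrow> nat \<Rightarrow> nat" where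
  "bead_incl T i = (\<lambda>r\<in>{..bead_dim T i}. joint T i + r)"

text \<open>The presheaf \<open>K\<^sub>\<bullet>(a,b)\<close>. Under the above correspondence, a necklace map \<open>f : T \<rightarrow> U\<close> acts by
  precomposition: the \<open>i\<close>-th simplex of the result is the image of the \<open>i\<close>-th bead of \<open>T\<close> under
  the composite \<open>T \<rightarrow> U \<rightarrow> K\<close> (see \<open>nec_eval_precompose\<close> below).\<close>

definition nec_psh :: "'a sset \<Rightarrow> 'a \<Rightarrow> 'a \<Rightarrow> (necklace, nat \<Rightarrow> nat, 'a list) psh" where
  "nec_psh K a b =
    \<lparr>psh_ob = \<lambda>(T, p). nec_simplices K a b T,
     psh_map = \<lambda>(T, p) (U, q) f xs.
       map (\<lambda>i. nec_eval K a U xs (bead_dim T i) (compose {..bead_dim T i} f (bead_incl T i))) [0..<beads T]\<rparr>"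

definition nec_poset :: "necklace \<Rightarrow> nat set set" where
  "nec_poset = (\<lambda>(T, p). {V. T \<subseteq> V \<and> V \<subseteq> {..p}})"

definition nerve_P :: "(necklace, nat \<Rightarrow> nat, nat \<Rightarrow> nat set) sdiag" where
  "nerve_P = \<lparr>sd_ob = \<lambda>T. nerve (nec_poset T), sd_map = \<lambda>_ _ f. nerve_map ((`) f)\<rparr>"


section \<open>Categorification\<close>

definition simplex_scat :: "nat \<Rightarrow> (nat, nat \<Rightarrow> nat set) scat" where
  "simplex_scat n =
    \<lparr>obj = {..n},
     hom = \<lambda>i j. if i \<le> j then nerve (nec_poset ({0, j - i}, j - i)) else empty_sset,
     idn = \<lambda>i. (\<lambda>r\<in>{..0}. {0}),
     cmp = \<lambda>i j k m c d. \<lambda>r\<in>{..m}. c r \<union> (+) (j - i) ` d r\<rparr>"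

text \<open>On \<open>i \<le> j\<close>, the map \<open>\<alpha>\<close> restricts to the necklace map \<open>\<Delta>\<^sup>j\<^sup>-\<^sup>i \<rightarrow> \<Delta>\<^bsup>\<alpha>(j)-\<alpha>(i)\<^esup>\<close>,
  \<open>v \<mapsto> \<alpha>(i + v) - \<alpha>(i)\<close>.\<close>

definition simplex_scat_map :: "(nat \<Rightarrow> nat) \<Rightarrow> (nat, nat \<Rightarrow> nat set, nat, nat \<Rightarrow> nat set) sfun" where
  "simplex_scat_map \<alpha> =
    \<lparr>fob = \<alpha>, fmo = \<lambda>i j. nerve_map ((`) (\<lambda>v. \<alpha> (i + v) - \<alpha> i))\<rparr>"

text \<open>The category of simplices of \<open>K\<close>; by the Yoneda lemma it is the comma category of the Yoneda
  embedding over \<open>K\<close>. The left Kan extension of \<open>\<CC>[\<Delta>\<^sup>\<bullet>]\<close> along the Yoneda embedding takes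
  the value \<open>colim \<CC>[\<Delta>\<^sup>n]\<close> on \<open>K\<close>, where the colimit is over the simplices \<open>\<Delta>\<^sup>n \<rightarrow> K\<close>; see
  \<open>categorification_universal\<close> below.\<close>

definition simplex_category :: "'a sset \<Rightarrow> (nat \<times> 'a, nat \<Rightarrow> nat) cat" where
  "simplex_category K =
    \<lparr>Ob = {(n, x). x \<in> simplices K n},
     Ar = \<lambda>(m, y) (n, x). {\<alpha> \<in> Delta m n. act K m n \<alpha> x = y},
     Id = \<lambda>(n, x). idD n,
     Cp = \<lambda>(l, z) (m, y) (n, x) \<beta> \<alpha>. compose {..l} \<beta> \<alpha>\<rparr>"

definition simplex_diagram :: "(nat \<times> 'a, nat \<Rightarrow> nat, nat, nat \<Rightarrow> nat set) cdiag" where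
  "simplex_diagram = \<lparr>cd_ob = \<lambda>(n, x). simplex_scat n, cd_map = \<lambda>_ _. simplex_scat_map\<rparr>"

definition categorification ::
    "'a sset \<Rightarrow> (((nat \<times> 'a) \<times> nat) set, (nat \<times> 'a, nat, nat \<Rightarrow> nat set) word set) scat" where
  "categorification K = scat_colim (simplex_category K) simplex_diagram"

text \<open>The object of \<open>\<CC>[K]\<close> given by a vertex of \<open>K\<close>: the image of \<open>0\<close> under
  \<open>\<CC>[\<Delta>\<^sup>0] \<rightarrow> \<CC>[K]\<close>. By \<open>bij_betw_cat_vertex\<close> below this identifies the vertices
  of \<open>K\<close> with the objects of \<open>\<CC>[K]\<close>.\<close>

definition cat_vertex :: "'a sset \<Rightarrow> 'a \<Rightarrow> ((nat \<times> 'a) \<times> nat) set" where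
  "cat_vertex K a = fob (scat_colim_inj (simplex_category K) simplex_diagram (0, a)) 0"


section \<open>Basic properties of simplicial sets\<close>

lemma Delta_apply: "\<alpha> \<in> Delta m n \<Longrightarrow> i \<le> m \<Longrightarrow> \<alpha> i \<le> n"
  by (auto simp: Delta_def)

lemma Delta_mono: "\<alpha> \<in> Delta m n \<Longrightarrow> i \<le> j \<Longrightarrow> j \<le> m \<Longrightarrow> \<alpha> i \<le> \<alpha> j"
  by (auto simp: Delta_def mono_on_def)

lemma Delta_idD: "idD n \<in> Delta n n"
  by (auto simp: Delta_def mono_on_def)

lemma Delta_constD: "i \<le> n \<Longrightarrow> constD m i \<in> Delta m n"
  by (auto simp: Delta_def mono_on_def)

lemma Delta_compose: "\<alpha> \<in> Delta l m \<Longrightarrow> \<beta> \<in> Delta m n \<Longrightarrow> compose {..l} \<beta> \<alpha> \<in> Delta l n"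
  using Delta_apply[of \<alpha> l m] Delta_apply[of \<beta> m n] Delta_mono[of \<alpha> l m] Delta_mono[of \<beta> m n]
  by (auto simp: Delta_def[of l n] mono_on_def compose_def)

lemma Delta_eqI: "\<alpha> \<in> Delta m n \<Longrightarrow> \<beta> \<in> Delta m n' \<Longrightarrow> (\<And>i. i \<le> m \<Longrightarrow> \<alpha> i = \<beta> i) \<Longrightarrow> \<alpha> = \<beta>"
  by (rule extensionalityI[of _ "{..m}"]) (simp_all add: Delta_def PiE_iff)

lemma compose_constD: "\<alpha> \<in> Delta l m \<Longrightarrow> compose {..l} (constD m i) \<alpha> = constD l i"
  by (auto simp: compose_def Delta_def PiE_iff intro!: restrict_ext)

lemma compose_idD_right: "\<alpha> \<in> Delta m n \<Longrightarrow> compose {..m} \<alpha> (idD m) = \<alpha>"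
  by (rule compose_Id) (auto simp: Delta_def PiE_iff)

lemma compose_idD_left: "\<alpha> \<in> Delta m n \<Longrightarrow> compose {..m} (idD n) \<alpha> = \<alpha>"
  by (rule Id_compose) (auto simp: Delta_def PiE_iff)

lemma Delta_compose_assoc:
  "\<alpha> \<in> Delta l m \<Longrightarrow> compose {..l} \<gamma> (compose {..l} \<beta> \<alpha>) = compose {..l} (compose {..m} \<gamma> \<beta>) \<alpha>"
  by (auto simp: compose_def Delta_def PiE_iff intro!: restrict_ext)

lemma (in simplicial_set) degen_closed: "v \<in> simplices X 0 \<Longrightarrow> degen X n v \<in> simplices X n"
  unfolding degen_def by (rule act_closed[OF Delta_constD]) auto

lemma (in simplicial_set) degen_act:
  "v \<in> simplices X 0 \<Longrightarrow> \<alpha> \<in> Delta m n \<Longrightarrow> act X m n \<alpha> (degen X n v) = degen X m v"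
  unfolding degen_def by (simp add: act_compose[OF _ Delta_constD, symmetric] compose_constD)

lemma (in simplicial_set) degen_0: "v \<in> simplices X 0 \<Longrightarrow> degen X 0 v = v"
proof -
  have "constD 0 0 = idD 0" by (rule restrict_ext) simp
  then show "v \<in> simplices X 0 \<Longrightarrow> degen X 0 v = v" unfolding degen_def using act_id[of v 0] by metis
qed

lemma sset_map_degen:
  "sset_map X Y \<phi> \<Longrightarrow> v \<in> simplices X 0 \<Longrightarrow> \<phi> n (degen X n v) = degen Y n (\<phi> 0 v)"
  unfolding sset_map_def degen_def by (auto simp: Delta_constD)

lemma sset_map_comp: "sset_map X Y \<phi> \<Longrightarrow> sset_map Y Z \<psi> \<Longrightarrow> sset_map X Z (\<lambda>n x. \<psi> n (\<phi> n x))"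
  unfolding sset_map_def by simp

lemma simplicial_set_empty: "simplicial_set empty_sset"
  by unfold_locales (auto simp: empty_sset_def)

lemma simplicial_set_nerve: "simplicial_set (nerve P)"
proof
  fix \<alpha> m n and c :: "nat \<Rightarrow> 'a" assume "\<alpha> \<in> Delta m n" "c \<in> simplices (nerve P) n"
  then have "\<alpha> i \<le> n" "c (\<alpha> i) \<in> P" "j \<le> i \<Longrightarrow> c (\<alpha> j) \<le> c (\<alpha> i)" if "i \<le> m" for i j
    using that Delta_apply[of \<alpha> m n i] Delta_mono[of \<alpha> m n j i] by (auto simp: nerve_def mono_on_def PiE_iff)
  then show "act (nerve P) m n \<alpha> c \<in> simplices (nerve P) m"
    by (auto simp: nerve_def mono_on_def compose_def PiE_iff)
next
  fix n and c :: "nat \<Rightarrow> 'a" assume "c \<in> simplices (nerve P) n"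
  then show "act (nerve P) n n (idD n) c = c"
    by (auto simp: nerve_def PiE_iff intro!: compose_Id)
next
  fix \<alpha> \<beta> l m n and c :: "nat \<Rightarrow> 'a" assume "\<alpha> \<in> Delta l m" 
  then show "act (nerve P) l n (compose {..l} \<beta> \<alpha>) c = act (nerve P) l m \<alpha> (act (nerve P) m n \<beta> c)"
    by (simp add: nerve_def Delta_compose_assoc)
qed

lemma nerve_map_sset_map:
  assumes "h ` P \<subseteq> Q" "mono_on P h"
  shows "sset_map (nerve P) (nerve Q) (nerve_map h)"
  using assms unfolding sset_map_def nerve_def nerve_map_def 
  by (auto simp: PiE_iff compose_def mono_on_def Delta_def intro!: restrict_ext)

lemma equivclp_lift:
  assumes "equivclp r x y" "\<And>x y. r x y \<Longrightarrow> f x = f y"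
  shows "f x = f y"
  using assms(1)
proof (induction rule: equivclp_induct)
  case (step y z)
  from step(2) have "f y = f z" using assms(2)[of y z] assms(2)[of z y] by auto
  with step(3) show ?case by simp
qed simp

lemma equivclp_class_eq:
  assumes "equivclp r x y"
  shows "{z. equivclp r x z} = {z. equivclp r y z}"
  using equivclp_trans[OF assms] equivclp_trans[OF equivclp_sym[OF assms]] by (intro Collect_cong iffI)

section \<open>The universal property of weighted colimits\<close>

lemma wcolim_class_eqI:
  "equivclp (wcolim_step J W F n) p q \<Longrightarrow> wcolim_class J W F n p = wcolim_class J W F n q"
  unfolding wcolim_class_def by (rule equivclp_class_eq)

lemma wcolim_class_self: "p \<in> wcolim_class J W F n p"
  by (simp add: wcolim_class_def)

lemma wcolim_class_UN:
  assumes "\<And>p q. wcolim_step J W F n p q \<Longrightarrow> h p = h q"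
  shows "(\<Union>q\<in>wcolim_class J W F n p. h q) = h p"
proof -
  have "h q = h p" if "q \<in> wcolim_class J W F n p" for q
    using that equivclp_lift[of "wcolim_step J W F n" p q h] assms by (auto simp: wcolim_class_def)
  then show ?thesis using wcolim_class_self[of p J W F n] by blast
qed

locale weighted_diagram = presheaf J W + sset_diagram J F
  for J :: "('j, 'f) cat" and W :: "('j, 'f, 'w) psh" and F :: "('j, 'f, 'a) sdiag"
begin

lemma step_act:
  assumes "\<alpha> \<in> Delta m n" "wcolim_step J W F n (j, w, y) (k, v, z)"
  shows "wcolim_step J W F m (j, w, act (sd_ob F j) m n \<alpha> y) (k, v, act (sd_ob F k) m n \<alpha> z)"
  using assms(2)
proof cases
  case (1 f)
  interpret simplicial_set "sd_ob F j" using 1 by (intro sd_sset) 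
  have "act (sd_ob F j) m n \<alpha> y \<in> simplices (sd_ob F j) m"
    using assms(1) 1 by (intro act_closed)
  from wcolim_step.intros[of j J k f v W "act (sd_ob F j) m n \<alpha> y" F m] this 1 show ?thesis
    using sd_map[of j k f] assms(1) by (auto simp: sset_map_def)
qed

lemma colim_act:
  assumes "\<alpha> \<in> Delta m n"
  shows "act (weighted_colimit J W F) m n \<alpha> (wcolim_class J W F n (j, w, y))
    = wcolim_class J W F m (j, w, act (sd_ob F j) m n \<alpha> y)"
proof -
  let ?h = "\<lambda>(j, w, y). wcolim_class J W F m (j, w, act (sd_ob F j) m n \<alpha> y)"
  have "?h p = ?h q" if "wcolim_step J W F n p q" for p q
    using that step_act[OF assms] by (cases p; cases q) (auto intro!: wcolim_class_eqI r_into_equivclp)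
  then show ?thesis
    using wcolim_class_UN[of J W F n ?h "(j, w, y)"] by (simp add: weighted_colimit_def)
qed

lemma colim_simplices:
  "simplices (weighted_colimit J W F) n = {wcolim_class J W F n (j, w, y) | j w y.
        j \<in> Ob J \<and> w \<in> psh_ob W j \<and> y \<in> simplices (sd_ob F j) n}"
  by (simp add: weighted_colimit_def)

theorem simplicial_set_weighted_colimit: "simplicial_set (weighted_colimit J W F)"
proof 
  fix \<alpha> m n c assume "\<alpha> \<in> Delta m n" "c \<in> simplices (weighted_colimit J W F) n"
  then show "act (weighted_colimit J W F) m n \<alpha> c \<in> simplices (weighted_colimit J W F) m"
    using simplicial_set.act_closed[OF sd_sset] unfolding colim_simplices
    by (fastforce simp: colim_act)
next
  fix n c assume "c \<in> simplices (weighted_colimit J W F) n"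
  then show "act (weighted_colimit J W F) n n (idD n) c = c"
    using simplicial_set.act_id[OF sd_sset] unfolding colim_simplices
    by (fastforce simp: colim_act Delta_idD)
next
  fix \<alpha> \<beta> l m n c assume "\<alpha> \<in> Delta l m" "\<beta> \<in> Delta m n" "c \<in> simplices (weighted_colimit J W F) n"
  then show "act (weighted_colimit J W F) l n (compose {..l} \<beta> \<alpha>) c =
    act (weighted_colimit J W F) l m \<alpha> (act (weighted_colimit J W F) m n \<beta> c)"
    using simplicial_set.act_compose[OF sd_sset] Delta_compose unfolding colim_simplices
    by (fastforce simp: colim_act)
qed

theorem weighted_cocone_weighted_colimit:
  "weighted_cocone J W F (weighted_colimit J W F) (\<lambda>j w n y. wcolim_class J W F n (j, w, y))"
  unfolding weighted_cocone_def sset_map_def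
  by (auto simp: colim_act colim_simplices intro!: wcolim_class_eqI r_into_equivclp wcolim_step.intros)

theorem weighted_colimit_universal:
  assumes \<mu>: "weighted_cocone J W F Y \<mu>"
  shows "\<exists>\<phi>. sset_map (weighted_colimit J W F) Y \<phi> \<and>
      (\<forall>j\<in>Ob J. \<forall>w\<in>psh_ob W j. \<forall>n. \<forall>y\<in>simplices (sd_ob F j) n.
        \<phi> n (wcolim_class J W F n (j, w, y)) = \<mu> j w n y)"
    and "\<lbrakk>sset_map (weighted_colimit J W F) Y \<phi>; sset_map (weighted_colimit J W F) Y \<psi>;
      \<And>j w n y. \<lbrakk>j \<in> Ob J; w \<in> psh_ob W j; y \<in> simplices (sd_ob F j) n\<rbrakk> \<Longrightarrow>
        \<phi> n (wcolim_class J W F n (j, w, y)) = \<psi> n (wcolim_class J W F n (j, w, y));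
      c \<in> simplices (weighted_colimit J W F) n\<rbrakk> \<Longrightarrow> \<phi> n c = \<psi> n c"
proof -
  define \<phi> where "\<phi> n c = the_elem (\<Union>(j, w, y)\<in>c. {\<mu> j w n y})" for n c
  have eq: "\<phi> n (wcolim_class J W F n (j, w, y)) = \<mu> j w n y" for j w n y
  proof -
    let ?h = "\<lambda>(j, w, y). {\<mu> j w n y}"
    have "?h p = ?h q" if "wcolim_step J W F n p q" for p q
      using that \<mu> by cases (auto simp: weighted_cocone_def)
    then show ?thesis using wcolim_class_UN[of J W F n ?h "(j, w, y)"] by (simp add: \<phi>_def)
  qed
  have "sset_map (weighted_colimit J W F) Y \<phi>"
    using \<mu> by (auto simp: sset_map_def colim_simplices eq colim_act weighted_cocone_def)
  with eq show "\<exists>\<phi>. sset_map (weighted_colimit J W F) Y \<phi> \<and>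
      (\<forall>j\<in>Ob J. \<forall>w\<in>psh_ob W j. \<forall>n. \<forall>y\<in>simplices (sd_ob F j) n.
        \<phi> n (wcolim_class J W F n (j, w, y)) = \<mu> j w n y)" by blast
qed (auto simp: colim_simplices)

end


section \<open>The universal property of colimits of simplicially enriched categories\<close>

lemma sset_mapD: "sset_map X Y \<phi> \<Longrightarrow> x \<in> simplices X n \<Longrightarrow> \<phi> n x \<in> simplices Y n"
  "sset_map X Y \<phi> \<Longrightarrow> x \<in> simplices X n \<Longrightarrow> \<alpha> \<in> Delta m n \<Longrightarrow> \<phi> m (act X m n \<alpha> x) = act Y m n \<alpha> (\<phi> n x)"
  by (auto simp: sset_map_def)

lemma colim_ob_arrow:
  "\<lbrakk>j \<in> Ob J; k \<in> Ob J; f \<in> Ar J j k; x \<in> obj (cd_ob D j)\<rbrakk>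
    \<Longrightarrow> colim_ob J D k (fob (cd_map D j k f) x) = colim_ob J D j x"
  unfolding colim_ob_def 
  by (rule equivclp_class_eq[symmetric]) (auto intro: r_into_equivclp colim_ob_step.intros)

context scat_diagram
begin

abbreviation "C \<equiv> scat_colim J D"
abbreviation "Q \<equiv> colim_ob J D"

lemma obC: "X \<in> obj C \<longleftrightarrow> (\<exists>j x. j \<in> Ob J \<and> x \<in> obj (cd_ob D j) \<and> X = Q j x)"
  by (auto simp: scat_colim_def)

lemma word_ob: "colim_word J D n X Y u \<Longrightarrow> X \<in> obj C \<and> Y \<in> obj C"
  by (induction rule: colim_word.induct) (auto simp: obC)

lemma word_append: "colim_word J D n X Y u \<Longrightarrow> colim_word J D n Y Z v \<Longrightarrow> colim_word J D n X Z (u @ v)"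
  by (induction rule: colim_word.induct) (auto intro: colim_word.intros)

lemma word_Nil: "X \<in> obj C \<Longrightarrow> colim_word J D n X X []"
  by (auto simp: obC intro: colim_word.Nil)

lemma word_single:
  "\<lbrakk>j \<in> Ob J; x \<in> obj (cd_ob D j); y \<in> obj (cd_ob D j); g \<in> simplices (hom (cd_ob D j) x y) n\<rbrakk>
   \<Longrightarrow> colim_word J D n (Q j x) (Q j y) [(j, x, y, g)]"
  by (auto intro: colim_word.intros)

lemma eq_word: "colim_eq J D n X Y u v \<Longrightarrow> colim_word J D n X Y u \<and> colim_word J D n X Y v"
proof (induction rule: colim_eq.induct)
  case (identity j x)
  interpret simplicial_category "cd_ob D j" using identity by (intro cd_scat)
  have "degen (hom (cd_ob D j) x x) n (idn (cd_ob D j) x) \<in> simplices (hom (cd_ob D j) x x) n"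
    using identity by (intro simplicial_set.degen_closed hom_sset idn_closed)
  then show ?case using identity by (auto intro: colim_word.intros)
next
  case (composite j x y z g h)
  interpret simplicial_category "cd_ob D j" using composite by (intro cd_scat)
  show ?case using composite by (auto intro!: colim_word.intros cmp_closed)
next
  case (arrow j k f x y g)
  interpret simplicial_functor "cd_ob D j" "cd_ob D k" "cd_map D j k f" using arrow by (intro cd_functor)
  have "colim_word J D n (Q k (fob (cd_map D j k f) x)) (Q k (fob (cd_map D j k f) y))
          [(k, fob (cd_map D j k f) x, fob (cd_map D j k f) y, fmo (cd_map D j k f) x y n g)]"
    using arrow by (intro word_single fob_closed sset_mapD(1)[OF fmo_map])
  then show ?case using arrow by (auto simp: colim_ob_arrow word_single)
qed (auto intro: word_append)

lemma class_self: "colim_word J D n X Y u \<Longrightarrow> u \<in> colim_class J D n X Y u"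
  by (simp add: colim_class_def colim_eq.refl)

lemma class_eqI: "colim_eq J D n X Y u v \<Longrightarrow> colim_class J D n X Y u = colim_class J D n X Y v"
  unfolding colim_class_def
  by (intro Collect_cong iffI) (erule colim_eq.trans[OF colim_eq.sym], assumption, erule colim_eq.trans, assumption)

lemma class_UN:
  assumes "colim_word J D n X Y u" "\<And>v. colim_eq J D n X Y u v \<Longrightarrow> h v = h u"
  shows "(\<Union>v\<in>colim_class J D n X Y u. h v) = h u"
proof -
  have "h ` colim_class J D n X Y u = {h u}"
  proof (intro equalityI subsetI)
    fix z assume "z \<in> h ` colim_class J D n X Y u"
    then obtain v where "colim_eq J D n X Y u v" "z = h v" by (auto simp: colim_class_def)
    with assms(2)[of v] show "z \<in> {h u}" by simp
  qed (use class_self[OF assms(1)] in blast)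
  then show ?thesis by simp
qed

lemma word_act_simps: "word_act D m n \<alpha> [] = []" "word_act D m n \<alpha> (u @ v) = word_act D m n \<alpha> u @ word_act D m n \<alpha> v"
  "word_act D m n \<alpha> ((j, x, y, g) # u) = (j, x, y, act (hom (cd_ob D j) x y) m n \<alpha> g) # word_act D m n \<alpha> u"
  by (auto simp: word_act_def)

lemma hom_act_closed:
  "\<lbrakk>j \<in> Ob J; x \<in> obj (cd_ob D j); y \<in> obj (cd_ob D j); g \<in> simplices (hom (cd_ob D j) x y) n; \<alpha> \<in> Delta m n\<rbrakk>
   \<Longrightarrow> act (hom (cd_ob D j) x y) m n \<alpha> g \<in> simplices (hom (cd_ob D j) x y) m"
  by (intro simplicial_set.act_closed simplicial_category.hom_sset cd_scat)

lemma word_act_closed: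
  "colim_word J D n X Y u \<Longrightarrow> \<alpha> \<in> Delta m n \<Longrightarrow> colim_word J D m X Y (word_act D m n \<alpha> u)"
  by (induction rule: colim_word.induct) (auto simp: word_act_simps intro!: colim_word.intros hom_act_closed)

lemma eq_act: "colim_eq J D n X Y u v \<Longrightarrow> \<alpha> \<in> Delta m n \<Longrightarrow> colim_eq J D m X Y (word_act D m n \<alpha> u) (word_act D m n \<alpha> v)"
proof (induction rule: colim_eq.induct)
  case (identity j x)
  interpret simplicial_category "cd_ob D j" using identity by (intro cd_scat)
  show ?case using identity colim_eq.identity[of j J x D m] 
    by (simp add: word_act_simps simplicial_set.degen_act hom_sset idn_closed)
next
  case (composite j x y z g h)
  interpret simplicial_category "cd_ob D j" using composite by (intro cd_scat)
  show ?case using composite colim_eq.composite[of j J x D y z "act (hom (cd_ob D j) x y) m n \<alpha> g" m "act (hom (cd_ob D j) y z) m n \<alpha> h"]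
    by (simp add: word_act_simps hom_act_closed cmp_act)
next
  case (arrow j k f x y g)
  interpret simplicial_functor "cd_ob D j" "cd_ob D k" "cd_map D j k f" using arrow by (intro cd_functor)
  show ?case using arrow colim_eq.arrow[of j J k f x D y "act (hom (cd_ob D j) x y) m n \<alpha> g" m]
    by (simp add: word_act_simps hom_act_closed sset_mapD(2)[OF fmo_map])
next
  case (trans X Y u v w)
  show ?case by (rule colim_eq.trans[OF trans.IH[OF trans.prems]])
next
  case (append X Y u u' Z v v')
  then show ?case by (simp add: word_act_simps colim_eq.append)
qed (simp_all add: colim_eq.refl colim_eq.sym word_act_closed)

lemma C_simplices: "simplices (hom C X Y) n = {colim_class J D n X Y u | u. colim_word J D n X Y u}"
  by (simp add: scat_colim_def)

lemma C_act:
  "colim_word J D n X Y u \<Longrightarrow> \<alpha> \<in> Delta m n \<Longrightarrow>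
    act (hom C X Y) m n \<alpha> (colim_class J D n X Y u) = colim_class J D m X Y (word_act D m n \<alpha> u)"
  by (simp add: scat_colim_def) (rule class_UN, simp, rule class_eqI, rule colim_eq.sym, rule eq_act)

lemma C_cmp:
  assumes "colim_word J D n X Y u" "colim_word J D n Y Z v"
  shows "cmp C X Y Z n (colim_class J D n X Y u) (colim_class J D n Y Z v) = colim_class J D n X Z (u @ v)"
proof -
  have "(\<Union>v\<in>colim_class J D n Y Z v. colim_class J D n X Z (u' @ v)) = colim_class J D n X Z (u' @ v)"
    if "colim_word J D n X Y u'" for u'
    by (rule class_UN[OF assms(2)], rule class_eqI, rule colim_eq.append[OF colim_eq.refl[OF that] colim_eq.sym])
  moreover have "(\<Union>u\<in>colim_class J D n X Y u. colim_class J D n X Z (u @ v)) = colim_class J D n X Z (u @ v)"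
    by (rule class_UN[OF assms(1)], rule class_eqI, rule colim_eq.append[OF colim_eq.sym colim_eq.refl[OF assms(2)]])
  moreover have "colim_word J D n X Y u'" if "u' \<in> colim_class J D n X Y u" for u'
    using that eq_word by (auto simp: colim_class_def)
  ultimately show ?thesis by (simp add: scat_colim_def)
qed

lemma C_idn: "idn C X = colim_class J D 0 X X []"
  by (simp add: scat_colim_def)

lemma word_act_id: "colim_word J D n X Y u \<Longrightarrow> word_act D n n (idD n) u = u"
proof (induction rule: colim_word.induct)
  case (Cons j x y g Z u)
  then show ?case
    by (simp only: word_act_simps simplicial_set.act_id[OF simplicial_category.hom_sset[OF cd_scat]])
qed (simp add: word_act_simps)

lemma word_act_compose:
  assumes "\<alpha> \<in> Delta l m" "\<beta> \<in> Delta m n"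
  shows "colim_word J D n X Y u \<Longrightarrow>
    word_act D l n (compose {..l} \<beta> \<alpha>) u = word_act D l m \<alpha> (word_act D m n \<beta> u)"
proof (induction rule: colim_word.induct)
  case (Cons j x y g Z u)
  then show ?case using simplicial_set.act_compose[OF simplicial_category.hom_sset[OF cd_scat]] assms
    by (simp add: word_act_simps)
qed (simp add: word_act_simps)

lemma C_hom_sset: "simplicial_set (hom C X Y)"
proof
  fix \<alpha> m n c assume "\<alpha> \<in> Delta m n" "c \<in> simplices (hom C X Y) n"
  then show "act (hom C X Y) m n \<alpha> c \<in> simplices (hom C X Y) m"
    by (auto simp: C_simplices C_act intro: word_act_closed)
next
  fix n c assume "c \<in> simplices (hom C X Y) n"
  then show "act (hom C X Y) n n (idD n) c = c"
    by (auto simp: C_simplices C_act Delta_idD word_act_id)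
next
  fix \<alpha> \<beta> l m n c assume "\<alpha> \<in> Delta l m" "\<beta> \<in> Delta m n" "c \<in> simplices (hom C X Y) n"
  then show "act (hom C X Y) l n (compose {..l} \<beta> \<alpha>) c = act (hom C X Y) l m \<alpha> (act (hom C X Y) m n \<beta> c)"
    by (auto simp: C_simplices C_act Delta_compose word_act_closed word_act_compose)
qed

lemma C_degen: "X \<in> obj C \<Longrightarrow> degen (hom C X X) n (idn C X) = colim_class J D n X X []"
  by (simp add: degen_def C_idn C_act word_Nil Delta_constD word_act_simps)

theorem simplicial_category_scat_colim: "simplicial_category C"
proof (rule simplicial_category.intro)
  fix x y z n g h \<alpha> m assume "x \<in> obj C" "y \<in> obj C" "z \<in> obj C" "\<alpha> \<in> Delta m n"
     "g \<in> simplices (hom C x y) n" "h \<in> simplices (hom C y z) n"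
  then show "cmp C x y z m (act (hom C x y) m n \<alpha> g) (act (hom C y z) m n \<alpha> h)
          = act (hom C x z) m n \<alpha> (cmp C x y z n g h)"
    by (auto simp: C_simplices C_act C_cmp word_act_closed word_append word_act_simps)
next
  fix x assume "x \<in> obj C"
  then show "idn C x \<in> simplices (hom C x x) 0" by (auto simp: C_idn C_simplices intro: word_Nil)
qed (auto simp: C_hom_sset C_degen C_simplices C_cmp word_Nil word_append intro: word_append)

lemma inj_simps [simp]: "fob (scat_colim_inj J D j) x = Q j x"
  "fmo (scat_colim_inj J D j) x y n g = colim_class J D n (Q j x) (Q j y) [(j, x, y, g)]"
  by (simp_all add: scat_colim_inj_def)

theorem scat_cocone_scat_colim: "scat_cocone J D C (scat_colim_inj J D)"
  unfolding scat_cocone_def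
proof (intro conjI ballI)
  fix j assume j: "j \<in> Ob J"
  interpret simplicial_category "cd_ob D j" using j by (intro cd_scat)
  show "simplicial_functor (cd_ob D j) C (scat_colim_inj J D j)"
  proof (rule simplicial_functor.intro, unfold inj_simps)
    fix x assume "x \<in> obj (cd_ob D j)"
    then show "Q j x \<in> obj C" using j by (auto simp: obC)
  next
    fix x y assume xy: "x \<in> obj (cd_ob D j)" "y \<in> obj (cd_ob D j)"
    have "colim_class J D n (Q j x) (Q j y) [(j, x, y, g)] \<in> simplices (hom C (Q j x) (Q j y)) n"
      if "g \<in> simplices (hom (cd_ob D j) x y) n" for n g
      using word_single[OF j xy that] unfolding C_simplices by blast
    moreover have "colim_class J D m (Q j x) (Q j y) [(j, x, y, act (hom (cd_ob D j) x y) m n \<alpha> g)] =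
      act (hom C (Q j x) (Q j y)) m n \<alpha> (colim_class J D n (Q j x) (Q j y) [(j, x, y, g)])"
      if "\<alpha> \<in> Delta m n" "g \<in> simplices (hom (cd_ob D j) x y) n" for m n \<alpha> g
      using C_act[OF word_single[OF j xy that(2)] that(1)] by (simp add: word_act_simps)
    ultimately show "sset_map (hom (cd_ob D j) x y) (hom C (Q j x) (Q j y))
        (\<lambda>n g. colim_class J D n (Q j x) (Q j y) [(j, x, y, g)])"
      by (simp add: sset_map_def)
  next
    fix x assume x: "x \<in> obj (cd_ob D j)"
    then show "colim_class J D 0 (Q j x) (Q j x) [(j, x, x, idn (cd_ob D j) x)] = idn C (Q j x)"
      using class_eqI[OF colim_eq.identity[OF j x, of 0]]
      by (simp add: C_idn simplicial_set.degen_0 hom_sset idn_closed)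
  next
    fix x y z n g h assume a: "x \<in> obj (cd_ob D j)" "y \<in> obj (cd_ob D j)" "z \<in> obj (cd_ob D j)"
      "g \<in> simplices (hom (cd_ob D j) x y) n" "h \<in> simplices (hom (cd_ob D j) y z) n"
    show "colim_class J D n (Q j x) (Q j z) [(j, x, z, cmp (cd_ob D j) x y z n g h)] =
      cmp C (Q j x) (Q j y) (Q j z) n (colim_class J D n (Q j x) (Q j y) [(j, x, y, g)])
       (colim_class J D n (Q j y) (Q j z) [(j, y, z, h)])"
      using C_cmp[OF word_single[OF j a(1,2,4)] word_single[OF j a(2,3,5)]]
        class_eqI[OF colim_eq.composite[OF j a]] by simp
  qed
next
  fix j k f assume a: "j \<in> Ob J" "k \<in> Ob J" "f \<in> Ar J j k"
  show "sfun_eq (cd_ob D j) (sfun_comp (scat_colim_inj J D k) (cd_map D j k f)) (scat_colim_inj J D j)"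
    using class_eqI[OF colim_eq.arrow[OF a]] by (simp add: sfun_eq_def sfun_comp_def colim_ob_arrow[OF a])
qed

end

lemma simplicial_functor_degen:
  assumes "simplicial_functor C E F" "simplicial_category C" "x \<in> obj C"
  shows "fmo F x x n (degen (hom C x x) n (idn C x)) = degen (hom E (fob F x) (fob F x)) n (idn E (fob F x))"
  using sset_map_degen[OF simplicial_functor.fmo_map[OF assms(1,3,3)] simplicial_category.idn_closed[OF assms(2,3)]]
  by (simp add: simplicial_functor.fmo_idn[OF assms(1,3)])

locale scat_cocone_under = scat_diagram J D + E: simplicial_category E
  for J :: "('j, 'f) cat" and D :: "('j, 'f, 'o, 'm) cdiag" and E :: "('p, 'q) scat" +
  fixes \<kappa> :: "'j \<Rightarrow> ('o, 'm, 'p, 'q) sfun"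
  assumes cocone: "scat_cocone J D E \<kappa>"
begin

definition GO :: "('j \<times> 'o) set \<Rightarrow> 'p" where
  "GO X = the_elem ((\<lambda>(j, x). fob (\<kappa> j) x) ` X)"

lemma GO: "GO (Q j x) = fob (\<kappa> j) x"
proof -
  let ?h = "\<lambda>(j, x). fob (\<kappa> j) x"
  have step: "?h p = ?h q" if "colim_ob_step J D p q" for p q
    using that cocone by cases (auto simp: scat_cocone_def sfun_eq_def sfun_comp_def)
  have "?h ` Q j x = {?h (j, x)}"
  proof (intro equalityI subsetI)
    fix z assume "z \<in> ?h ` Q j x"
    then obtain q where "equivclp (colim_ob_step J D) (j, x) q" "z = ?h q" by (auto simp: colim_ob_def)
    with equivclp_lift[OF this(1), of ?h, OF step] show "z \<in> {?h (j, x)}" by simp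
  qed (auto simp: colim_ob_def intro!: image_eqI[of _ _ "(j, x)"])
  then show ?thesis by (simp add: GO_def)
qed

lemma kfun: "j \<in> Ob J \<Longrightarrow> simplicial_functor (cd_ob D j) E (\<kappa> j)"
  using cocone by (simp add: scat_cocone_def)

lemma GO_closed: "X \<in> obj C \<Longrightarrow> GO X \<in> obj E"
  by (auto simp: obC GO intro: simplicial_functor.fob_closed[OF kfun])

fun ev :: "nat \<Rightarrow> 'p \<Rightarrow> ('j, 'o, 'm) word \<Rightarrow> 'q" where
  "ev n y [] = degen (hom E y y) n (idn E y)"
| "ev n y ((j, x, x', g) # u) =
    cmp E (fob (\<kappa> j) x) (fob (\<kappa> j) x') y n (fmo (\<kappa> j) x x' n g) (ev n y u)"

lemma ev_closed: "colim_word J D n X Y u \<Longrightarrow> ev n (GO Y) u \<in> simplices (hom E (GO X) (GO Y)) n"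
proof (induction rule: colim_word.induct)
  case (Nil j x)
  then have "Q j x \<in> obj C" by (auto simp: obC)
  then show ?case using GO_closed[of "Q j x"]
    by (auto intro!: simplicial_set.degen_closed E.hom_sset E.idn_closed)
next
  case (Cons j x y g Z u)
  then have "GO Z \<in> obj E" using word_ob GO_closed by blast
  then show ?case using Cons kfun[of j]
    by (auto simp: GO intro!: E.cmp_closed simplicial_functor.fob_closed sset_mapD(1)[OF simplicial_functor.fmo_map])
qed

lemma ev_append: "colim_word J D n X Y u \<Longrightarrow> colim_word J D n Y Z v \<Longrightarrow>
   ev n (GO Z) (u @ v) = cmp E (GO X) (GO Y) (GO Z) n (ev n (GO Y) u) (ev n (GO Z) v)"
proof (induction rule: colim_word.induct)
  case (Nil j x)
  then show ?case using ev_closed[OF Nil(3)] word_ob[OF Nil(3)] GO_closed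
    by (auto intro!: E.cmp_idn_left[symmetric])
next
  case (Cons j x y g Y u)
  then have "GO Z \<in> obj E" "GO Y \<in> obj E" using word_ob GO_closed by blast+
  then show ?case using Cons kfun[of j] ev_closed[OF Cons(5)] ev_closed[OF Cons.prems]
    by (auto simp: GO intro!: E.cmp_assoc[symmetric] simplicial_functor.fob_closed sset_mapD(1)[OF simplicial_functor.fmo_map])
qed

lemma ev_single:
  assumes "j \<in> Ob J" "x \<in> obj (cd_ob D j)" "y \<in> obj (cd_ob D j)" "g \<in> simplices (hom (cd_ob D j) x y) n"
  shows "ev n (GO (Q j y)) [(j, x, y, g)] = fmo (\<kappa> j) x y n g"
proof -
  interpret simplicial_functor "cd_ob D j" E "\<kappa> j" using assms(1) by (rule kfun)
  show ?thesis using assms by (simp add: GO E.cmp_idn_right fob_closed sset_mapD(1)[OF fmo_map])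
qed

lemma ev_eq: "colim_eq J D n X Y u v \<Longrightarrow> ev n (GO Y) u = ev n (GO Y) v"
proof (induction rule: colim_eq.induct)
  case (append X Y u u' Z v v')
  then show ?case using eq_word by (metis ev_append)
next
  case (identity j x)
  then show ?case using simplicial_functor_degen[OF kfun cd_scat]
    ev_single[of j x x "degen (hom (cd_ob D j) x x) n (idn (cd_ob D j) x)" n]
    eq_word[OF colim_eq.identity[OF identity, of n]]
    by (auto simp: GO intro!: ev_single simplicial_set.degen_closed simplicial_category.hom_sset simplicial_category.idn_closed cd_scat)
next
  case (composite j x y z g h)
  interpret simplicial_functor "cd_ob D j" E "\<kappa> j" using composite(1) by (rule kfun)
  interpret simplicial_category "cd_ob D j" using composite by (intro cd_scat)
  show ?case using composite by (simp add: GO E.cmp_idn_right fob_closed fmo_cmp sset_mapD(1)[OF fmo_map] cmp_closed E.cmp_closed)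
next
  case (arrow j k f x y g)
  interpret F: simplicial_functor "cd_ob D j" "cd_ob D k" "cd_map D j k f" using arrow by (intro cd_functor)
  have "fmo (\<kappa> j) x y n g = fmo (\<kappa> k) (fob (cd_map D j k f) x) (fob (cd_map D j k f) y) n (fmo (cd_map D j k f) x y n g)"
    using cocone arrow by (simp add: scat_cocone_def sfun_eq_def sfun_comp_def)
  then show ?case 
    using ev_single[OF arrow(1,4-6)]
      ev_single[OF arrow(2) F.fob_closed[OF arrow(4)] F.fob_closed[OF arrow(5)]
        sset_mapD(1)[OF F.fmo_map[OF arrow(4,5)] arrow(6)]] arrow
    by (simp add: colim_ob_arrow del: ev.simps)
qed auto

lemma ev_act: "colim_word J D n X Y u \<Longrightarrow> \<alpha> \<in> Delta m n \<Longrightarrow>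
  ev m (GO Y) (word_act D m n \<alpha> u) = act (hom E (GO X) (GO Y)) m n \<alpha> (ev n (GO Y) u)"
proof (induction rule: colim_word.induct)
  case (Nil j x)
  then have "GO (Q j x) \<in> obj E" by (intro GO_closed) (auto simp: obC)
  then show ?case using Nil by (simp add: word_act_simps simplicial_set.degen_act E.hom_sset E.idn_closed)
next
  case (Cons j x y g Y u)
  then have "GO Y \<in> obj E" using word_ob GO_closed by blast+
  then show ?case using Cons kfun[of j] ev_closed[OF Cons(5)] 
    by (auto simp: GO word_act_simps sset_mapD(2)[OF simplicial_functor.fmo_map[of "cd_ob D j"]]
      intro!: E.cmp_act simplicial_functor.fob_closed sset_mapD(1)[OF simplicial_functor.fmo_map])
qed

definition G :: "(('j \<times> 'o) set, ('j, 'o, 'm) word set, 'p, 'q) sfun" where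
  "G = \<lparr>fob = GO, fmo = \<lambda>X Y n c. the_elem (ev n (GO Y) ` c)\<rparr>"

lemma G_class:
  assumes "colim_word J D n X Y u"
  shows "fmo G X Y n (colim_class J D n X Y u) = ev n (GO Y) u"
proof -
  have "ev n (GO Y) ` colim_class J D n X Y u = {ev n (GO Y) u}"
    using class_self[OF assms] by (auto simp: colim_class_def dest: ev_eq)
  then show ?thesis by (simp add: G_def)
qed

lemma G_ob [simp]: "fob G = GO" by (simp add: G_def)

lemma G_functor: "simplicial_functor C E G"
proof (rule simplicial_functor.intro)
  fix X Y assume "X \<in> obj C" "Y \<in> obj C"
  then show "sset_map (hom C X Y) (hom E (fob G X) (fob G Y)) (fmo G X Y)"
    by (auto simp: sset_map_def C_simplices G_class ev_closed C_act word_act_closed ev_act)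
next
  fix X assume "X \<in> obj C"
  then show "fmo G X X 0 (idn C X) = idn E (fob G X)"
    by (simp add: C_idn G_class word_Nil simplicial_set.degen_0 E.hom_sset E.idn_closed GO_closed)
qed (auto simp: GO_closed C_simplices C_cmp G_class word_append ev_append)

lemma G_factor: "j \<in> Ob J \<Longrightarrow> sfun_eq (cd_ob D j) (sfun_comp G (scat_colim_inj J D j)) (\<kappa> j)"
  by (auto simp: sfun_eq_def sfun_comp_def GO G_class word_single ev_single[unfolded GO] simp del: ev.simps)

end

theorem (in scat_diagram) scat_colim_unique:
  assumes E: "simplicial_category E" and F: "simplicial_functor C E F" and G: "simplicial_functor C E G"
    and eq: "\<And>j. j \<in> Ob J \<Longrightarrow> sfun_eq (cd_ob D j) (sfun_comp F (scat_colim_inj J D j)) (sfun_comp G (scat_colim_inj J D j))"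
  shows "sfun_eq C F G"
proof -
  interpret F: simplicial_functor C E F by fact
  interpret G: simplicial_functor C E G by fact
  have ob: "fob F (Q j x) = fob G (Q j x)" if "j \<in> Ob J" "x \<in> obj (cd_ob D j)" for j x
    using eq that by (simp add: sfun_eq_def sfun_comp_def)
  have "fmo F X Y n (colim_class J D n X Y u) = fmo G X Y n (colim_class J D n X Y u)"
    if "colim_word J D n X Y u" for X Y n u
    using that
  proof (induction rule: colim_word.induct)
    case (Nil j x)
    then have "Q j x \<in> obj C" by (auto simp: obC)
    then show ?case
      using simplicial_functor_degen[OF F simplicial_category_scat_colim, of "Q j x" n] 
        simplicial_functor_degen[OF G simplicial_category_scat_colim, of "Q j x" n] ob[OF Nil]
      by (simp add: C_degen)
  next
    case (Cons j x y g Z u)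
    have obs: "Q j x \<in> obj C" "Q j y \<in> obj C" "Z \<in> obj C" using Cons word_ob by (auto simp: obC)
    have w: "colim_word J D n (Q j x) (Q j y) [(j, x, y, g)]" using Cons by (intro word_single)
    have c: "colim_class J D n (Q j x) Z ((j, x, y, g) # u) = cmp C (Q j x) (Q j y) Z n
       (colim_class J D n (Q j x) (Q j y) [(j, x, y, g)]) (colim_class J D n (Q j y) Z u)"
      using C_cmp[OF w Cons(5)] by simp
    have "fmo F (Q j x) (Q j y) n (colim_class J D n (Q j x) (Q j y) [(j, x, y, g)]) =
      fmo G (Q j x) (Q j y) n (colim_class J D n (Q j x) (Q j y) [(j, x, y, g)])"
      using eq[of j] Cons by (simp add: sfun_eq_def sfun_comp_def)
    moreover have "fob F Z = fob G Z" using obs ob by (auto simp: obC)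
    moreover have cl: "colim_class J D n (Q j x) (Q j y) [(j, x, y, g)] \<in> simplices (hom C (Q j x) (Q j y)) n"
      "colim_class J D n (Q j y) Z u \<in> simplices (hom C (Q j y) Z) n"
      using w Cons(5) unfolding C_simplices by blast+
    ultimately show ?case unfolding c F.fmo_cmp[OF obs cl] G.fmo_cmp[OF obs cl]
      using Cons.IH ob Cons(1-3) by simp
  qed
  then show ?thesis using ob by (auto simp: sfun_eq_def obC C_simplices)
qed

theorem (in scat_diagram) scat_colim_universal:
  assumes "simplicial_category E" and "scat_cocone J D E \<kappa>"
  shows "\<exists>F. simplicial_functor C E F \<and>
      (\<forall>j\<in>Ob J. sfun_eq (cd_ob D j) (sfun_comp F (scat_colim_inj J D j)) (\<kappa> j)) \<and>
      (\<forall>F'. simplicial_functor C E F' \<and>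
        (\<forall>j\<in>Ob J. sfun_eq (cd_ob D j) (sfun_comp F' (scat_colim_inj J D j)) (\<kappa> j)) \<longrightarrow> sfun_eq C F' F)"
proof -
  interpret S: scat_cocone_under J D E \<kappa>
    using assms by (intro scat_cocone_under.intro scat_cocone_under_axioms.intro scat_diagram_axioms)
  have "sfun_eq C F' S.G" if "simplicial_functor C E F'" 
    "\<forall>j\<in>Ob J. sfun_eq (cd_ob D j) (sfun_comp F' (scat_colim_inj J D j)) (\<kappa> j)" for F'
    using that S.G_factor by (intro scat_colim_unique[OF assms(1) that(1) S.G_functor]) (auto simp: sfun_eq_def)
  then show ?thesis using S.G_functor S.G_factor by blast
qed


section \<open>Functoriality of the data\<close>

lemma nerve_simps:
  "c \<in> simplices (nerve P) n \<longleftrightarrow> c \<in> {..n} \<rightarrow>\<^sub>E P \<and> (\<forall>r s. r \<le> s \<longrightarrow> s \<le> n \<longrightarrow> c r \<le> c s)"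
  "act (nerve P) m n \<alpha> c = compose {..m} c \<alpha>"
  by (auto simp: nerve_def mono_on_def)

lemma degen_nerve: "degen (nerve P) n v = (\<lambda>r\<in>{..n}. v 0)"
  by (auto simp: degen_def nerve_simps compose_def intro!: restrict_ext)

lemma simplex_scat_simps:
  "obj (simplex_scat n) = {..n}"
  "hom (simplex_scat n) i j = (if i \<le> j then nerve (nec_poset ({0, j - i}, j - i)) else empty_sset)"
  "idn (simplex_scat n) i = (\<lambda>r\<in>{..0}. {0})"
  "cmp (simplex_scat n) i j k m c d = (\<lambda>r\<in>{..m}. c r \<union> (+) (j - i) ` d r)"
  by (simp_all add: simplex_scat_def)

lemma nec_poset_iff: "V \<in> nec_poset (T, p) \<longleftrightarrow> T \<subseteq> V \<and> V \<subseteq> {..p}"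
  by (simp add: nec_poset_def)

lemma simplex_scat_hom:
  "g \<in> simplices (hom (simplex_scat n) i j) m \<longleftrightarrow> i \<le> j \<and> g \<in> extensional {..m} \<and>
     (\<forall>r\<le>m. {0, j - i} \<subseteq> g r \<and> g r \<subseteq> {..j - i}) \<and> (\<forall>r s. r \<le> s \<longrightarrow> s \<le> m \<longrightarrow> g r \<subseteq> g s)"
  by (auto simp: simplex_scat_simps nerve_simps nec_poset_iff PiE_iff empty_sset_def)

lemma simplicial_category_simplex_scat: "simplicial_category (simplex_scat n)"
proof (rule simplicial_category.intro)
  show "simplicial_set (hom (simplex_scat n) x y)" for x y
    by (simp add: simplex_scat_simps simplicial_set_nerve simplicial_set_empty)
  show "idn (simplex_scat n) x \<in> simplices (hom (simplex_scat n) x x) 0" for x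
    by (simp add: simplex_scat_hom) (simp add: simplex_scat_simps)
next
  fix x y z g h m
  assume g: "g \<in> simplices (hom (simplex_scat n) x y) m" and h: "h \<in> simplices (hom (simplex_scat n) y z) m"
  have "{0, z - x} \<subseteq> g r \<union> (+) (y - x) ` h r \<and> g r \<union> (+) (y - x) ` h r \<subseteq> {..z - x}" if "r \<le> m" for r
  proof -
    have "z - y \<in> h r" "h r \<subseteq> {..z - y}" "0 \<in> g r" "g r \<subseteq> {..y - x}" "x \<le> y" "y \<le> z"
      using g h that by (auto simp: simplex_scat_hom)
    moreover from this have "z - x \<in> (+) (y - x) ` h r" by (auto intro: rev_image_eqI)
    ultimately show ?thesis by auto
  qed
  moreover have "g r \<union> (+) (y - x) ` h r \<subseteq> g s \<union> (+) (y - x) ` h s" if "r \<le> s" "s \<le> m" for r s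
    using g h that unfolding simplex_scat_hom by (intro Un_mono image_mono) auto
  ultimately show "cmp (simplex_scat n) x y z m g h \<in> simplices (hom (simplex_scat n) x z) m"
    using g h by (simp add: simplex_scat_hom) (simp add: simplex_scat_simps)
next
  fix x y z g h k m \<alpha>
  assume "\<alpha> \<in> Delta k m" "g \<in> simplices (hom (simplex_scat n) x y) m" "h \<in> simplices (hom (simplex_scat n) y z) m"
  moreover from this have "x \<le> y" "y \<le> z" by (simp_all add: simplex_scat_hom)
  ultimately show "cmp (simplex_scat n) x y z k (act (hom (simplex_scat n) x y) k m \<alpha> g)
      (act (hom (simplex_scat n) y z) k m \<alpha> h) =
    act (hom (simplex_scat n) x z) k m \<alpha> (cmp (simplex_scat n) x y z m g h)"
    by (auto simp: simplex_scat_simps nerve_simps compose_def dest: Delta_apply intro!: restrict_ext)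
next
  fix x y g m
  assume g: "g \<in> simplices (hom (simplex_scat n) x y) m"
  then have e: "g \<in> extensional {..m}" "insert 0 (g r) = g r" "g r \<union> {y - x} = g r" if "r \<le> m" for r
    using that by (auto simp: simplex_scat_hom)
  show "cmp (simplex_scat n) x x y m (degen (hom (simplex_scat n) x x) m (idn (simplex_scat n) x)) g = g"
    using e by (intro extensionalityI[of _ "{..m}"]) (auto simp: simplex_scat_simps degen_nerve)
  show "cmp (simplex_scat n) x y y m g (degen (hom (simplex_scat n) y y) m (idn (simplex_scat n) y)) = g"
    using e by (intro extensionalityI[of _ "{..m}"]) (auto simp: simplex_scat_simps degen_nerve)
next
  fix w x y z f g h m
  assume "f \<in> simplices (hom (simplex_scat n) w x) m" "g \<in> simplices (hom (simplex_scat n) x y) m"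
  then have "y - w = (x - w) + (y - x)" by (simp add: simplex_scat_hom)
  then show "cmp (simplex_scat n) w y z m (cmp (simplex_scat n) w x y m f g) h =
    cmp (simplex_scat n) w x z m f (cmp (simplex_scat n) x y z m g h)"
    by (auto simp: simplex_scat_simps image_Un image_image add.assoc intro!: restrict_ext)
qed

lemma simplex_scat_hom_bound:
  assumes "c \<in> simplices (hom (simplex_scat n) x y) m" "y \<le> n" "r \<le> m" "v \<in> c r"
  shows "x + v \<le> n"
proof -
  have "x \<le> y" "v \<le> y - x" using assms by (auto simp: simplex_scat_hom)
  then show ?thesis using assms(2) by simp
qed

lemma simplex_scat_map_simps:
  "fob (simplex_scat_map \<alpha>) = \<alpha>"
  "fmo (simplex_scat_map \<alpha>) i j m c = (\<lambda>r\<in>{..m}. (\<lambda>v. \<alpha> (i + v) - \<alpha> i) ` c r)"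
  by (auto simp: simplex_scat_map_def nerve_map_def compose_def)

lemma simplicial_functor_simplex_scat_map:
  assumes \<alpha>: "\<alpha> \<in> Delta n p"
  shows "simplicial_functor (simplex_scat n) (simplex_scat p) (simplex_scat_map \<alpha>)"
proof (rule simplicial_functor.intro)
  fix x y assume "x \<in> obj (simplex_scat n)" "y \<in> obj (simplex_scat n)"
  then have xy: "x \<le> n" "y \<le> n" by (simp_all add: simplex_scat_simps)
  have "fmo (simplex_scat_map \<alpha>) x y m g \<in> simplices (hom (simplex_scat p) (\<alpha> x) (\<alpha> y)) m"
    if g: "g \<in> simplices (hom (simplex_scat n) x y) m" for m g
  proof -
    have le: "x \<le> y" "\<alpha> x \<le> \<alpha> y" using g xy Delta_mono[OF \<alpha>] by (auto simp: simplex_scat_hom)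
    have "{0, \<alpha> y - \<alpha> x} \<subseteq> (\<lambda>v. \<alpha> (x + v) - \<alpha> x) ` g r \<and> (\<lambda>v. \<alpha> (x + v) - \<alpha> x) ` g r \<subseteq> {..\<alpha> y - \<alpha> x}" if "r \<le> m" for r
    proof -
      have r: "0 \<in> g r" "y - x \<in> g r" "g r \<subseteq> {..y - x}" using g that by (auto simp: simplex_scat_hom)
      have "\<alpha> (x + v) - \<alpha> x \<le> \<alpha> y - \<alpha> x" if "v \<in> g r" for v
        using r(3) that le xy by (intro diff_le_mono Delta_mono[OF \<alpha>]) auto
      moreover have "0 \<in> (\<lambda>v. \<alpha> (x + v) - \<alpha> x) ` g r" using r(1) by (rule rev_image_eqI) simp
      moreover have "\<alpha> y - \<alpha> x \<in> (\<lambda>v. \<alpha> (x + v) - \<alpha> x) ` g r" using r(2) by (rule rev_image_eqI) (simp add: le)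
      ultimately show ?thesis by blast
    qed
    moreover have "(\<lambda>v. \<alpha> (x + v) - \<alpha> x) ` g r \<subseteq> (\<lambda>v. \<alpha> (x + v) - \<alpha> x) ` g s" if "r \<le> s" "s \<le> m" for r s
      using g that unfolding simplex_scat_hom by (intro image_mono) auto
    ultimately show ?thesis using le
      by (simp add: simplex_scat_hom) (simp add: simplex_scat_map_simps)
  qed
  moreover have "fmo (simplex_scat_map \<alpha>) x y k (act (hom (simplex_scat n) x y) k m \<beta> g) =
    act (hom (simplex_scat p) (\<alpha> x) (\<alpha> y)) k m \<beta> (fmo (simplex_scat_map \<alpha>) x y m g)"
    if \<beta>: "\<beta> \<in> Delta k m" and g: "g \<in> simplices (hom (simplex_scat n) x y) m" for k m \<beta> g
  proof -
    have "x \<le> y" "\<alpha> x \<le> \<alpha> y" using g xy Delta_mono[OF \<alpha>] by (auto simp: simplex_scat_hom)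
    then show ?thesis using Delta_apply[OF \<beta>]
      by (auto simp: simplex_scat_simps simplex_scat_map_simps nerve_simps compose_def intro!: restrict_ext)
  qed
  ultimately show "sset_map (hom (simplex_scat n) x y) (hom (simplex_scat p) (fob (simplex_scat_map \<alpha>) x)
     (fob (simplex_scat_map \<alpha>) y)) (fmo (simplex_scat_map \<alpha>) x y)"
    by (simp add: sset_map_def simplex_scat_map_simps(1))
next
  fix x y z g h m
  assume "x \<in> obj (simplex_scat n)" "y \<in> obj (simplex_scat n)" "z \<in> obj (simplex_scat n)" and
    g: "g \<in> simplices (hom (simplex_scat n) x y) m" and h: "h \<in> simplices (hom (simplex_scat n) y z) m"
  then have le: "x \<le> y" "y \<le> z" "z \<le> n" "y \<le> n" "x \<le> n" by (auto simp: simplex_scat_hom simplex_scat_simps(1))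
  have "\<alpha> (x + (y - x + v)) - \<alpha> x = \<alpha> y - \<alpha> x + (\<alpha> (y + v) - \<alpha> y)" if "r \<le> m" "v \<in> h r" for r v
  proof -
    have "v \<le> z - y" using h that by (auto simp: simplex_scat_hom)
    then have "\<alpha> y \<le> \<alpha> (y + v)" "\<alpha> x \<le> \<alpha> y" using le by (auto intro!: Delta_mono[OF \<alpha>])
    then show ?thesis using le by simp
  qed
  then have "(\<lambda>v. \<alpha> (x + v) - \<alpha> x) ` ((+) (y - x) ` h r) = (+) (\<alpha> y - \<alpha> x) ` ((\<lambda>v. \<alpha> (y + v) - \<alpha> y) ` h r)"
    if "r \<le> m" for r
    using that unfolding image_image by (intro image_cong) auto
  then show "fmo (simplex_scat_map \<alpha>) x z m (cmp (simplex_scat n) x y z m g h) =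
    cmp (simplex_scat p) (fob (simplex_scat_map \<alpha>) x) (fob (simplex_scat_map \<alpha>) y) (fob (simplex_scat_map \<alpha>) z) m
      (fmo (simplex_scat_map \<alpha>) x y m g) (fmo (simplex_scat_map \<alpha>) y z m h)"
    by (simp add: simplex_scat_map_simps simplex_scat_simps image_Un cong: restrict_cong)
qed (use Delta_apply[OF \<alpha>] in \<open>auto simp: simplex_scat_simps simplex_scat_map_simps intro!: restrict_ext\<close>)

theorem small_category_simplex_category:
  assumes "simplicial_set K"
  shows "small_category (simplex_category K)"
proof -
  interpret simplicial_set K by fact
  show ?thesis
    by (rule small_category.intro)
      (auto simp: simplex_category_def Delta_idD act_id Delta_compose act_compose compose_idD_left
        compose_idD_right Delta_compose_assoc)
qed

theorem scat_diagram_simplex_diagram: "scat_diagram (simplex_category K) simplex_diagram"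
proof (rule scat_diagram.intro)
  fix i j k f g assume "i \<in> Ob (simplex_category K)" "j \<in> Ob (simplex_category K)" "k \<in> Ob (simplex_category K)"
    "f \<in> Ar (simplex_category K) i j" "g \<in> Ar (simplex_category K) j k"
  then obtain l m n where ijk: "fst i = l" "fst j = m" "fst k = n" "f \<in> Delta l m" "g \<in> Delta m n"
    by (auto simp: simplex_category_def split: prod.splits)
  have comp: "Cp (simplex_category K) i j k g f = compose {..l} g f"
    using ijk by (auto simp: simplex_category_def split: prod.splits)
  have ob: "cd_ob simplex_diagram i = simplex_scat l"
    using ijk by (auto simp: simplex_diagram_def split: prod.splits)
  have img: "(\<lambda>v. compose {..l} g f (x + v) - compose {..l} g f x) ` c r =
      (\<lambda>v. g (f x + v) - g (f x)) ` (\<lambda>v. f (x + v) - f x) ` c r"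
    if "x \<le> l" "y \<le> l" "c \<in> simplices (hom (simplex_scat l) x y) p" "r \<le> p" for x y c p r
    unfolding image_image
  proof (rule image_cong[OF HOL.refl])
    fix v assume "v \<in> c r"
    then have "x + v \<le> l" by (rule simplex_scat_hom_bound[OF that(3,2,4)])
    then show "compose {..l} g f (x + v) - compose {..l} g f x = g (f x + (f (x + v) - f x)) - g (f x)"
      using Delta_mono[OF ijk(4), of x "x + v"] by (simp add: compose_eq)
  qed
  have "fmo (simplex_scat_map (compose {..l} g f)) x y p c =
      fmo (simplex_scat_map g) (f x) (f y) p (fmo (simplex_scat_map f) x y p c)"
    if "x \<le> l" "y \<le> l" "c \<in> simplices (hom (simplex_scat l) x y) p" for x y c p
    unfolding simplex_scat_map_simps(2) by (rule restrict_ext) (simp add: img[OF that])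
  then show "sfun_eq (cd_ob simplex_diagram i) (cd_map simplex_diagram i k (Cp (simplex_category K) i j k g f))
     (sfun_comp (cd_map simplex_diagram j k g) (cd_map simplex_diagram i j f))"
    unfolding comp ob
    by (simp add: simplex_diagram_def sfun_eq_def sfun_comp_def simplex_scat_map_simps(1)
         simplex_scat_simps(1) compose_eq)
next
  fix j assume "j \<in> Ob (simplex_category K)"
  have "fmo (simplex_scat_map (idD n)) x y m c = c"
    if c: "x \<le> n" "y \<le> n" "c \<in> simplices (hom (simplex_scat n) x y) m" for n x y c m
  proof (rule extensionalityI[of _ "{..m}"])
    fix r assume "r \<in> {..m}"
    then have "idD n (x + v) - idD n x = v" if "v \<in> c r" for v
      using simplex_scat_hom_bound[OF c(3,2) _ that] c(1) by simp
    then have "(\<lambda>v. idD n (x + v) - idD n x) ` c r = (\<lambda>v. v) ` c r" by (intro image_cong) simp_all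
    then show "fmo (simplex_scat_map (idD n)) x y m c r = c r"
      using \<open>r \<in> {..m}\<close> by (simp only: simplex_scat_map_simps restrict_apply' image_ident)
  qed (use c(3) in \<open>simp_all add: simplex_scat_map_simps(2) simplex_scat_hom\<close>)
  then show "sfun_eq (cd_ob simplex_diagram j) (cd_map simplex_diagram j j (Id (simplex_category K) j)) sfun_id"
    by (cases j) (simp add: simplex_diagram_def simplex_category_def sfun_eq_def sfun_id_def
      simplex_scat_map_simps(1) simplex_scat_simps(1))
qed (auto simp: simplex_diagram_def simplex_category_def simplicial_category_simplex_scat
       simplicial_functor_simplex_scat_map split: prod.splits)

lemma Nec_Ob: "(T, p) \<in> Ob Nec \<longleftrightarrow> 0 \<in> T \<and> p \<in> T \<and> T \<subseteq> {..p}"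
  by (simp add: Nec_def)

lemma Nec_Ar: "f \<in> Ar Nec (T, p) (U, q) \<longleftrightarrow> f \<in> Delta p q \<and> f 0 = 0 \<and> f p = q \<and> U \<subseteq> f ` T"
  by (simp add: Nec_def)

lemma Nec_Id: "Id Nec (T, p) = idD p"
  by (simp add: Nec_def)

lemma Nec_Cp: "Cp Nec (T, p) (U, q) (V, r) g f = compose {..p} g f"
  by (simp add: Nec_def)

theorem small_category_Nec: "small_category Nec"
proof (rule small_category.intro)
  fix i j k f g
  assume a: "i \<in> Ob Nec" "j \<in> Ob Nec" "k \<in> Ob Nec" "f \<in> Ar Nec i j" "g \<in> Ar Nec j k"
  obtain T p U q V r where ijk: "i = (T, p)" "j = (U, q)" "k = (V, r)" by (cases i; cases j; cases k)
  have "V \<subseteq> compose {..p} g f ` T"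
  proof
    fix v assume "v \<in> V"
    have "V \<subseteq> g ` U" "U \<subseteq> f ` T" using a by (simp_all add: ijk Nec_Ar)
    then have "v \<in> g ` f ` T" using \<open>v \<in> V\<close> by (meson image_mono subsetD)
    then obtain t where t: "t \<in> T" "v = g (f t)" by (elim imageE) simp
    then have "t \<le> p" using a by (auto simp: ijk Nec_Ob)
    then show "v \<in> compose {..p} g f ` T" using t by (intro rev_image_eqI[of t]) (simp_all add: compose_eq)
  qed
  moreover have "compose {..p} g f \<in> Delta p r"
    using a by (intro Delta_compose[of f p q g r]) (simp_all add: ijk Nec_Ar)
  ultimately show "Cp Nec i j k g f \<in> Ar Nec i k"
    using a by (simp add: ijk Nec_Ar Nec_Cp compose_eq)
next
  fix i j k l f g h
  assume "f \<in> Ar Nec i j" "g \<in> Ar Nec j k" "h \<in> Ar Nec k l"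
  then show "Cp Nec i k l h (Cp Nec i j k g f) = Cp Nec i j l (Cp Nec j k l h g) f"
    by (cases i; cases j; cases k; cases l) (simp add: Nec_Ar Nec_Cp Delta_compose_assoc)
next
  fix i assume "i \<in> Ob Nec"
  then show "Id Nec i \<in> Ar Nec i i"
    by (cases i) (auto simp: Nec_Ar Nec_Ob Nec_Id Delta_idD image_iff)
next
  fix i j f assume "f \<in> Ar Nec i j"
  moreover obtain T p U q where "i = (T, p)" "j = (U, q)" by (cases i; cases j)
  ultimately show "Cp Nec i i j f (Id Nec i) = f" "Cp Nec i j j (Id Nec j) f = f"
    by (simp_all add: Nec_Ar Nec_Id Nec_Cp compose_idD_left[of f p q] compose_idD_right[of f p q])
qed

theorem sset_diagram_nerve_P: "sset_diagram Nec nerve_P"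
proof (rule sset_diagram.intro)
  show "simplicial_set (sd_ob nerve_P j)" for j
    by (simp add: nerve_P_def simplicial_set_nerve)
next
  fix j k f assume a: "j \<in> Ob Nec" "k \<in> Ob Nec" "f \<in> Ar Nec j k"
  obtain T p U q where jk: "j = (T, p)" "k = (U, q)" by (cases j; cases k)
  have "f ` V \<in> nec_poset (U, q)" if "V \<in> nec_poset (T, p)" for V
  proof -
    have "f ` V \<subseteq> {..q}" using a that Delta_apply[of f p q] by (auto simp: jk Nec_Ar nec_poset_iff)
    moreover have "U \<subseteq> f ` T" "T \<subseteq> V" using a that by (simp_all add: jk Nec_Ar nec_poset_iff)
    ultimately show ?thesis unfolding nec_poset_iff by blast
  qed
  then show "sset_map (sd_ob nerve_P j) (sd_ob nerve_P k) (sd_map nerve_P j k f)"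
    unfolding nerve_P_def jk
    by (auto intro!: nerve_map_sset_map simp: mono_on_def image_mono)
next
  fix j x n assume "x \<in> simplices (sd_ob nerve_P j) n"
  moreover obtain T p where j: "j = (T, p)" by (cases j)
  ultimately have x: "x \<in> extensional {..n}" "\<And>r. r \<le> n \<Longrightarrow> x r \<in> nec_poset (T, p)"
    by (auto simp: nerve_P_def nerve_def PiE_iff)
  have "idD p ` V = V" if "V \<in> nec_poset (T, p)" for V
    using that by (auto simp: nec_poset_iff image_iff subset_iff)
  then show "sd_map nerve_P j j (Id Nec j) n x = x"
    using x by (intro extensionalityI[of _ "{..n}"])
      (auto simp: nerve_P_def nerve_map_def j Nec_Id compose_eq simp del: restrict_apply)
next
  fix i j k f g x n assume "x \<in> simplices (sd_ob nerve_P i) n" and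
    a: "f \<in> Ar Nec i j" "g \<in> Ar Nec j k"
  moreover obtain T p U q V r where ijk: "i = (T, p)" "j = (U, q)" "k = (V, r)" by (cases i; cases j; cases k)
  ultimately have x: "x \<in> extensional {..n}" "\<And>r. r \<le> n \<Longrightarrow> x r \<in> nec_poset (T, p)"
    by (auto simp: nerve_P_def nerve_def PiE_iff)
  have "compose {..p} g f ` W = g ` f ` W" if "W \<in> nec_poset (T, p)" for W
    using that unfolding image_image by (intro image_cong) (auto simp: nec_poset_iff compose_eq)
  then show "sd_map nerve_P i k (Cp Nec i j k g f) n x = sd_map nerve_P j k g n (sd_map nerve_P i j f n x)"
    using x by (intro extensionalityI[of _ "{..n}"])
      (auto simp: nerve_P_def nerve_map_def ijk Nec_Cp compose_eq simp del: restrict_apply)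
qed

lemma
  assumes "(T, p) \<in> Ob Nec"
  shows joint_0: "joint T 0 = 0"
    and joint_last: "joint T (beads T) = p"
    and joint_less: "\<lbrakk>i < j; j \<le> beads T\<rbrakk> \<Longrightarrow> joint T i < joint T j"
    and joint_in: "i \<le> beads T \<Longrightarrow> joint T i \<in> T"
    and joint_ex: "t \<in> T \<Longrightarrow> \<exists>i\<le>beads T. joint T i = t"
    and beads_0: "T = {0} \<longleftrightarrow> beads T = 0"
proof -
  have T: "finite T" "0 \<in> T" "p \<in> T" "T \<subseteq> {..p}" using assms finite_subset by (auto simp: Nec_Ob)
  define l where "l = sorted_list_of_set T"
  have l: "sorted_wrt (<) l" "set l = T" "length l = card T" using T by (auto simp: l_def)
  have c: "card T = Suc (beads T)" using T card_gt_0_iff[of T] by (auto simp: beads_def)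
  show less: "joint T i < joint T j" if "i < j" "j \<le> beads T" for i j
    using that l c by (auto simp: joint_def l_def[symmetric] intro: sorted_wrt_nth_less)
  show i: "joint T i \<in> T" if "i \<le> beads T" for i
    using that l c nth_mem[of i l] by (simp add: joint_def l_def[symmetric])
  show ex: "\<exists>i\<le>beads T. joint T i = t" if "t \<in> T" for t
  proof -
    obtain i where "i < length l" "l ! i = t" using \<open>t \<in> T\<close>[folded l(2)] by (metis in_set_conv_nth)
    then show ?thesis using l c by (intro exI[of _ i]) (simp add: joint_def l_def[symmetric])
  qed
  obtain i where "i \<le> beads T" "joint T i = 0" using ex T by blast
  then show "joint T 0 = 0" using less[of 0 i] by (cases "i = 0") auto
  obtain i where "i \<le> beads T" "joint T i = p" using ex T by blast
  then show "joint T (beads T) = p" using less[of i "beads T"] i[of "beads T"] T by (cases "i = beads T") auto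
  show "T = {0} \<longleftrightarrow> beads T = 0"
  proof
    assume "beads T = 0"
    then obtain t where "T = {t}" using c by (auto simp: card_1_singleton_iff)
    then show "T = {0}" using T by simp
  qed (simp add: beads_def)
qed

lemma joint_le: "(T, p) \<in> Ob Nec \<Longrightarrow> i \<le> j \<Longrightarrow> j \<le> beads T \<Longrightarrow> joint T i \<le> joint T j"
  using joint_less[of T p i j] by (cases "i = j") auto

lemma bead_dim: "(T, p) \<in> Ob Nec \<Longrightarrow> i < beads T \<Longrightarrow> joint T i + bead_dim T i = joint T (Suc i)"
  using joint_le[of T p i "Suc i"] by (simp add: bead_dim_def)

lemma bead_incl:
  assumes "(T, p) \<in> Ob Nec" "i < beads T"
  shows "bead_incl T i \<in> Delta (bead_dim T i) p" and "in_bead T i (bead_dim T i) (bead_incl T i)"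
proof -
  have "joint T i + bead_dim T i = joint T (Suc i)" "joint T (Suc i) \<le> p"
    using bead_dim[OF assms] joint_in[OF assms(1), of "Suc i"] assms by (auto simp: Nec_Ob)
  then show "bead_incl T i \<in> Delta (bead_dim T i) p" "in_bead T i (bead_dim T i) (bead_incl T i)"
    using assms(2) by (auto simp: bead_incl_def Delta_def mono_on_def in_bead_def)
qed

lemma in_bead_compose: "\<beta> \<in> Delta m n \<Longrightarrow> in_bead T i n \<alpha> \<Longrightarrow> in_bead T i m (compose {..m} \<alpha> \<beta>)"
  using Delta_apply[of \<beta> m n] by (fastforce simp: in_bead_def compose_eq)

lemma in_bead_map:
  assumes T: "(T, p) \<in> Ob Nec" and U: "(U, q) \<in> Ob Nec" and f: "f \<in> Ar Nec (T, p) (U, q)"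
    and i: "in_bead T i n \<alpha>" and "U \<noteq> {0}"
  shows "\<exists>j. in_bead U j n (compose {..n} f \<alpha>)"
proof -
  have fD: "f \<in> Delta p q" "U \<subseteq> f ` T" using f by (simp_all add: Nec_Ar)
  have i': "i < beads T" using i by (simp add: in_bead_def)
  have Sp: "joint T (Suc i) \<le> p" using joint_in[OF T, of "Suc i"] T i' by (auto simp: Nec_Ob)
  define j where "j = (LEAST j. f (joint T (Suc i)) \<le> joint U (Suc j))"
  have U0: "0 < beads U" using \<open>U \<noteq> {0}\<close> beads_0[OF U] by simp
  have "f (joint T (Suc i)) \<le> joint U (Suc (beads U - 1))"
    using Delta_apply[OF fD(1) Sp] joint_last[OF U] U0 by simp
  then have j: "f (joint T (Suc i)) \<le> joint U (Suc j)" "j \<le> beads U - 1"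
    unfolding j_def by (auto intro: LeastI Least_le)
  have "joint U j \<le> f (joint T i)"
  proof (cases j)
    case 0
    then show ?thesis using joint_0[OF U] by simp
  next
    case (Suc k)
    have less: "joint U j < f (joint T (Suc i))"
      using not_less_Least[of k "\<lambda>j. f (joint T (Suc i)) \<le> joint U (Suc j)"] Suc by (auto simp: j_def[symmetric])
    have "joint U j \<in> U" using j U0 by (intro joint_in[OF U]) simp
    then obtain t where t: "t \<in> T" "joint U j = f t" using fD by auto
    obtain h where h: "h \<le> beads T" "t = joint T h" using joint_ex[OF T t(1)] by auto
    have "h \<le> i"
    proof (rule ccontr)
      assume "\<not> h \<le> i"
      then have "joint T (Suc i) \<le> joint T h" using h by (intro joint_le[OF T]) auto
      moreover have "joint T h \<le> p" using t h T by (auto simp: Nec_Ob)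
      ultimately have "f (joint T (Suc i)) \<le> f (joint T h)" by (rule Delta_mono[OF fD(1)])
      with less t h show False by simp
    qed
    moreover have "joint T i \<le> p" using joint_le[OF T, of i "Suc i"] i' Sp by simp
    ultimately show ?thesis unfolding t h using joint_le[OF T, of h i] i'
      by (intro Delta_mono[OF fD(1)]) auto
  qed
  moreover have "f (joint T i) \<le> f (\<alpha> r) \<and> f (\<alpha> r) \<le> f (joint T (Suc i))" if "r \<le> n" for r
    using i that Sp by (auto simp: in_bead_def image_subset_iff intro!: Delta_mono[OF fD(1)] intro: order_trans)
  ultimately have "in_bead U j n (compose {..n} f \<alpha>)"
    using j U0 by (fastforce simp: in_bead_def compose_eq)
  then show ?thesis ..
qed

lemma (in simplicial_set) act_constD:
  assumes "x \<in> simplices X d" "i \<le> d"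
  shows "act X n d (constD n i) x = degen X n (vert X d i x)"
proof -
  have "act X n d (compose {..n} (constD 0 i) (constD n 0)) x = degen X n (vert X d i x)"
    unfolding degen_def vert_def using assms by (intro act_compose Delta_constD) auto
  then show ?thesis using assms by (simp only: compose_constD[OF Delta_constD] order.refl)
qed

lemma (in simplicial_set) vert_closed: "x \<in> simplices X d \<Longrightarrow> i \<le> d \<Longrightarrow> vert X d i x \<in> simplices X 0"
  unfolding vert_def by (intro act_closed Delta_constD)

locale necklace_in = simplicial_set K
  for K :: "'a sset" and a b :: 'a and T :: "nat set" and p :: nat and xs :: "'a list" +
  assumes a: "a \<in> simplices K 0" and T: "(T, p) \<in> Ob Nec" and xs: "xs \<in> nec_simplices K a b T"
begin

lemma xs_nth: "i < beads T \<Longrightarrow> xs ! i \<in> simplices K (bead_dim T i)"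
  using xs beads_0[OF T] by (auto simp: nec_simplices_def split: if_splits)

lemma length_xs: "length xs = beads T"
  using xs beads_0[OF T] by (auto simp: nec_simplices_def split: if_splits)

lemma bead_Delta:
  assumes "\<alpha> \<in> Delta n p" "in_bead T i n \<alpha>"
  shows "(\<lambda>r\<in>{..n}. \<alpha> r - joint T i) \<in> Delta n (bead_dim T i)"
  using assms by (auto simp: Delta_def mono_on_def in_bead_def bead_dim_def intro!: diff_le_mono)

lemma eval_eq:
  assumes \<alpha>: "\<alpha> \<in> Delta n p" and i: "in_bead T i n \<alpha>"
  shows "nec_eval K a T xs n \<alpha> = act K n (bead_dim T i) (\<lambda>r\<in>{..n}. \<alpha> r - joint T i) (xs ! i)"
proof -
  have i': "i < beads T" using i by (simp add: in_bead_def)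
  then have T0: "T \<noteq> {0}" using beads_0[OF T] by simp
  define j where "j = (LEAST i. in_bead T i n \<alpha>)"
  have j: "in_bead T j n \<alpha>" "j \<le> i" using i unfolding j_def by (auto intro: LeastI Least_le)
  have eval: "nec_eval K a T xs n \<alpha> = act K n (bead_dim T j) (\<lambda>r\<in>{..n}. \<alpha> r - joint T j) (xs ! j)"
    using T0 by (simp add: nec_eval_def j_def Let_def)
  show ?thesis
  proof (cases "j = i")
    case False
    then have ji: "Suc j \<le> i" using j by simp
    have r: "\<alpha> r = joint T i \<and> joint T i = joint T (Suc j)" if "r \<le> n" for r
      using i j that joint_le[OF T ji] i' by (force simp: in_bead_def image_subset_iff)
    then have "joint T i = joint T (Suc j)" by blast
    then have iS: "i = Suc j" using joint_less[OF T, of "Suc j" i] ji i' by (cases "i = Suc j") auto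
    have "(\<lambda>r\<in>{..n}. \<alpha> r - joint T i) = constD n 0" "(\<lambda>r\<in>{..n}. \<alpha> r - joint T j) = constD n (bead_dim T j)"
      using r by (auto simp: bead_dim_def intro!: restrict_ext)
    moreover have "vert K (bead_dim T j) (bead_dim T j) (xs ! j) = vert K (bead_dim T i) 0 (xs ! i)"
      using xs T0 i' unfolding iS by (simp add: nec_simplices_def)
    ultimately show ?thesis unfolding eval using xs_nth i' iS by (simp add: act_constD)
  qed (simp add: eval)
qed

lemma eval_closed:
  assumes "\<alpha> \<in> Delta n p" and "T = {0} \<or> in_bead T i n \<alpha>"
  shows "nec_eval K a T xs n \<alpha> \<in> simplices K n"
proof (cases "T = {0}")
  case True
  then show ?thesis using a by (simp add: nec_eval_def degen_closed)
next
  case False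
  then have "in_bead T i n \<alpha>" using assms by simp
  with assms(1) show ?thesis
    using xs_nth[of i] bead_Delta by (auto simp: eval_eq in_bead_def intro!: act_closed)
qed

lemma eval_act:
  assumes \<alpha>: "\<alpha> \<in> Delta n p" and \<beta>: "\<beta> \<in> Delta m n" and i: "T = {0} \<or> in_bead T i n \<alpha>"
  shows "nec_eval K a T xs m (compose {..m} \<alpha> \<beta>) = act K m n \<beta> (nec_eval K a T xs n \<alpha>)"
proof (cases "T = {0}")
  case True
  then show ?thesis using a \<beta> by (simp add: nec_eval_def degen_act)
next
  case False
  then have i: "in_bead T i n \<alpha>" using i by simp
  have "(\<lambda>r\<in>{..m}. compose {..m} \<alpha> \<beta> r - joint T i) = compose {..m} (\<lambda>r\<in>{..n}. \<alpha> r - joint T i) \<beta>"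
    using Delta_apply[OF \<beta>] by (auto simp: compose_def intro!: restrict_ext)
  moreover have "i < beads T" using i by (simp add: in_bead_def)
  ultimately show ?thesis
    using eval_eq[OF \<alpha> i] eval_eq[OF Delta_compose[OF \<beta> \<alpha>] in_bead_compose[OF \<beta> i]]
      act_compose[OF \<beta> bead_Delta[OF \<alpha> i] xs_nth] by simp
qed

lemma eval_incl:
  assumes i: "i < beads T"
  shows "nec_eval K a T xs (bead_dim T i) (bead_incl T i) = xs ! i"
proof -
  have "(\<lambda>r\<in>{..bead_dim T i}. bead_incl T i r - joint T i) = idD (bead_dim T i)"
    by (auto simp: bead_incl_def intro!: restrict_ext)
  then show ?thesis using eval_eq[OF bead_incl[OF T i]] act_id[OF xs_nth[OF i]] by simp
qed

lemma eval_first: "nec_eval K a T xs 0 (constD 0 0) = a"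
proof (cases "T = {0}")
  case True
  then show ?thesis using a by (simp add: nec_eval_def degen_0)
next
  case False
  then have b: "0 < beads T" using beads_0[OF T] by simp
  have D: "constD 0 0 \<in> Delta 0 (bead_dim T 0)" by (rule Delta_constD) simp
  have "compose {..0} (bead_incl T 0) (constD 0 0) = constD 0 0"
    using joint_0[OF T] by (auto simp: compose_def bead_incl_def intro!: restrict_ext)
  then have "nec_eval K a T xs 0 (constD 0 0) = act K 0 (bead_dim T 0) (constD 0 0) (xs ! 0)"
    using eval_act[OF bead_incl(1)[OF T b] D disjI2[OF bead_incl(2)[OF T b]]] eval_incl[OF b] by simp
  then show ?thesis using xs False by (simp add: nec_simplices_def vert_def)
qed

lemma eval_last: "nec_eval K a T xs 0 (constD 0 p) = b"
proof (cases "T = {0}")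
  case True
  then show ?thesis using a xs by (auto simp: nec_eval_def degen_0 nec_simplices_def split: if_splits)
next
  case False
  define i where "i = beads T - 1"
  have b: "i < beads T" "Suc i = beads T" using beads_0[OF T] False by (auto simp: i_def)
  have D: "constD 0 (bead_dim T i) \<in> Delta 0 (bead_dim T i)" by (rule Delta_constD) simp
  have "compose {..0} (bead_incl T i) (constD 0 (bead_dim T i)) = constD 0 p"
    using joint_last[OF T] bead_dim[OF T b(1)] b by (auto simp: compose_def bead_incl_def intro!: restrict_ext)
  then have "nec_eval K a T xs 0 (constD 0 p) = act K 0 (bead_dim T i) (constD 0 (bead_dim T i)) (xs ! i)"
    using eval_act[OF bead_incl(1)[OF T b(1)] D disjI2[OF bead_incl(2)[OF T b(1)]]] eval_incl[OF b(1)] by simp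
  then show ?thesis using xs False by (simp add: nec_simplices_def vert_def i_def)
qed

end

lemma nec_psh_simps:
  "psh_ob (nec_psh K a b) (T, p) = nec_simplices K a b T"
  "psh_map (nec_psh K a b) (T, p) (U, q) f xs =
    map (\<lambda>i. nec_eval K a U xs (bead_dim T i) (compose {..bead_dim T i} f (bead_incl T i))) [0..<beads T]"
  by (simp_all add: nec_psh_def)

lemma nec_psh_closed:
  assumes K: "simplicial_set K" and a: "a \<in> simplices K 0"
    and T: "(T, p) \<in> Ob Nec" and U: "(U, q) \<in> Ob Nec" and f: "f \<in> Ar Nec (T, p) (U, q)"
    and xs: "xs \<in> nec_simplices K a b U"
  shows "psh_map (nec_psh K a b) (T, p) (U, q) f xs \<in> nec_simplices K a b T" (is "?ys \<in> _")
proof -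
  interpret U: necklace_in K a b U q xs
    using K a U xs by (intro necklace_in.intro necklace_in_axioms.intro)
  have fD: "f \<in> Delta p q" "f 0 = 0" "f p = q" "U \<subseteq> f ` T" using f by (simp_all add: Nec_Ar)
  show ?thesis
  proof (cases "T = {0}")
    case True
    then have "p = 0" "q = 0" using T fD by (auto simp: Nec_Ob)
    then have "U = {0}" using U by (auto simp: Nec_Ob)
    then show ?thesis using xs True by (auto simp: nec_psh_simps nec_simplices_def beads_def split: if_splits)
  next
    case False
    then have b0: "0 < beads T" using beads_0[OF T] by simp
    have D: "compose {..bead_dim T i} f (bead_incl T i) \<in> Delta (bead_dim T i) q"
      and ex: "\<exists>j. U = {0} \<or> in_bead U j (bead_dim T i) (compose {..bead_dim T i} f (bead_incl T i))"
      if "i < beads T" for i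
      using Delta_compose[OF bead_incl(1)[OF T that] fD(1)] in_bead_map[OF T U f bead_incl(2)[OF T that]] by auto
    have closed: "?ys ! i \<in> simplices K (bead_dim T i)" if "i < beads T" for i
      using ex[OF that] U.eval_closed[OF D[OF that]] that by (auto simp: nec_psh_simps)
    have vert: "vert K (bead_dim T i) r (?ys ! i) = nec_eval K a U xs 0 (constD 0 (f (joint T i + r)))"
      if "i < beads T" "r \<le> bead_dim T i" for i r
    proof -
      have "compose {..0} (compose {..bead_dim T i} f (bead_incl T i)) (constD 0 r) = constD 0 (f (joint T i + r))"
        using that by (auto simp: compose_def bead_incl_def intro!: restrict_ext)
      moreover from ex[OF that(1)] obtain j
        where "U = {0} \<or> in_bead U j (bead_dim T i) (compose {..bead_dim T i} f (bead_incl T i))" ..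
      note U.eval_act[OF D[OF that(1)] Delta_constD[OF that(2)] this, of 0]
      ultimately show ?thesis
        using that by (simp add: vert_def nec_psh_simps del: atMost_0)
    qed
    show ?thesis
      unfolding nec_simplices_def using False b0 closed vert U.eval_first U.eval_last joint_0[OF T]
        joint_last[OF T] bead_dim[OF T] fD
      by (auto simp: nec_psh_simps(2)[of K a b T p U q, THEN arg_cong[of _ _ length]])
  qed
qed

theorem nec_eval_precompose:
  assumes K: "simplicial_set K" and a: "a \<in> simplices K 0"
    and T: "(T, p) \<in> Ob Nec" and U: "(U, q) \<in> Ob Nec" and f: "f \<in> Ar Nec (T, p) (U, q)"
    and xs: "xs \<in> nec_simplices K a b U" and \<alpha>: "\<alpha> \<in> Delta n p" and i: "T = {0} \<or> in_bead T i n \<alpha>"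
  shows "nec_eval K a T (psh_map (nec_psh K a b) (T, p) (U, q) f xs) n \<alpha>
    = nec_eval K a U xs n (compose {..n} f \<alpha>)"
proof -
  interpret U: necklace_in K a b U q xs
    using K a U xs by (intro necklace_in.intro necklace_in_axioms.intro)
  interpret T: necklace_in K a b T p "psh_map (nec_psh K a b) (T, p) (U, q) f xs"
    using K a T nec_psh_closed[OF K a T U f xs] by (intro necklace_in.intro necklace_in_axioms.intro)
  have fD: "f \<in> Delta p q" "f p = q" "f 0 = 0" using f by (simp_all add: Nec_Ar)
  show ?thesis
  proof (cases "T = {0}")
    case True
    then have "p = 0" "q = 0" using T fD by (auto simp: Nec_Ob)
    then have "U = {0}" using U by (auto simp: Nec_Ob)
    then show ?thesis using True by (simp add: nec_eval_def)
  next
    case False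
    then have i: "in_bead T i n \<alpha>" "i < beads T" using i by (auto simp: in_bead_def)
    let ?d = "bead_dim T i" and ?\<beta> = "\<lambda>r\<in>{..n}. \<alpha> r - joint T i"
    have inc: "compose {..n} (bead_incl T i) ?\<beta> = \<alpha>"
    proof (rule Delta_eqI[OF Delta_compose[OF T.bead_Delta[OF \<alpha> i(1)] bead_incl(1)[OF T i(2)]] \<alpha>])
      fix r assume "r \<le> n"
      then show "compose {..n} (bead_incl T i) ?\<beta> r = \<alpha> r"
        using i Delta_apply[OF T.bead_Delta[OF \<alpha> i(1)], of r]
        by (auto simp: compose_eq bead_incl_def in_bead_def image_subset_iff)
    qed
    obtain j where j: "U = {0} \<or> in_bead U j ?d (compose {..?d} f (bead_incl T i))"
      using in_bead_map[OF T U f bead_incl(2)[OF T i(2)]] by blast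
    have "nec_eval K a T (psh_map (nec_psh K a b) (T, p) (U, q) f xs) n \<alpha> =
        act K n ?d ?\<beta> (nec_eval K a U xs ?d (compose {..?d} f (bead_incl T i)))"
      using T.eval_eq[OF \<alpha> i(1)] i(2) by (simp add: nec_psh_simps)
    also have "\<dots> = nec_eval K a U xs n (compose {..n} (compose {..?d} f (bead_incl T i)) ?\<beta>)"
      using U.eval_act[OF Delta_compose[OF bead_incl(1)[OF T i(2)] fD(1)] T.bead_Delta[OF \<alpha> i(1)] j] by simp
    also have "compose {..n} (compose {..?d} f (bead_incl T i)) ?\<beta> = compose {..n} f \<alpha>"
      using Delta_compose_assoc[OF T.bead_Delta[OF \<alpha> i(1)], of f "bead_incl T i"] inc by simp
    finally show ?thesis .
  qed
qed

theorem presheaf_nec_psh: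
  assumes K: "simplicial_set K" and a: "a \<in> simplices K 0"
  shows "presheaf Nec (nec_psh K a b)"
proof (rule presheaf.intro)
  fix j k f w assume "j \<in> Ob Nec" "k \<in> Ob Nec" "f \<in> Ar Nec j k" "w \<in> psh_ob (nec_psh K a b) k"
  then show "psh_map (nec_psh K a b) j k f w \<in> psh_ob (nec_psh K a b) j"
    by (cases j; cases k) (simp add: nec_psh_closed[OF K a] nec_psh_simps(1))
next
  fix j w assume j: "j \<in> Ob Nec" "w \<in> psh_ob (nec_psh K a b) j"
  obtain T p where Tp: "j = (T, p)" by (cases j)
  interpret T: necklace_in K a b T p w
    using K a j by (intro necklace_in.intro necklace_in_axioms.intro) (simp_all add: Tp nec_psh_simps)
  show "psh_map (nec_psh K a b) j j (Id Nec j) w = w"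
    using compose_idD_left[OF bead_incl(1)[OF T.T]] T.eval_incl
    by (intro nth_equalityI) (simp_all add: Tp nec_psh_simps Nec_Id T.length_xs)
next
  fix i j k f g w
  assume as: "i \<in> Ob Nec" "j \<in> Ob Nec" "k \<in> Ob Nec" "f \<in> Ar Nec i j" "g \<in> Ar Nec j k"
    "w \<in> psh_ob (nec_psh K a b) k"
  obtain T p U q V r where ijk: "i = (T, p)" "j = (U, q)" "k = (V, r)" by (cases i; cases j; cases k)
  note as = as[unfolded ijk nec_psh_simps(1)]
  have "nec_eval K a V w (bead_dim T l) (compose {..bead_dim T l} (compose {..p} g f) (bead_incl T l)) =
    nec_eval K a U (psh_map (nec_psh K a b) (U, q) (V, r) g w) (bead_dim T l)
      (compose {..bead_dim T l} f (bead_incl T l))" if l: "l < beads T" for l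
  proof -
    have fD: "f \<in> Delta p q" using as by (simp add: Nec_Ar)
    obtain h where "U = {0} \<or> in_bead U h (bead_dim T l) (compose {..bead_dim T l} f (bead_incl T l))"
      using in_bead_map[OF as(1,2,4) bead_incl(2)[OF as(1) l]] by blast
    from nec_eval_precompose[OF K a as(2,3,5,6) Delta_compose[OF bead_incl(1)[OF as(1) l] fD] this]
    show ?thesis by (simp add: Delta_compose_assoc[OF bead_incl(1)[OF as(1) l]])
  qed
  then show "psh_map (nec_psh K a b) i k (Cp Nec i j k g f) w =
      psh_map (nec_psh K a b) i j f (psh_map (nec_psh K a b) j k g w)"
    unfolding ijk Nec_Cp nec_psh_simps(2)[of K a b T] by simp
qed


section \<open>The universal property and the objects of the categorification\<close>

theorem simplicial_category_categorification: "simplicial_category (categorification K)"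
  unfolding categorification_def
  by (rule scat_diagram.simplicial_category_scat_colim[OF scat_diagram_simplex_diagram])

theorem scat_cocone_categorification:
  "scat_cocone (simplex_category K) simplex_diagram (categorification K)
     (scat_colim_inj (simplex_category K) simplex_diagram)"
  unfolding categorification_def
  by (rule scat_diagram.scat_cocone_scat_colim[OF scat_diagram_simplex_diagram])

theorem categorification_universal:
  assumes "simplicial_category E" and "scat_cocone (simplex_category K) simplex_diagram E \<kappa>"
  shows "\<exists>F. simplicial_functor (categorification K) E F \<and>
      (\<forall>j\<in>Ob (simplex_category K). sfun_eq (cd_ob simplex_diagram j)
        (sfun_comp F (scat_colim_inj (simplex_category K) simplex_diagram j)) (\<kappa> j)) \<and>
      (\<forall>F'. simplicial_functor (categorification K) E F' \<and>
        (\<forall>j\<in>Ob (simplex_category K). sfun_eq (cd_ob simplex_diagram j)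
          (sfun_comp F' (scat_colim_inj (simplex_category K) simplex_diagram j)) (\<kappa> j))
        \<longrightarrow> sfun_eq (categorification K) F' F)"
  unfolding categorification_def
  by (rule scat_diagram.scat_colim_universal[OF scat_diagram_simplex_diagram assms])

theorem bij_betw_cat_vertex:
  assumes "simplicial_set K"
  shows "bij_betw (cat_vertex K) (simplices K 0) (obj (categorification K))"
proof -
  interpret simplicial_set K by fact
  let ?J = "simplex_category K"
  have cv: "cat_vertex K a = colim_ob ?J simplex_diagram (0, a) 0" for a
    by (simp add: cat_vertex_def scat_colim_inj_def)
  have ob: "colim_ob ?J simplex_diagram (n, x) i = cat_vertex K (vert K n i x)"
    if "x \<in> simplices K n" "i \<le> n" for n x i
  proof -
    have "colim_ob ?J simplex_diagram (n, x) (fob (cd_map simplex_diagram (0, vert K n i x) (n, x) (constD 0 i)) 0)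
        = colim_ob ?J simplex_diagram (0, vert K n i x) 0"
      using that vert_closed[OF that] Delta_constD[OF that(2), of 0]
      by (intro colim_ob_arrow)
        (simp_all add: simplex_category_def simplex_diagram_def simplex_scat_simps(1) vert_def del: atMost_0)
    then show ?thesis by (simp add: simplex_diagram_def simplex_scat_map_simps(1) cv)
  qed
  have obj: "obj (categorification K) = {colim_ob ?J simplex_diagram (n, x) i | n x i. x \<in> simplices K n \<and> i \<le> n}"
    by (auto simp: categorification_def scat_colim_def simplex_category_def simplex_diagram_def simplex_scat_simps(1))
  have "obj (categorification K) = cat_vertex K ` simplices K 0"
  proof (intro equalityI subsetI)
    fix X assume "X \<in> obj (categorification K)"
    then obtain n x i where "X = cat_vertex K (vert K n i x)" "x \<in> simplices K n" "i \<le> n" using ob by (auto simp: obj)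
    then show "X \<in> cat_vertex K ` simplices K 0" using vert_closed by simp
  qed (auto simp: obj cv)
  moreover have "inj_on (cat_vertex K) (simplices K 0)"
  proof (rule inj_onI)
    fix a b assume ab: "a \<in> simplices K 0" "b \<in> simplices K 0" and "cat_vertex K a = cat_vertex K b"
    then have "equivclp (colim_ob_step ?J simplex_diagram) ((0, a), 0) ((0, b), 0)"
      by (auto simp: cv colim_ob_def set_eq_iff)
    then have "(\<lambda>((n, x), i). vert K n i x) ((0, a), 0) = (\<lambda>((n, x), i). vert K n i x) ((0, b), 0)"
    proof (rule equivclp_lift)
      fix p q assume "colim_ob_step ?J simplex_diagram p q"
      then show "(\<lambda>((n, x), i). vert K n i x) p = (\<lambda>((n, x), i). vert K n i x) q"
      proof cases
        case (1 j k f x)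
        obtain m y n z where jk: "j = (m, y)" "k = (n, z)" by (cases j; cases k)
        have f: "f \<in> Delta m n" "act K m n f z = y" "z \<in> simplices K n" "x \<le> m"
          using 1 by (auto simp: jk simplex_category_def simplex_diagram_def simplex_scat_simps(1))
        have "compose {..0} f (constD 0 x) = constD 0 (f x)" by (auto simp: compose_def intro!: restrict_ext)
        then have "vert K m x y = vert K n (f x) z"
          using act_compose[OF Delta_constD[OF f(4), of 0] f(1,3)] f(2) by (simp add: vert_def)
        then show ?thesis using 1 by (simp add: jk simplex_diagram_def simplex_scat_map_simps(1))
      qed
    qed
    then have "vert K 0 0 a = vert K 0 0 b" by simp
    then show "a = b" using degen_0[OF ab(1)] degen_0[OF ab(2)] unfolding vert_def degen_def by simp
  qed
  ultimately show ?thesis by (simp add: bij_betw_def)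
qed

end

theory Submission
  imports Defs
begin

text \<open>A composable word in the \<open>\<CC>[\<Delta>\<^sup>m]\<close> gives an element \<open>(T, xs, y)\<close> of \<open>K\<^sub>T(a,b) \<times> (N\<P>\<^sub>T)\<^sub>n\<close>: a letter
  \<open>g \<in> \<CC>[\<Delta>\<^sup>m](i,j)\<^sub>n\<close> over \<open>x \<in> K\<^sub>m\<close> goes to the simplex \<open>x|[i,j]\<close> on the necklace \<open>\<Delta>\<^sup>j\<^sup>-\<^sup>i\<close> together with
  \<open>g\<close>, and concatenation goes to the wedge. Conversely a chain \<open>y\<close> in \<open>\<P>\<^sub>T\<close> contains all joints of \<open>T\<close>, so
  it is cut at the joints into one letter per bead. Going from elements to words and back is the
  identity on the nose, and the other composite is the identity up to the relations of the colimit.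

  That cutting respects the relations of the weighted colimit comes down to necklace maps
  \<open>T \<rightarrow> \<Delta>\<^sup>e\<close>: there the letters of \<open>T\<close> are pushed into the single category \<open>\<CC>[\<Delta>\<^sup>e]\<close> and composed. For a general
  \<open>f : T \<rightarrow> U\<close>, every joint of \<open>U\<close> is the image of a joint of \<open>T\<close>, so \<open>f\<close> is a wedge of maps to single beads.\<close>

section \<open>Wedges of necklaces\<close>

definition wedge :: "nat set \<Rightarrow> nat \<Rightarrow> nat set \<Rightarrow> nat set" where
  "wedge T p U = T \<union> (+) p ` U"

lemma wedge_Ob: "(T, p) \<in> Ob Nec \<Longrightarrow> (U, q) \<in> Ob Nec \<Longrightarrow> (wedge T p U, p + q) \<in> Ob Nec"
  by (auto simp: Nec_Ob wedge_def)

lemma wedge_0_left: "0 \<in> U \<Longrightarrow> wedge {0} 0 U = U"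
  by (auto simp: wedge_def)

lemma wedge_0_right: "p \<in> T \<Longrightarrow> wedge T p {0} = T"
  by (auto simp: wedge_def)

lemma wedge_assoc: "wedge (wedge T p U) (p + q) V = wedge T p (wedge U q V)"
  by (auto simp: wedge_def image_Un image_image add.assoc)

lemma wedge_mono: "T \<subseteq> T' \<Longrightarrow> U \<subseteq> U' \<Longrightarrow> wedge T p U \<subseteq> wedge T' p U'"
  by (auto simp: wedge_def)

lemma wedge_split: "t \<in> T \<Longrightarrow> wedge (T \<inter> {..t}) t {v. t + v \<in> T} = T"
proof -
  have "v \<in> wedge (T \<inter> {..t}) t {v. t + v \<in> T}" if "v \<in> T" for v
  proof (cases "v \<le> t")
    case False
    then have "v = t + (v - t)" by simp
    with that show ?thesis by (auto simp: wedge_def intro!: image_eqI[of _ _ "v - t"])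
  qed (use that in \<open>simp add: wedge_def\<close>)
  then show ?thesis by (auto simp: wedge_def)
qed

lemma wedge_lower: "V \<subseteq> {..p} \<Longrightarrow> p \<in> V \<Longrightarrow> wedge V p W \<inter> {..p} = V"
  by (auto simp: wedge_def)

lemma wedge_upper: "V \<subseteq> {..p} \<Longrightarrow> 0 \<in> W \<Longrightarrow> {v. p + v \<in> wedge V p W} = W"
  by (auto simp: wedge_def)

text \<open>This includes \<open>d = 0\<close>, where \<open>{0, 0}\<close> is \<open>{0}\<close>
  and the necklace has no beads. Letters with equal source and target are thus covered by the same
  formulas.\<close>

lemma simplex_Ob: "({0, d}, d) \<in> Ob Nec"
  by (simp add: Nec_Ob)

lemma split_Ob:
  assumes "(T, p) \<in> Ob Nec" "t \<in> T"
  shows "(T \<inter> {..t}, t) \<in> Ob Nec" "({v. t + v \<in> T}, p - t) \<in> Ob Nec"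
  using assms by (auto simp: Nec_Ob subset_iff)

text \<open>Every necklace is an iterated wedge of simplices of positive dimension; the induction
  peels off the first bead.\<close>

lemma Nec_induct [consumes 1, case_names zero wedge]:
  assumes "(T, p) \<in> Ob Nec"
    and "P {0} 0"
    and "\<And>d T p. \<lbrakk>0 < d; (T, p) \<in> Ob Nec; P T p\<rbrakk> \<Longrightarrow> P (wedge {0, d} d T) (d + p)"
  shows "P T p"
  using assms(1)
proof (induction p arbitrary: T rule: less_induct)
  case (less p)
  then have T: "0 \<in> T" "p \<in> T" "T \<subseteq> {..p}" by (simp_all add: Nec_Ob)
  show ?case
  proof (cases "p = 0")
    case True
    then have "T = {0}" using T by auto
    then show ?thesis using assms(2) True by simp
  next
    case False
    \<comment> \<open>\<open>d\<close> is the first joint after 0. By minimality no joint lies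
      strictly between, so cutting at \<open>d\<close> leaves exactly one bead on the left.\<close>
    define d where "d = (LEAST d. d \<in> T \<and> 0 < d)"
    have d: "d \<in> T" "0 < d" unfolding d_def using LeastI[of "\<lambda>d. d \<in> T \<and> 0 < d" p] T False by auto
    have "v = 0 \<or> v = d" if "v \<in> T" "v \<le> d" for v
      using that Least_le[of "\<lambda>d. d \<in> T \<and> 0 < d" v, folded d_def] by linarith
    then have "T \<inter> {..d} = {0, d}" using d T by auto
    then have eq: "wedge {0, d} d {v. d + v \<in> T} = T" using wedge_split[OF d(1)] by simp
    have le: "d \<le> p" using d T by auto
    have IH: "P {v. d + v \<in> T} (p - d)"
      using d le False by (intro less.IH split_Ob(2)[OF less.prems]) auto
    have "P (wedge {0, d} d {v. d + v \<in> T}) (d + (p - d))"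
      by (rule assms(3)[OF d(2) split_Ob(2)[OF less.prems d(1)] IH])
    then show ?thesis using eq le by simp
  qed
qed

text \<open>The last joint of \<open>T\<close> and the first joint of \<open>U\<close> are glued at
  \<open>p\<close>, so the head of the second list is dropped. Both sides are strictly increasing
  lists of the same set.\<close>

lemma sorted_list_of_set_wedge:
  assumes T: "(T, p) \<in> Ob Nec" and U: "(U, q) \<in> Ob Nec"
  shows "sorted_list_of_set (wedge T p U) = sorted_list_of_set T @ map ((+) p) (tl (sorted_list_of_set U))"
proof -
  have fin: "finite T" "finite U" using T U finite_subset by (auto simp: Nec_Ob)
  then have fin': "finite (wedge T p U)" by (simp add: wedge_def)
  obtain us where us: "sorted_list_of_set U = 0 # us"
  proof (cases "sorted_list_of_set U")
    case Nil
    then show ?thesis using U fin by (auto simp: Nec_Ob)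
  next
    case (Cons u us)
    have "0 \<in> set (u # us)" "sorted (u # us)" using U fin Cons[symmetric] by (auto simp: Nec_Ob)
    then show ?thesis using that[of us] Cons by auto
  qed
  have s: "sorted_wrt (<) (0 # us)" using strict_sorted_list_of_set[of U] unfolding us .
  have setU: "U = insert 0 (set us)" using set_sorted_list_of_set[OF fin(2)] us by simp
  have "sorted_wrt (<) (sorted_list_of_set T @ map ((+) p) us)"
    using s T fin by (fastforce simp: sorted_wrt_append sorted_wrt_map Nec_Ob)
  moreover have "set (sorted_list_of_set T @ map ((+) p) us) = wedge T p U"
    using T fin setU by (auto simp: wedge_def Nec_Ob)
  ultimately have "sorted_list_of_set T @ map ((+) p) us = sorted_list_of_set (wedge T p U)"
    using fin' by (intro strict_sorted_equal) simp_all
  then show ?thesis using us by simp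
qed

lemma
  assumes T: "(T, p) \<in> Ob Nec" and U: "(U, q) \<in> Ob Nec"
  shows beads_wedge: "beads (wedge T p U) = beads T + beads U"
    and joint_wedge_left: "i \<le> beads T \<Longrightarrow> joint (wedge T p U) i = joint T i"
    and joint_wedge_right: "i \<le> beads U \<Longrightarrow> joint (wedge T p U) (beads T + i) = p + joint U i"
proof -
  have len: "length (sorted_list_of_set S) = Suc (beads S)" "card S = Suc (beads S)" if "(S, r) \<in> Ob Nec" for S r
  proof -
    have "finite S" "S \<noteq> {}" using that finite_subset by (auto simp: Nec_Ob)
    then have "0 < card S" by (simp add: card_gt_0_iff)
    then show "length (sorted_list_of_set S) = Suc (beads S)" "card S = Suc (beads S)" by (simp_all add: beads_def)
  qed
  note eq = sorted_list_of_set_wedge[OF T U]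
  show b: "beads (wedge T p U) = beads T + beads U"
    using arg_cong[OF eq, of length] len[OF T] len[OF U] len[OF wedge_Ob[OF T U]] by simp
  show l: "joint (wedge T p U) i = joint T i" if "i \<le> beads T" for i
    using that len[OF T] by (simp add: joint_def eq nth_append)
  show "joint (wedge T p U) (beads T + i) = p + joint U i" if "i \<le> beads U"
  proof (cases i)
    \<comment> \<open>The shared joint \<open>p\<close> is listed in the part of \<open>T\<close>,
      so index 0 is read off there. For positive \<open>i\<close> the dropped head shifts the index
      by one.\<close>
    case 0
    then show ?thesis using l[of "beads T"] joint_last[OF T] joint_0[OF U] by simp
  next
    case (Suc k)
    then show ?thesis using that len[OF T] len[OF U] by (simp add: joint_def eq nth_append nth_tl)
  qed
qed

lemma
  assumes T: "(T, p) \<in> Ob Nec" and U: "(U, q) \<in> Ob Nec"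
  shows bead_dim_wedge_left: "i < beads T \<Longrightarrow> bead_dim (wedge T p U) i = bead_dim T i"
    and bead_dim_wedge_right: "i < beads U \<Longrightarrow> bead_dim (wedge T p U) (beads T + i) = bead_dim U i"
  using joint_wedge_left[OF T U] joint_wedge_right[OF T U, of "Suc i"] joint_wedge_right[OF T U, of i]
  by (auto simp: bead_dim_def)

text \<open>The common argument for everything defined bead by bead (dimensions, paths, words): over
  a wedge, such a list is the concatenation of the lists over the two factors.\<close>

lemma map_beads_wedge:
  assumes T: "(T, p) \<in> Ob Nec" and U: "(U, q) \<in> Ob Nec"
    and "\<And>i. i < beads T \<Longrightarrow> h i = f i" "\<And>i. i < beads U \<Longrightarrow> h (beads T + i) = g i"
  shows "map h [0..<beads (wedge T p U)] = map f [0..<beads T] @ map g [0..<beads U]"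
proof -
  have "h i = g (i - beads T)" if "beads T \<le> i" "i < beads T + beads U" for i
    using assms(4)[of "i - beads T"] that by simp
  then show ?thesis using assms(3) by (intro nth_equalityI) (auto simp: beads_wedge[OF T U] nth_append)
qed

lemma beads_simplex: "beads {0, d} = (if d = 0 then 0 else 1)"
  by (simp add: beads_def)

lemma joint_simplex: "0 < d \<Longrightarrow> joint {0, d} (Suc 0) = d"
  using joint_last[OF simplex_Ob[of d]] by (simp add: beads_simplex)

lemma bead_dim_simplex: "0 < d \<Longrightarrow> bead_dim {0, d} 0 = d"
  using joint_simplex[of d] joint_0[OF simplex_Ob[of d]] by (simp add: bead_dim_def)

section \<open>Chains of vertex sets\<close>

text \<open>For \<open>p = j - i\<close> this is the composition
  \<open>cmp (simplex_scat m) i j k n\<close>, so wedges of chains correspond to composites of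
  letters.\<close>

definition wedge_chain :: "nat \<Rightarrow> nat \<Rightarrow> (nat \<Rightarrow> nat set) \<Rightarrow> (nat \<Rightarrow> nat set) \<Rightarrow> nat \<Rightarrow> nat set" where
  "wedge_chain n p y z = (\<lambda>r\<in>{..n}. wedge (y r) p (z r))"

abbreviation chains :: "nat set \<Rightarrow> nat \<Rightarrow> nat \<Rightarrow> (nat \<Rightarrow> nat set) set" where
  "chains T p n \<equiv> simplices (nerve (nec_poset (T, p))) n"

lemma chains_iff:
  "y \<in> chains T p n \<longleftrightarrow> y \<in> extensional {..n} \<and> (\<forall>r\<le>n. T \<subseteq> y r \<and> y r \<subseteq> {..p}) \<and>
     (\<forall>r s. r \<le> s \<longrightarrow> s \<le> n \<longrightarrow> y r \<subseteq> y s)"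
  by (auto simp: nerve_simps nec_poset_iff PiE_iff)

lemma wedge_chain_closed:
  assumes "y \<in> chains T p n" "z \<in> chains U q n"
  shows "wedge_chain n p y z \<in> chains (wedge T p U) (p + q) n"
proof -
  have "wedge T p U \<subseteq> wedge (y r) p (z r)" "wedge (y r) p (z r) \<subseteq> {..p + q}" if "r \<le> n" for r
    using assms that by (force simp: chains_iff wedge_def)+
  moreover have "wedge (y r) p (z r) \<subseteq> wedge (y s) p (z s)" if "r \<le> s" "s \<le> n" for r s
    using assms that by (intro wedge_mono) (auto simp: chains_iff)
  ultimately show ?thesis by (auto simp: chains_iff wedge_chain_def)
qed

text \<open>\<open>p\<close> is a joint of the wedge and hence lies in every set of the chain, so
  each set can be cut there, and cutting preserves inclusions.\<close>

lemma wedge_chain_cases: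
  assumes T: "(T, p) \<in> Ob Nec" and U: "(U, q) \<in> Ob Nec" and y: "y \<in> chains (wedge T p U) (p + q) n"
  obtains y1 y2 where "y1 \<in> chains T p n" "y2 \<in> chains U q n" "y = wedge_chain n p y1 y2"
proof
  let ?y1 = "\<lambda>r\<in>{..n}. y r \<inter> {..p}" and ?y2 = "\<lambda>r\<in>{..n}. {v. p + v \<in> y r}"
  have p: "p \<in> y r" if "r \<le> n" for r using T y that by (auto simp: chains_iff wedge_def Nec_Ob)
  show "?y1 \<in> chains T p n" "?y2 \<in> chains U q n"
  proof -
    have yr: "T \<subseteq> y r" "(+) p ` U \<subseteq> y r" "y r \<subseteq> {..p + q}" if "r \<le> n" for r
      using y that by (auto simp: chains_iff wedge_def)
    have ys: "y r \<subseteq> y s" if "r \<le> s" "s \<le> n" for r s using y that by (simp add: chains_iff)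
    have "T \<subseteq> y r \<inter> {..p}" "U \<subseteq> {v. p + v \<in> y r}" "{v. p + v \<in> y r} \<subseteq> {..q}" if "r \<le> n" for r
      using yr[OF that] T by (auto simp: Nec_Ob)
    moreover have "y r \<inter> {..p} \<subseteq> y s \<inter> {..p}" "{v. p + v \<in> y r} \<subseteq> {v. p + v \<in> y s}" if "r \<le> s" "s \<le> n" for r s
      using ys[OF that] by auto
    ultimately show "?y1 \<in> chains T p n" "?y2 \<in> chains U q n" by (simp_all add: chains_iff)
  qed
  show "y = wedge_chain n p ?y1 ?y2"
  proof (rule extensionalityI[of _ "{..n}"])
    fix r assume "r \<in> {..n}"
    then show "y r = wedge_chain n p ?y1 ?y2 r" using p by (simp add: wedge_chain_def wedge_split)
  qed (use y in \<open>simp_all add: chains_iff wedge_chain_def\<close>)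
qed

lemma wedge_chain_assoc:
  "wedge_chain n (p + q) (wedge_chain n p x y) z = wedge_chain n p x (wedge_chain n q y z)"
  by (auto simp: wedge_chain_def wedge_assoc intro!: restrict_ext)

lemma chains_zero: "y \<in> chains {0} 0 n \<longleftrightarrow> y = (\<lambda>r\<in>{..n}. {0})"
proof
  assume "y \<in> chains {0} 0 n"
  then show "y = (\<lambda>r\<in>{..n}. {0})" by (intro extensionalityI[of _ "{..n}"]) (auto simp: chains_iff)
qed (auto simp: chains_iff)

lemma wedge_chain_0_left:
  assumes "0 \<in> U" "z \<in> chains U q n"
  shows "wedge_chain n 0 (\<lambda>r\<in>{..n}. {0}) z = z"
proof (rule extensionalityI[of _ "{..n}"])
  fix r assume "r \<in> {..n}"
  moreover from this have "0 \<in> z r" using assms by (auto simp: chains_iff)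
  ultimately show "wedge_chain n 0 (\<lambda>r\<in>{..n}. {0}) z r = z r" by (simp add: wedge_chain_def wedge_0_left)
qed (use assms in \<open>simp_all add: wedge_chain_def chains_iff\<close>)

lemma wedge_chain_0_right:
  assumes "p \<in> T" "y \<in> chains T p n"
  shows "wedge_chain n p y (\<lambda>r\<in>{..n}. {0}) = y"
proof (rule extensionalityI[of _ "{..n}"])
  fix r assume "r \<in> {..n}"
  moreover from this have "p \<in> y r" using assms by (auto simp: chains_iff)
  ultimately show "wedge_chain n p y (\<lambda>r\<in>{..n}. {0}) r = y r" by (simp add: wedge_chain_def wedge_0_right)
qed (use assms in \<open>simp_all add: wedge_chain_def chains_iff\<close>)

section \<open>Paths of simplices\<close>

text \<open>A recursive form of \<open>nec_simplices\<close>, indexed by the list of bead dimensions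
  instead of \<open>T\<close>. Concatenating paths and splitting off the first simplex become
  immediate.\<close>

fun is_path :: "'a sset \<Rightarrow> 'a \<Rightarrow> 'a \<Rightarrow> nat list \<Rightarrow> 'a list \<Rightarrow> bool" where
  "is_path X a b [] xs \<longleftrightarrow> xs = [] \<and> a = b"
| "is_path X a b (d # ds) [] \<longleftrightarrow> False"
| "is_path X a b (d # ds) (x # xs) \<longleftrightarrow>
    x \<in> simplices X d \<and> vert X d 0 x = a \<and> is_path X (vert X d d x) b ds xs"

lemma is_path_iff:
  "is_path X a b ds xs \<longleftrightarrow> (if ds = [] then xs = [] \<and> a = b else
     length xs = length ds \<and> (\<forall>i<length ds. xs ! i \<in> simplices X (ds ! i)) \<and>
     vert X (ds ! 0) 0 (xs ! 0) = a \<and>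
     vert X (ds ! (length ds - 1)) (ds ! (length ds - 1)) (xs ! (length ds - 1)) = b \<and>
     (\<forall>i. Suc i < length ds \<longrightarrow> vert X (ds ! i) (ds ! i) (xs ! i) = vert X (ds ! Suc i) 0 (xs ! Suc i)))"
proof (induction X a b ds xs rule: is_path.induct)
  case (3 X a b d ds x xs)
  have all: "(\<forall>i<Suc n. P i) \<longleftrightarrow> P 0 \<and> (\<forall>i<n. P (Suc i))" for P n by (auto simp: less_Suc_eq_0_disj)
  show ?case
  proof (cases ds)
    case (Cons e es)
    have "(\<forall>i. Suc i < Suc (Suc (length es)) \<longrightarrow> P i) \<longleftrightarrow> P 0 \<and> (\<forall>i. Suc i < Suc (length es) \<longrightarrow> P (Suc i))" for P
      using all[of "length es" "\<lambda>i. P i"] by (simp add: all)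
    then show ?thesis using 3 unfolding Cons by (simp add: all) (auto simp: eq_commute)
  qed (auto simp: all)
qed auto

lemma is_path_append:
  "is_path X a b ds xs \<Longrightarrow> is_path X b c es ys \<Longrightarrow> is_path X a c (ds @ es) (xs @ ys)"
  by (induction X a b ds xs rule: is_path.induct) auto

lemma nec_simplices_iff:
  assumes "(T, p) \<in> Ob Nec"
  shows "xs \<in> nec_simplices X a b T \<longleftrightarrow> is_path X a b (map (bead_dim T) [0..<beads T]) xs"
  using beads_0[OF assms] unfolding is_path_iff nec_simplices_def by auto

lemma nec_simplices_wedge:
  assumes T: "(T, p) \<in> Ob Nec" and U: "(U, q) \<in> Ob Nec"
    and "xs \<in> nec_simplices X a b T" "ys \<in> nec_simplices X b c U"
  shows "xs @ ys \<in> nec_simplices X a c (wedge T p U)"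
  using assms(3,4) bead_dim_wedge_left[OF T U] bead_dim_wedge_right[OF T U]
  by (simp add: nec_simplices_iff[OF T] nec_simplices_iff[OF U] nec_simplices_iff[OF wedge_Ob[OF T U]]
      map_beads_wedge[OF T U, of _ "bead_dim T" "bead_dim U"] is_path_append)

text \<open>Read off from the head of the path. Positivity of \<open>d\<close> matters:
  \<open>{0, 0}\<close> contributes no bead, so there would be no \<open>x\<close> to split
  off.\<close>

lemma nec_simplices_wedgeE:
  assumes U: "(U, q) \<in> Ob Nec" and "0 < d" and xs: "xs \<in> nec_simplices X a c (wedge {0, d} d U)"
  obtains x ys where "xs = x # ys" "x \<in> simplices X d" "vert X d 0 x = a" "ys \<in> nec_simplices X (vert X d d x) c U"
proof -
  note T = simplex_Ob[of d]
  have "is_path X a c (d # map (bead_dim U) [0..<beads U]) xs"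
    using xs map_beads_wedge[where f = "bead_dim {0, d}" and g = "bead_dim U",
        OF T U bead_dim_wedge_left[OF T U] bead_dim_wedge_right[OF T U]] \<open>0 < d\<close>
    by (simp add: nec_simplices_iff[OF wedge_Ob[OF T U]] beads_simplex bead_dim_simplex)
  then show ?thesis using that by (cases xs) (auto simp: nec_simplices_iff[OF U])
qed

text \<open>The path given by a single simplex; it is empty in dimension \<open>0\<close> because the necklace
  \<open>\<Delta>\<^sup>0\<close> has no beads.\<close>

definition simplex_path :: "nat \<Rightarrow> 'a \<Rightarrow> 'a list" where
  "simplex_path d x = (if d = 0 then [] else [x])"

lemma simplex_path:
  "x \<in> simplices X d \<Longrightarrow> simplex_path d x \<in> nec_simplices X (vert X d 0 x) (vert X d d x) {0, d}"
  by (auto simp: nec_simplices_iff[OF simplex_Ob] simplex_path_def beads_simplex bead_dim_simplex)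

text \<open>The path of the composite of \<open>f\<close>, viewed as a map from the necklace to
  \<open>\<Delta>\<^sup>e\<close>, with the simplex \<open>x\<close>. In contrast to necklace maps,
  \<open>f\<close> may miss the end points of \<open>[e]\<close>; an induction that cuts
  \<open>f\<close> into pieces needs this.\<close>

definition restr_path :: "'a sset \<Rightarrow> nat \<Rightarrow> 'a \<Rightarrow> nat set \<Rightarrow> (nat \<Rightarrow> nat) \<Rightarrow> 'a list" where
  "restr_path X e x T f =
    map (\<lambda>i. act X (bead_dim T i) e (compose {..bead_dim T i} f (bead_incl T i)) x) [0..<beads T]"

section \<open>Wedges of necklace maps\<close>

definition wedge_map :: "nat \<Rightarrow> nat \<Rightarrow> nat \<Rightarrow> (nat \<Rightarrow> nat) \<Rightarrow> (nat \<Rightarrow> nat) \<Rightarrow> nat \<Rightarrow> nat" where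
  "wedge_map p p' q f g = (\<lambda>i\<in>{..p + p'}. if i \<le> p then f i else q + g (i - p))"

text \<open>The formulas overlap at the gluing point. There the \<open>if\<close> takes the branch
  of \<open>f\<close>, which agrees with the other one because \<open>f p = q\<close> and
  \<open>g 0 = 0\<close>.\<close>

lemma wedge_map_simps:
  assumes "f p = q" "g 0 = 0"
  shows "i \<le> p \<Longrightarrow> wedge_map p p' q f g i = f i"
    and "i \<le> p' \<Longrightarrow> wedge_map p p' q f g (p + i) = q + g i"
  using assms by (auto simp: wedge_map_def)

lemma wedge_map_Ar:
  assumes f: "f \<in> Ar Nec (T, p) (U, q)" and g: "g \<in> Ar Nec (T', p') (U', q')"
    and T: "(T, p) \<in> Ob Nec" and T': "(T', p') \<in> Ob Nec"
  shows "wedge_map p p' q f g \<in> Ar Nec (wedge T p T', p + p') (wedge U q U', q + q')"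
proof -
  have f': "f \<in> Delta p q" "f 0 = 0" "f p = q" "U \<subseteq> f ` T" and g': "g \<in> Delta p' q'" "g 0 = 0" "g p' = q'" "U' \<subseteq> g ` T'"
    using f g by (simp_all add: Nec_Ar)
  note w = wedge_map_simps[where f = f and g = g and p' = p', OF f'(3) g'(2)]
  have "wedge_map p p' q f g i \<le> q + q'" if "i \<le> p + p'" for i
    using that Delta_apply[OF f'(1), of i] Delta_apply[OF g'(1), of "i - p"] by (auto simp: wedge_map_def)
  \<comment> \<open>Across the gluing point, for \<open>i \<le> p < j\<close>, the two values are
    separated by \<open>q\<close>.\<close>
  moreover have "wedge_map p p' q f g i \<le> wedge_map p p' q f g j" if "i \<le> j" "j \<le> p + p'" for i j
    using that Delta_mono[OF f'(1), of i j] Delta_mono[OF g'(1), of "i - p" "j - p"] Delta_apply[OF f'(1), of i]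
    by (auto simp: wedge_map_def)
  moreover have "wedge_map p p' q f g \<in> extensional {..p + p'}" by (simp add: wedge_map_def)
  ultimately have "wedge_map p p' q f g \<in> Delta (p + p') (q + q')" by (auto simp: Delta_def mono_on_def PiE_iff)
  moreover have "wedge U q U' \<subseteq> wedge_map p p' q f g ` wedge T p T'"
  proof
    fix u assume "u \<in> wedge U q U'"
    then consider t where "t \<in> T" "u = f t" | t where "t \<in> T'" "u = q + g t"
      using f'(4) g'(4) by (auto simp: wedge_def)
    then show "u \<in> wedge_map p p' q f g ` wedge T p T'"
    proof cases
      case 1
      then show ?thesis using w(1)[of t] T by (intro image_eqI[of _ _ t]) (auto simp: wedge_def Nec_Ob)
    next
      case 2
      then show ?thesis using w(2)[of t] T' by (intro image_eqI[of _ _ "p + t"]) (auto simp: wedge_def Nec_Ob)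
    qed
  qed
  ultimately show ?thesis using w(1)[of 0] w(2)[of p'] f' g' by (simp add: Nec_Ar)
qed

lemma Delta_0: "\<alpha> \<in> Delta n 0 \<Longrightarrow> \<alpha> = constD n 0"
  by (rule Delta_eqI[OF _ Delta_constD]) (auto dest: Delta_apply)

section \<open>The presheaf of paths on wedges and on single simplices\<close>

context simplicial_set
begin

text \<open>Needed when a wedge factor has no beads: there \<open>nec_eval\<close> is degenerate by
  definition, and a wedge evaluated at its first vertex has to give the same simplex.\<close>

lemma eval_const_first:
  assumes "a \<in> simplices X 0" "(T, p) \<in> Ob Nec" "xs \<in> nec_simplices X a b T"
  shows "nec_eval X a T xs n (constD n 0) = degen X n a"
proof (cases "T = {0}")
  case False
  interpret T: necklace_in X a b T p xs using assms by unfold_locales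
  have "0 < beads T" using False beads_0[OF assms(2)] by simp
  then have "in_bead T 0 0 (constD 0 0)" by (auto simp: in_bead_def joint_0[OF assms(2)])
  \<comment> \<open>The constant map factors as \<open>[n] \<rightarrow> [0]\<close> followed by the
    vertex 0, whose value is \<open>a\<close>.\<close>
  then have "nec_eval X a T xs n (compose {..n} (constD 0 0) (constD n 0)) = degen X n a"
    using T.eval_act[OF Delta_constD Delta_constD, of 0 0 0 0 n] T.eval_first
    by (simp add: degen_def del: atMost_0)
  then show ?thesis by (simp only: compose_constD[OF Delta_constD] order.refl)
qed (simp add: nec_eval_def)

lemma eval_const_last:
  assumes "a \<in> simplices X 0" "(T, p) \<in> Ob Nec" "xs \<in> nec_simplices X a b T"
  shows "nec_eval X a T xs n (constD n p) = degen X n b"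
proof (cases "T = {0}")
  case False
  interpret T: necklace_in X a b T p xs using assms by unfold_locales
  have *: "0 < beads T" using False beads_0[OF assms(2)] by simp
  then have "joint T (beads T - 1) \<le> p" "joint T (Suc (beads T - 1)) = p"
    using joint_le[OF assms(2), of "beads T - 1" "beads T"] by (simp_all add: joint_last[OF assms(2)])
  then have "in_bead T (beads T - 1) 0 (constD 0 p)" using * by (auto simp: in_bead_def)
  then have "nec_eval X a T xs n (compose {..n} (constD 0 p) (constD n 0)) = degen X n b"
    using T.eval_act[OF Delta_constD Delta_constD, of p 0 0 "beads T - 1" n] T.eval_last
    by (simp add: degen_def del: atMost_0)
  then show ?thesis by (simp only: compose_constD[OF Delta_constD] order.refl)
next
  case True
  then show ?thesis using assms(3) by (auto simp: nec_eval_def nec_simplices_def split: if_splits)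
qed

context
  fixes a b c :: 'a and T U :: "nat set" and p q :: nat and xs ys :: "'a list"
  assumes a: "a \<in> simplices X 0" and b: "b \<in> simplices X 0"
    and T: "(T, p) \<in> Ob Nec" and U: "(U, q) \<in> Ob Nec"
    and xs: "xs \<in> nec_simplices X a b T" and ys: "ys \<in> nec_simplices X b c U"
begin

interpretation T: necklace_in X a b T p xs using a T xs by unfold_locales
interpretation U: necklace_in X b c U q ys using b U ys by unfold_locales
interpretation W: necklace_in X a c "wedge T p U" "p + q" "xs @ ys"
  using a wedge_Ob[OF T U] nec_simplices_wedge[OF T U xs ys] by unfold_locales

text \<open>A bead of \<open>T\<close> is the bead of the wedge with the same index and the same
  simplex. If \<open>T\<close> has no beads, \<alpha> is constant and both sides are degenerate on
  \<open>a\<close>.\<close>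

lemma eval_wedge_left:
  assumes \<alpha>: "\<alpha> \<in> Delta n p" and i: "T = {0} \<or> in_bead T i n \<alpha>"
  shows "nec_eval X a (wedge T p U) (xs @ ys) n \<alpha> = nec_eval X a T xs n \<alpha>"
proof (cases "T = {0}")
  case True
  then have "p = 0" using T by (simp add: Nec_Ob)
  then have "\<alpha> = constD n 0" using Delta_0 \<alpha> by simp
  then show ?thesis using eval_const_first[OF W.a W.T W.xs] eval_const_first[OF a T xs] by simp
next
  case False
  then have i: "in_bead T i n \<alpha>" and iT: "i < beads T" using i by (auto simp: in_bead_def)
  have "in_bead (wedge T p U) i n \<alpha>"
    using i joint_wedge_left[OF T U, of i] joint_wedge_left[OF T U, of "Suc i"]
    by (simp add: in_bead_def beads_wedge[OF T U])
  moreover have "\<alpha> \<in> Delta n (p + q)" using \<alpha> by (auto simp: Delta_def PiE_iff trans_le_add1)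
  ultimately show ?thesis
    using T.eval_eq[OF \<alpha> i] W.eval_eq[of \<alpha> n i] iT
    by (simp add: bead_dim_wedge_left[OF T U] joint_wedge_left[OF T U] nth_append T.length_xs)
qed

text \<open>Indices shift by \<open>beads T\<close> and joints by \<open>p\<close>. If \<alpha> is
  constant at 0, the least bead containing the shifted map can be the last bead of \<open>T\<close>;
  \<open>eval_eq\<close> allows computing in bead \<open>beads T + i\<close> all the same.\<close>

lemma eval_wedge_right:
  assumes \<alpha>: "\<alpha> \<in> Delta n q" and i: "U = {0} \<or> in_bead U i n \<alpha>"
  shows "nec_eval X a (wedge T p U) (xs @ ys) n (\<lambda>r\<in>{..n}. p + \<alpha> r) = nec_eval X b U ys n \<alpha>"
proof (cases "U = {0}")
  case True
  then have q: "q = 0" using U by (simp add: Nec_Ob)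
  then have "\<alpha> = constD n 0" using Delta_0 \<alpha> by simp
  moreover from this have "(\<lambda>r\<in>{..n}. p + \<alpha> r) = constD n p" by (intro restrict_ext) simp
  ultimately show ?thesis using eval_const_last[OF W.a W.T W.xs] eval_const_last[OF b U ys] q by simp
next
  case False
  let ?\<alpha> = "\<lambda>r\<in>{..n}. p + \<alpha> r"
  have i: "in_bead U i n \<alpha>" and iU: "i < beads U" using i False by (auto simp: in_bead_def)
  have "in_bead (wedge T p U) (beads T + i) n ?\<alpha>"
    using i joint_wedge_right[OF T U, of i] joint_wedge_right[OF T U, of "Suc i"]
    by (auto simp: in_bead_def beads_wedge[OF T U] image_subset_iff)
  moreover have "?\<alpha> \<in> Delta n (p + q)" using \<alpha> by (auto simp: Delta_def PiE_iff mono_on_def)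
  moreover have "(\<lambda>r\<in>{..n}. ?\<alpha> r - (p + joint U i)) = (\<lambda>r\<in>{..n}. \<alpha> r - joint U i)"
    by (rule restrict_ext) simp
  ultimately show ?thesis
    using U.eval_eq[OF \<alpha> i] W.eval_eq[of ?\<alpha> n "beads T + i"] iU
    by (simp add: bead_dim_wedge_right[OF T U] joint_wedge_right[OF T U] nth_append T.length_xs)
qed

end

lemma compose_bead_incl_left:
  assumes "(T, p) \<in> Ob Nec" "(U, q) \<in> Ob Nec" "i < beads T" "\<And>v. v \<le> p \<Longrightarrow> h v = f v"
  shows "compose {..bead_dim T i} h (bead_incl (wedge T p U) i) = compose {..bead_dim T i} f (bead_incl T i)"
  using assms Delta_apply[OF bead_incl(1)[OF assms(1,3)]]
  by (auto simp: compose_def bead_incl_def joint_wedge_left bead_dim_wedge_left intro!: restrict_ext)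

lemma compose_bead_incl_right:
  assumes "(T, p) \<in> Ob Nec" "(U, q) \<in> Ob Nec" "i < beads U" "\<And>v. v \<le> q \<Longrightarrow> h (p + v) = g v"
  shows "compose {..bead_dim U i} h (bead_incl (wedge T p U) (beads T + i)) = compose {..bead_dim U i} g (bead_incl U i)"
  using assms Delta_apply[OF bead_incl(1)[OF assms(2,3)]]
  by (auto simp: compose_def bead_incl_def joint_wedge_right bead_dim_wedge_right add.assoc intro!: restrict_ext)

text \<open>The wedge of \<open>f\<close> and \<open>g\<close> sends the beads of \<open>T\<close>
  into the part of \<open>U\<close> and those of \<open>T'\<close> into the part of
  \<open>U'\<close>, where evaluating \<open>xs @ ys\<close> reduces to evaluating one
  factor.\<close>

lemma nec_psh_wedge:
  assumes a: "a \<in> simplices X 0" and b: "b \<in> simplices X 0"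
    and T: "(T, p) \<in> Ob Nec" and U: "(U, q) \<in> Ob Nec"
    and T': "(T', p') \<in> Ob Nec" and U': "(U', q') \<in> Ob Nec"
    and f: "f \<in> Ar Nec (T, p) (U, q)" and g: "g \<in> Ar Nec (T', p') (U', q')"
    and xs: "xs \<in> nec_simplices X a b U" and ys: "ys \<in> nec_simplices X b c U'"
  shows "psh_map (nec_psh X a c) (wedge T p T', p + p') (wedge U q U', q + q') (wedge_map p p' q f g) (xs @ ys) =
    psh_map (nec_psh X a b) (T, p) (U, q) f xs @ psh_map (nec_psh X b c) (T', p') (U', q') g ys"
  unfolding nec_psh_simps
proof (rule map_beads_wedge[OF T T'])
  have f': "f \<in> Delta p q" "f p = q" and g': "g \<in> Delta p' q'" "g 0 = 0" using f g by (simp_all add: Nec_Ar)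
  note w = wedge_map_simps[where f = f and g = g and p' = p', OF f'(2) g'(2)]
  note ev = eval_wedge_left[OF a b U U' xs ys] eval_wedge_right[OF a b U U' xs ys]
  let ?h = "wedge_map p p' q f g"
  fix i
  show "nec_eval X a (wedge U q U') (xs @ ys) (bead_dim (wedge T p T') i)
      (compose {..bead_dim (wedge T p T') i} ?h (bead_incl (wedge T p T') i)) =
    nec_eval X a U xs (bead_dim T i) (compose {..bead_dim T i} f (bead_incl T i))" if i: "i < beads T"
  proof -
    obtain j where "U = {0} \<or> in_bead U j (bead_dim T i) (compose {..bead_dim T i} f (bead_incl T i))"
      using in_bead_map[OF T U f bead_incl(2)[OF T i]] by blast
    then show ?thesis
      using ev(1)[OF Delta_compose[OF bead_incl(1)[OF T i] f'(1)]] w(1)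
        compose_bead_incl_left[OF T T' i, of ?h f] by (simp add: bead_dim_wedge_left[OF T T' i])
  qed
  show "nec_eval X a (wedge U q U') (xs @ ys) (bead_dim (wedge T p T') (beads T + i))
      (compose {..bead_dim (wedge T p T') (beads T + i)} ?h (bead_incl (wedge T p T') (beads T + i))) =
    nec_eval X b U' ys (bead_dim T' i) (compose {..bead_dim T' i} g (bead_incl T' i))" if i: "i < beads T'"
  proof -
    let ?\<alpha> = "compose {..bead_dim T' i} g (bead_incl T' i)"
    obtain j where j: "U' = {0} \<or> in_bead U' j (bead_dim T' i) ?\<alpha>"
      using in_bead_map[OF T' U' g bead_incl(2)[OF T' i]] by blast
    have "compose {..bead_dim T' i} ?h (bead_incl (wedge T p T') (beads T + i)) =
        compose {..bead_dim T' i} (\<lambda>v. q + g v) (bead_incl T' i)"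
      using w(2) by (intro compose_bead_incl_right[OF T T' i])
    also have "\<dots> = (\<lambda>r\<in>{..bead_dim T' i}. q + ?\<alpha> r)"
      by (auto simp: compose_def intro!: restrict_ext)
    finally show ?thesis
      using ev(2)[OF Delta_compose[OF bead_incl(1)[OF T' i] g'(1)] j] by (simp add: bead_dim_wedge_right[OF T T' i])
  qed
qed

text \<open>By Yoneda, the path of \<open>x\<close> stands for the map
  \<open>\<Delta>\<^sup>e \<rightarrow> X\<close> classified by \<open>x\<close>. For
  \<open>e = 0\<close> the empty path forgets \<open>x\<close>, and the starting vertex passed to
  \<open>nec_eval\<close> recovers it.\<close>

lemma eval_simplex_path:
  assumes x: "x \<in> simplices X e" and \<alpha>: "\<alpha> \<in> Delta n e"
  shows "nec_eval X (vert X e 0 x) {0, e} (simplex_path e x) n \<alpha> = act X n e \<alpha> x"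
proof (cases "e = 0")
  case True
  then show ?thesis using Delta_0[of \<alpha> n] \<alpha> act_constD[OF x, of 0 n] by (simp add: nec_eval_def)
next
  case False
  interpret necklace_in X "vert X e 0 x" "vert X e e x" "{0, e}" e "simplex_path e x"
    using simplex_path[OF x] vert_closed[OF x] simplex_Ob by unfold_locales auto
  have j: "joint {0, e} 0 = 0" "joint {0, e} (Suc 0) = e" using joint_0[OF T] joint_simplex False by auto
  then have "in_bead {0, e} 0 n \<alpha>" using Delta_apply[OF \<alpha>] False by (auto simp: in_bead_def beads_simplex)
  moreover have "(\<lambda>r\<in>{..n}. \<alpha> r) = \<alpha>" using \<alpha> by (auto simp: Delta_def PiE_iff extensional_restrict)
  ultimately show ?thesis using eval_eq[OF \<alpha>] False by (simp add: j bead_dim_simplex simplex_path_def)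
qed

lemma nec_psh_simplex_path:
  assumes "x \<in> simplices X e" "vert X e 0 x = a" "(T, p) \<in> Ob Nec" "f \<in> Delta p e"
  shows "psh_map (nec_psh X a b) (T, p) ({0, e}, e) f (simplex_path e x) = restr_path X e x T f"
  unfolding nec_psh_simps restr_path_def
  using eval_simplex_path[OF assms(1) Delta_compose[OF bead_incl(1)[OF assms(3)] assms(4)]] assms(2) by auto

lemma restr_path_wedge:
  assumes "(T, p) \<in> Ob Nec" "(U, q) \<in> Ob Nec"
    and "\<And>v. v \<le> p \<Longrightarrow> h v = f v" "\<And>v. v \<le> q \<Longrightarrow> h (p + v) = g v"
  shows "restr_path X e x (wedge T p U) h = restr_path X e x T f @ restr_path X e x U g"
  unfolding restr_path_def
  using compose_bead_incl_left[of T p U q _ h f, OF assms(1,2) _ assms(3)]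
    compose_bead_incl_right[of T p U q _ h g, OF assms(1,2) _ assms(4)]
  by (intro map_beads_wedge[OF assms(1,2)])
    (simp_all add: bead_dim_wedge_left[OF assms(1,2)] bead_dim_wedge_right[OF assms(1,2)])

lemma restr_path_simplex:
  assumes "f \<in> Delta d e"
  shows "restr_path X e x {0, d} f = simplex_path d (act X d e f x)"
proof (cases "d = 0")
  case False
  have "bead_incl {0, d} 0 = idD d"
    using False joint_0[OF simplex_Ob[of d]] by (simp add: bead_incl_def bead_dim_simplex)
  then show ?thesis using False compose_idD_right[OF assms]
    by (simp add: restr_path_def beads_simplex bead_dim_simplex simplex_path_def)
qed (use beads_simplex[of 0] in \<open>simp add: restr_path_def simplex_path_def\<close>)

end

text \<open>The gluing point \<open>q\<close> is a joint of the target, so the condition on joints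
  gives a joint \<open>t\<close> of \<open>T\<close> with \<open>f t = q\<close>. Cutting
  \<open>T\<close> and \<open>f\<close> at \<open>t\<close> yields the two factors.\<close>

lemma Nec_Ar_wedgeE:
  assumes T: "(T, p) \<in> Ob Nec" and U: "(U, q) \<in> Ob Nec" and U': "(U', q') \<in> Ob Nec"
    and f: "f \<in> Ar Nec (T, p) (wedge U q U', q + q')"
  obtains T1 p1 f1 T2 p2 f2 where "(T1, p1) \<in> Ob Nec" "(T2, p2) \<in> Ob Nec" "T = wedge T1 p1 T2" "p = p1 + p2"
    "f1 \<in> Ar Nec (T1, p1) (U, q)" "f2 \<in> Ar Nec (T2, p2) (U', q')" "f = wedge_map p1 p2 q f1 f2"
proof -
  have f': "f \<in> Delta p (q + q')" "f 0 = 0" "f p = q + q'" "wedge U q U' \<subseteq> f ` T" using f by (simp_all add: Nec_Ar)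
  have "q \<in> wedge U q U'" using U by (simp add: wedge_def Nec_Ob)
  then obtain t where t: "t \<in> T" "f t = q" using f'(4) by auto
  then have tp: "t \<le> p" using T by (auto simp: Nec_Ob)
  define f1 where "f1 = restrict f {..t}"
  define f2 where "f2 = (\<lambda>v\<in>{..p - t}. f (t + v) - q)"
  have lo: "f v \<le> q" if "v \<le> t" for v using Delta_mono[OF f'(1) that tp] t by simp
  have hi: "q \<le> f v" if "t \<le> v" "v \<le> p" for v using Delta_mono[OF f'(1) that] t by simp
  have "f1 \<in> Delta t q"
    using lo Delta_mono[OF f'(1)] tp by (auto simp: f1_def Delta_def mono_on_def)
  moreover have "U \<subseteq> f1 ` (T \<inter> {..t})"
  proof
    fix u assume u: "u \<in> U"
    then have "u \<in> wedge U q U'" by (simp add: wedge_def)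
    then obtain s where s: "s \<in> T" "f s = u" using f'(4) by auto
    show "u \<in> f1 ` (T \<inter> {..t})"
    proof (cases "s \<le> t")
      case True
      then show ?thesis using s by (intro image_eqI[of _ _ s]) (auto simp: f1_def)
    next
      case False
      \<comment> \<open>A joint of \<open>U\<close> that is hit only to the right of
        \<open>t\<close> must be \<open>q\<close> by monotonicity, and \<open>t\<close> itself hits
        \<open>q\<close>.\<close>
      then have "q \<le> u" using hi[of s] s T by (auto simp: Nec_Ob)
      then have "u = q" using u U by (auto simp: Nec_Ob)
      then show ?thesis using t by (intro image_eqI[of _ _ t]) (auto simp: f1_def)
    qed
  qed
  ultimately have 1: "f1 \<in> Ar Nec (T \<inter> {..t}, t) (U, q)" using f' t by (simp add: Nec_Ar) (simp add: f1_def)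
  have "f (t + v) - q \<le> f (t + w) - q" if "v \<le> w" "w \<le> p - t" for v w
    using that tp by (intro diff_le_mono Delta_mono[OF f'(1)]) auto
  moreover have "f (t + v) - q \<le> q'" if "v \<le> p - t" for v
  proof -
    have "t + v \<le> p" using that tp by simp
    then show ?thesis using Delta_apply[OF f'(1)] by fastforce
  qed
  ultimately have "f2 \<in> Delta (p - t) q'" by (auto simp: f2_def Delta_def mono_on_def)
  moreover have "U' \<subseteq> f2 ` {v. t + v \<in> T}"
  proof
    fix u assume u: "u \<in> U'"
    then have "q + u \<in> wedge U q U'" by (simp add: wedge_def)
    then obtain s where s: "s \<in> T" "f s = q + u" using f'(4) by auto
    have sp: "s \<le> p" using s T by (auto simp: Nec_Ob)
    show "u \<in> f2 ` {v. t + v \<in> T}"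
    proof (cases "t \<le> s")
      case True
      then show ?thesis using s sp by (intro image_eqI[of _ _ "s - t"]) (auto simp: f2_def)
    next
      case False
      \<comment> \<open>Symmetrically, a joint of \<open>U'\<close> hit to the left of
        \<open>t\<close> can only be the gluing point, which is hit by \<open>t\<close>.\<close>
      then have "u = 0" using lo[of s] s by simp
      then show ?thesis using t by (intro image_eqI[of _ _ 0]) (auto simp: f2_def)
    qed
  qed
  ultimately have 2: "f2 \<in> Ar Nec ({v. t + v \<in> T}, p - t) (U', q')" using f' t tp by (simp add: Nec_Ar) (simp add: f2_def)
  have "f v = wedge_map t (p - t) q f1 f2 v" if "v \<in> {..t + (p - t)}" for v
    using that tp hi[of v] by (auto simp: wedge_map_def f1_def f2_def)
  moreover have "f \<in> extensional {..t + (p - t)}" using f'(1) tp by (simp add: Delta_def PiE_iff)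
  ultimately have "f = wedge_map t (p - t) q f1 f2"
    by (intro extensionalityI[of _ "{..t + (p - t)}"]) (auto simp: wedge_map_def)
  then show ?thesis
    using that[OF split_Ob(1)[OF T t(1)] split_Ob(2)[OF T t(1)] wedge_split[OF t(1), symmetric] _ 1 2] tp by simp
qed

lemma image_wedge_map:
  assumes "f p = q" "g 0 = 0" "V \<subseteq> {..p}" "W \<subseteq> {..p'}"
  shows "wedge_map p p' q f g ` wedge V p W = wedge (f ` V) q (g ` W)"
proof -
  note w = wedge_map_simps[where f = f and g = g and p' = p', OF assms(1,2)]
  have "wedge_map p p' q f g ` V = f ` V" using w(1) assms(3) by (intro image_cong) auto
  moreover have "wedge_map p p' q f g ` (+) p ` W = (+) q ` g ` W"
    unfolding image_image using w(2) assms(4) by (intro image_cong) auto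
  ultimately show ?thesis by (simp add: wedge_def image_Un)
qed

section \<open>Cutting chains into words\<close>

text \<open>Every letter runs from the first to the last vertex of its own bead simplex, and its
  chain is the part of \<open>y\<close> between two consecutive joints, translated to start at
  0.\<close>

definition nec_word :: "nat \<Rightarrow> nat set \<Rightarrow> 'a list \<Rightarrow> (nat \<Rightarrow> nat set) \<Rightarrow> (nat \<times> 'a, nat, nat \<Rightarrow> nat set) word" where
  "nec_word n T xs y =
    map (\<lambda>i. ((bead_dim T i, xs ! i), 0, bead_dim T i,
      \<lambda>r\<in>{..n}. {v. v \<le> bead_dim T i \<and> joint T i + v \<in> y r})) [0..<beads T]"

lemma nec_word_zero: "nec_word n {0} xs y = []"
  by (simp add: nec_word_def beads_def)

lemma nec_word_simplex:
  assumes "0 < d" "y \<in> chains {0, d} d n"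
  shows "nec_word n {0, d} [x] y = [((d, x), 0, d, y)]"
proof -
  have "(\<lambda>r\<in>{..n}. {v. v \<le> d \<and> v \<in> y r}) = y"
    using assms(2) by (intro extensionalityI[of _ "{..n}"]) (auto simp: chains_iff)
  then show ?thesis using assms(1) joint_0[OF simplex_Ob[of d]]
    by (simp add: nec_word_def beads_simplex bead_dim_simplex)
qed

text \<open>Between two joints of one factor only the chain of that factor contributes. At the
  gluing point \<open>p\<close> both do, but \<open>p \<in> y r\<close> and
  \<open>0 \<in> z r\<close> give the same element.\<close>

lemma nec_word_wedge:
  assumes T: "(T, p) \<in> Ob Nec" and U: "(U, q) \<in> Ob Nec" and len: "length xs = beads T"
    and y: "y \<in> chains T p n" and z: "z \<in> chains U q n"
  shows "nec_word n (wedge T p U) (xs @ ys) (wedge_chain n p y z) = nec_word n T xs y @ nec_word n U ys z"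
  unfolding nec_word_def
proof (rule map_beads_wedge[OF T U])
  fix i assume i: "i < beads T"
  have "joint T i + v \<in> wedge (y r) p (z r) \<longleftrightarrow> joint T i + v \<in> y r" if "v \<le> bead_dim T i" "r \<le> n" for v r
  proof -
    have "joint T i + v \<le> p" using that bead_dim[OF T i] joint_le[OF T, of "Suc i" "beads T"] i joint_last[OF T] by simp
    moreover have "y r \<subseteq> {..p}" "p \<in> y r" using y that T by (auto simp: chains_iff Nec_Ob)
    ultimately show ?thesis using wedge_lower[of "y r" p "z r"] by auto
  qed
  then show "((bead_dim (wedge T p U) i, (xs @ ys) ! i), 0, bead_dim (wedge T p U) i,
      \<lambda>r\<in>{..n}. {v. v \<le> bead_dim (wedge T p U) i \<and> joint (wedge T p U) i + v \<in> wedge_chain n p y z r}) =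
    ((bead_dim T i, xs ! i), 0, bead_dim T i, \<lambda>r\<in>{..n}. {v. v \<le> bead_dim T i \<and> joint T i + v \<in> y r})"
    using i len by (auto simp: bead_dim_wedge_left[OF T U] joint_wedge_left[OF T U] nth_append wedge_chain_def
        intro!: restrict_ext)
next
  fix i assume i: "i < beads U"
  have "p + (joint U i + v) \<in> wedge (y r) p (z r) \<longleftrightarrow> joint U i + v \<in> z r" if "r \<le> n" for v r
  proof -
    have "y r \<subseteq> {..p}" "0 \<in> z r" using y z that T U by (auto simp: chains_iff Nec_Ob)
    then show ?thesis using wedge_upper[of "y r" p "z r"] by auto
  qed
  then show "((bead_dim (wedge T p U) (beads T + i), (xs @ ys) ! (beads T + i)), 0, bead_dim (wedge T p U) (beads T + i),
      \<lambda>r\<in>{..n}. {v. v \<le> bead_dim (wedge T p U) (beads T + i) \<and>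
        joint (wedge T p U) (beads T + i) + v \<in> wedge_chain n p y z r}) =
    ((bead_dim U i, ys ! i), 0, bead_dim U i, \<lambda>r\<in>{..n}. {v. v \<le> bead_dim U i \<and> joint U i + v \<in> z r})"
    using i len by (auto simp: bead_dim_wedge_right[OF T U] joint_wedge_right[OF T U] nth_append wedge_chain_def
        add.assoc intro!: restrict_ext)
qed

lemma simplex_scat_hom_chains:
  "g \<in> simplices (hom (simplex_scat m) i j) n \<longleftrightarrow> i \<le> j \<and> g \<in> chains {0, j - i} (j - i) n"
  by (simp add: simplex_scat_simps empty_sset_def)

section \<open>Words in the categorification, and cutting as a map compatible with necklace
  maps\<close>

context simplicial_set
begin

abbreviation "J \<equiv> simplex_category X"
abbreviation "D \<equiv> simplex_diagram :: (nat \<times> 'a, nat \<Rightarrow> nat, nat, nat \<Rightarrow> nat set) cdiag"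
abbreviation "cv \<equiv> cat_vertex X"

sublocale C: scat_diagram J D
  by (rule scat_diagram_simplex_diagram)

lemma Ob_J: "(n, x) \<in> Ob J \<longleftrightarrow> x \<in> simplices X n"
  by (simp add: simplex_category_def)

lemma Ar_J: "\<alpha> \<in> Ar J (m, y) (n, x) \<longleftrightarrow> \<alpha> \<in> Delta m n \<and> act X m n \<alpha> x = y"
  by (simp add: simplex_category_def)

lemma D_simps: "cd_ob D (n, x) = simplex_scat n" "cd_map D j k f = simplex_scat_map f"
  by (simp_all add: simplex_diagram_def)

text \<open>The \<open>i\<close>-th vertex \<open>[0] \<rightarrow> [n]\<close> is an arrow in the
  category of simplices of \<open>X\<close>; it identifies the object of
  \<open>\<CC>[\<Delta>\<^sup>0]\<close> with the object \<open>i\<close>.\<close>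

lemma colim_ob_eq_vertex:
  assumes "x \<in> simplices X n" "i \<le> n"
  shows "colim_ob J D (n, x) i = cv (vert X n i x)"
proof -
  have "colim_ob J D (n, x) (fob (cd_map D (0, vert X n i x) (n, x) (constD 0 i)) 0) = colim_ob J D (0, vert X n i x) 0"
    using assms vert_closed[OF assms] Delta_constD[OF assms(2), of 0]
    by (intro colim_ob_arrow) (simp_all add: Ob_J Ar_J D_simps simplex_scat_simps(1) vert_def del: atMost_0)
  then show ?thesis by (simp add: D_simps simplex_scat_map_simps(1) cat_vertex_def scat_colim_inj_def)
qed

lemma vert_act: "\<alpha> \<in> Delta m n \<Longrightarrow> x \<in> simplices X n \<Longrightarrow> i \<le> m \<Longrightarrow> vert X m i (act X m n \<alpha> x) = vert X n (\<alpha> i) x"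
proof -
  assume a: "\<alpha> \<in> Delta m n" "x \<in> simplices X n" "i \<le> m"
  have "compose {..0} \<alpha> (constD 0 i) = constD 0 (\<alpha> i)" by (auto simp: compose_def intro!: restrict_ext)
  then show ?thesis using act_compose[OF Delta_constD[OF a(3), of 0] a(1,2)] by (simp add: vert_def)
qed

lemma word_Nil: "a \<in> simplices X 0 \<Longrightarrow> colim_word J D n (cv a) (cv a) []"
  using colim_word.Nil[of "(0, a)" J 0 D n]
  by (simp add: Ob_J D_simps simplex_scat_simps(1) cat_vertex_def scat_colim_inj_def)

lemma word_Cons:
  assumes "x \<in> simplices X m" "i \<le> j" "j \<le> m" "g \<in> chains {0, j - i} (j - i) n"
    and "colim_word J D n (cv (vert X m j x)) Z u"
  shows "colim_word J D n (cv (vert X m i x)) Z (((m, x), i, j, g) # u)"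
  using colim_word.Cons[of "(m, x)" J i D j g n Z u] assms
  by (simp add: Ob_J D_simps simplex_scat_simps(1) simplex_scat_hom_chains colim_ob_eq_vertex)

lemma eq_identity:
  assumes "x \<in> simplices X m" "i \<le> m"
  shows "colim_eq J D n (cv (vert X m i x)) (cv (vert X m i x)) [((m, x), i, i, \<lambda>r\<in>{..n}. {0})] []"
  using colim_eq.identity[of "(m, x)" J i D n] assms
  by (simp add: Ob_J D_simps simplex_scat_simps(1) colim_ob_eq_vertex)
    (simp add: simplex_scat_simps degen_nerve)

lemma eq_composite:
  assumes "x \<in> simplices X m" "i \<le> j" "j \<le> k" "k \<le> m"
    "g \<in> chains {0, j - i} (j - i) n" "h \<in> chains {0, k - j} (k - j) n"
  shows "colim_eq J D n (cv (vert X m i x)) (cv (vert X m k x))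
    [((m, x), i, j, g), ((m, x), j, k, h)] [((m, x), i, k, wedge_chain n (j - i) g h)]"
  using colim_eq.composite[of "(m, x)" J i D j k g n h] assms
  by (simp add: Ob_J D_simps simplex_scat_simps(1,4) simplex_scat_hom_chains colim_ob_eq_vertex wedge_chain_def wedge_def)

lemma eq_arrow:
  assumes "x \<in> simplices X m" "\<alpha> \<in> Delta l m" "i \<le> j" "j \<le> l" "g \<in> chains {0, j - i} (j - i) n"
  shows "colim_eq J D n (cv (vert X m (\<alpha> i) x)) (cv (vert X m (\<alpha> j) x))
    [((l, act X l m \<alpha> x), i, j, g)] [((m, x), \<alpha> i, \<alpha> j, \<lambda>r\<in>{..n}. (\<lambda>v. \<alpha> (i + v) - \<alpha> i) ` g r)]"
  using colim_eq.arrow[of "(l, act X l m \<alpha> x)" J "(m, x)" \<alpha> i D j g n] assms act_closed[OF assms(2,1)]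
  by (simp add: Ob_J Ar_J D_simps simplex_scat_simps(1) simplex_scat_map_simps simplex_scat_hom_chains
      colim_ob_eq_vertex vert_act)

text \<open>All letters lie over restrictions of the one simplex \<open>x\<close>. The arrow
  relation moves each of them to \<open>x\<close> itself, where the composite relation merges them
  into one letter. After the first bead is removed the remaining map starts at \<open>f d\<close>,
  so \<open>f\<close> is an arbitrary monotone map and its values are translated by
  \<open>f 0\<close>.\<close>

lemma nec_word_restr_path:
  assumes "(T, p) \<in> Ob Nec" "f \<in> Delta p e" "x \<in> simplices X e" "y \<in> chains T p n"
  shows "colim_eq J D n (cv (vert X e (f 0) x)) (cv (vert X e (f p) x))
    (nec_word n T (restr_path X e x T f) y) [((e, x), f 0, f p, \<lambda>r\<in>{..n}. (\<lambda>v. f v - f 0) ` y r)]"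
  using assms
proof (induction T p arbitrary: f y rule: Nec_induct)
  case zero
  then have y: "y = (\<lambda>r\<in>{..n}. {0})" by (simp add: chains_zero)
  then have "(\<lambda>r\<in>{..n}. (\<lambda>v. f v - f 0) ` y r) = (\<lambda>r\<in>{..n}. {0})" by (auto intro!: restrict_ext)
  \<comment> \<open>Without beads the word is empty, and the identity relation makes it equal to the
    identity letter at \<open>f 0\<close>.\<close>
  then show ?case using colim_eq.sym[OF eq_identity[OF zero(2), of "f 0" n]] Delta_apply[OF zero(1)]
    by (simp only: nec_word_zero order.refl)
next
  case (wedge d T p)
  define f1 where "f1 = restrict f {..d}"
  define f2 where "f2 = (\<lambda>v\<in>{..p}. f (d + v))"
  have f1: "f1 \<in> Delta d e" and f2: "f2 \<in> Delta p e"
    using Delta_mono[OF wedge.prems(1)] Delta_apply[OF wedge.prems(1)]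
    by (auto simp: f1_def f2_def Delta_def mono_on_def)
  have fs: "f1 0 = f 0" "f1 d = f d" "f2 0 = f d" "f2 p = f (d + p)" by (simp_all add: f1_def f2_def)
  have le: "f 0 \<le> f d" "f d \<le> f (d + p)" "f (d + p) \<le> e"
    using Delta_mono[OF wedge.prems(1)] Delta_apply[OF wedge.prems(1)] by auto
  obtain y1 y2 where y1: "y1 \<in> chains {0, d} d n" and y2: "y2 \<in> chains T p n" and y: "y = wedge_chain n d y1 y2"
    using wedge_chain_cases[OF simplex_Ob wedge.hyps(2) wedge.prems(3)] .
  have v1: "v \<le> d" if "r \<le> n" "v \<in> y1 r" for r v using that y1 by (auto simp: chains_iff)
  have v2: "v \<le> p" if "r \<le> n" "v \<in> y2 r" for r v using that y2 by (auto simp: chains_iff)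
  let ?g = "\<lambda>r\<in>{..n}. (\<lambda>v. f1 (0 + v) - f1 0) ` y1 r" and ?h = "\<lambda>r\<in>{..n}. (\<lambda>v. f2 v - f2 0) ` y2 r"
  have path: "restr_path X e x (wedge {0, d} d T) f = [act X d e f1 x] @ restr_path X e x T f2"
    using restr_path_wedge[of "{0, d}" d T p f f1 f2 e x, OF simplex_Ob wedge.hyps(2)] \<open>0 < d\<close>
    by (simp add: f1_def f2_def restr_path_simplex[OF f1, unfolded f1_def] simplex_path_def)
  have "nec_word n (wedge {0, d} d T) (restr_path X e x (wedge {0, d} d T) f) y =
      [((d, act X d e f1 x), 0, d, y1)] @ nec_word n T (restr_path X e x T f2) y2"
    unfolding path y using \<open>0 < d\<close>
    by (subst nec_word_wedge[OF simplex_Ob wedge.hyps(2) _ y1 y2]) (simp_all add: beads_simplex nec_word_simplex[OF _ y1])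
  moreover have 1: "colim_eq J D n (cv (vert X e (f 0) x)) (cv (vert X e (f d) x))
      [((d, act X d e f1 x), 0, d, y1)] [((e, x), f 0, f d, ?g)]"
    using eq_arrow[OF wedge.prems(2) f1, of 0 d y1 n] y1 unfolding fs by simp
  moreover have 2: "colim_eq J D n (cv (vert X e (f d) x)) (cv (vert X e (f (d + p)) x))
      (nec_word n T (restr_path X e x T f2) y2) [((e, x), f d, f (d + p), ?h)]"
    using wedge.IH[OF f2 wedge.prems(2) y2] unfolding fs .
  moreover have "?g \<in> chains {0, f d - f 0} (f d - f 0) n"
    using sset_mapD(1)[OF simplicial_functor.fmo_map[OF simplicial_functor_simplex_scat_map[OF f1]], of 0 d y1 n] y1 le
    by (simp add: simplex_scat_simps(1) simplex_scat_hom_chains simplex_scat_map_simps fs)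
  moreover have "?h \<in> chains {0, f (d + p) - f d} (f (d + p) - f d) n"
  proof -
    \<comment> \<open>Forgetting the inner joints of \<open>T\<close> turns \<open>y2\<close> into a
      morphism from 0 to \<open>p\<close> in \<open>\<CC>[\<Delta>\<^sup>p]\<close>, to which the
      functor of \<open>f2\<close> applies.\<close>
    have "y2 \<in> chains {0, p} p n" using y2 wedge.hyps(2) by (auto simp: chains_iff Nec_Ob)
    then show ?thesis
      using sset_mapD(1)[OF simplicial_functor.fmo_map[OF simplicial_functor_simplex_scat_map[OF f2]], of 0 p y2 n] le
      by (simp add: simplex_scat_simps(1) simplex_scat_hom_chains simplex_scat_map_simps fs)
  qed
  ultimately have "colim_eq J D n (cv (vert X e (f 0) x)) (cv (vert X e (f (d + p)) x))
      (nec_word n (wedge {0, d} d T) (restr_path X e x (wedge {0, d} d T) f) y)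
      [((e, x), f 0, f (d + p), wedge_chain n (f d - f 0) ?g ?h)]"
    using colim_eq.trans[OF colim_eq.append[OF 1 2]] eq_composite[OF wedge.prems(2) le, of ?g n ?h] by simp
  moreover have "wedge_chain n (f d - f 0) ?g ?h = (\<lambda>r\<in>{..n}. (\<lambda>v. f v - f 0) ` y r)"
    unfolding y wedge_chain_def
  proof (rule restrict_ext)
    fix r assume r: "r \<in> {..n}"
    have "(\<lambda>v. f1 (0 + v) - f1 0) ` y1 r = (\<lambda>v. f v - f 0) ` y1 r"
      using v1 r by (intro image_cong) (auto simp: f1_def)
    \<comment> \<open>The two translations add up: the one by \<open>f d\<close> in the second
      letter and the offset \<open>f d - f 0\<close> of the wedge amount to the translation by
      \<open>f 0\<close>. Monotonicity of \<open>f\<close> makes the truncated differences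
      exact.\<close>
    moreover have "(+) (f d - f 0) ` (\<lambda>v. f2 v - f2 0) ` y2 r = (\<lambda>v. f v - f 0) ` (+) d ` y2 r"
      unfolding image_image
    proof (rule image_cong[OF HOL.refl])
      fix v assume "v \<in> y2 r"
      then have "v \<le> p" using v2 r by simp
      then show "f d - f 0 + (f2 v - f2 0) = f (d + v) - f 0"
        using le Delta_mono[OF wedge.prems(1), of d "d + v"] by (simp add: f2_def)
    qed
    ultimately show "wedge (?g r) (f d - f 0) (?h r) = (\<lambda>v. f v - f 0) ` (\<lambda>r\<in>{..n}. wedge (y1 r) d (y2 r)) r"
      using r by (simp add: wedge_def image_Un)
  qed
  ultimately show ?case by (simp only:)
qed

text \<open>\<open>f\<close> is cut over the first bead of \<open>U\<close>. Over that bead the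
  letters of \<open>T\<close> merge by \<open>nec_word_restr_path\<close>, the rest is the induction
  hypothesis, and wedges become concatenations on both sides.\<close>

lemma nec_word_psh_map:
  assumes "(U, q) \<in> Ob Nec" and "(T, p) \<in> Ob Nec" and "f \<in> Ar Nec (T, p) (U, q)"
    and "a \<in> simplices X 0" and "xs \<in> nec_simplices X a c U" and "y \<in> chains T p n"
  shows "colim_eq J D n (cv a) (cv c)
    (nec_word n T (psh_map (nec_psh X a c) (T, p) (U, q) f xs) y) (nec_word n U xs (\<lambda>r\<in>{..n}. f ` y r))"
  using assms
proof (induction U q arbitrary: T p f a xs y rule: Nec_induct)
  case zero
  then have f: "f \<in> Delta p 0" "f 0 = 0" "f p = 0" by (simp_all add: Nec_Ar)
  \<comment> \<open>\<open>T\<close> may still have beads, all collapsed to \<open>a\<close>.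
    Reading the empty path as the path of the 0-simplex \<open>a\<close> makes this the case
    \<open>e = 0\<close> of \<open>nec_word_restr_path\<close>, ending in an identity
    letter.\<close>
  have xs: "xs = simplex_path 0 a" "c = a" using zero(4) by (auto simp: nec_simplices_def simplex_path_def split: if_splits)
  have va: "vert X 0 0 a = a" using degen_0[OF zero(3)] by (simp add: vert_def degen_def)
  have "y r \<subseteq> {..p}" "0 \<in> y r" if "r \<le> n" for r using zero(1,5) that by (auto simp: chains_iff Nec_Ob)
  then have "(\<lambda>v. f v - f 0) ` y r = {0}" if "r \<le> n" for r
    using Delta_apply[OF f(1)] f(2) that by (fastforce intro!: rev_image_eqI)
  then have "(\<lambda>r\<in>{..n}. (\<lambda>v. f v - f 0) ` y r) = (\<lambda>r\<in>{..n}. {0})" by (intro restrict_ext) simp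
  then have "colim_eq J D n (cv a) (cv a) (nec_word n T (restr_path X 0 a T f) y) [((0, a), 0, 0, \<lambda>r\<in>{..n}. {0})]"
    using nec_word_restr_path[OF zero(1) f(1) zero(3,5)] unfolding f va by simp
  moreover have "colim_eq J D n (cv a) (cv a) [((0, a), 0, 0, \<lambda>r\<in>{..n}. {0})] []"
    using eq_identity[OF zero(3), of 0 n] va by simp
  moreover have "psh_map (nec_psh X a c) (T, p) ({0}, 0) f xs = restr_path X 0 a T f"
    using nec_psh_simplex_path[OF zero(3) va zero(1) f(1)] xs by simp
  ultimately show ?case unfolding nec_word_zero xs(2) by (metis colim_eq.trans)
next
  case (wedge d U q)
  obtain x xs' where xs: "xs = [x] @ xs'" and x: "x \<in> simplices X d" "vert X d 0 x = a"
    and xs': "xs' \<in> nec_simplices X (vert X d d x) c U"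
    using nec_simplices_wedgeE[OF wedge.hyps(2,1) wedge.prems(4)] by auto
  define b where "b = vert X d d x"
  have b: "b \<in> simplices X 0" using vert_closed[OF x(1)] by (simp add: b_def)
  obtain T1 p1 f1 T2 p2 f2 where T1: "(T1, p1) \<in> Ob Nec" and T2: "(T2, p2) \<in> Ob Nec"
    and T: "T = wedge T1 p1 T2" "p = p1 + p2"
    and f1: "f1 \<in> Ar Nec (T1, p1) ({0, d}, d)" and f2: "f2 \<in> Ar Nec (T2, p2) (U, q)"
    and f: "f = wedge_map p1 p2 d f1 f2"
    using Nec_Ar_wedgeE[OF wedge.prems(1) simplex_Ob wedge.hyps(2) wedge.prems(2)] .
  have f1': "f1 \<in> Delta p1 d" "f1 0 = 0" "f1 p1 = d" and f2': "f2 0 = 0" using f1 f2 by (simp_all add: Nec_Ar)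
  obtain y1 y2 where y1: "y1 \<in> chains T1 p1 n" and y2: "y2 \<in> chains T2 p2 n" and y: "y = wedge_chain n p1 y1 y2"
    using wedge_chain_cases[OF T1 T2] wedge.prems(5) unfolding T .
  have path: "[x] = simplex_path d x" using \<open>0 < d\<close> by (simp add: simplex_path_def)
  have x': "[x] \<in> nec_simplices X a b {0, d}" using simplex_path[OF x(1)] x(2) path by (simp add: b_def)
  have psh1: "psh_map (nec_psh X a b) (T1, p1) ({0, d}, d) f1 [x] = restr_path X d x T1 f1"
    unfolding path using nec_psh_simplex_path[OF x T1 f1'(1)] .
  have psh: "psh_map (nec_psh X a c) (T, p) (wedge {0, d} d U, d + q) f xs =
      restr_path X d x T1 f1 @ psh_map (nec_psh X b c) (T2, p2) (U, q) f2 xs'"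
    unfolding T f xs psh1[symmetric]
    using wedge.prems(3) b T1 simplex_Ob T2 wedge.hyps(2) f1 f2 x' xs'[folded b_def] by (rule nec_psh_wedge)
  have fy1: "(\<lambda>r\<in>{..n}. (\<lambda>v. f1 v - 0) ` y1 r) = (\<lambda>r\<in>{..n}. f1 ` y1 r)" by simp
  have fy: "(\<lambda>r\<in>{..n}. f ` y r) = wedge_chain n d (\<lambda>r\<in>{..n}. f1 ` y1 r) (\<lambda>r\<in>{..n}. f2 ` y2 r)"
    unfolding wedge_chain_def
  proof (rule restrict_ext)
    fix r assume r: "r \<in> {..n}"
    then have "y1 r \<subseteq> {..p1}" "y2 r \<subseteq> {..p2}" using y1 y2 by (simp_all add: chains_iff)
    then show "f ` y r = wedge ((\<lambda>r\<in>{..n}. f1 ` y1 r) r) d ((\<lambda>r\<in>{..n}. f2 ` y2 r) r)"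
      using r image_wedge_map[where f = f1 and g = f2, OF f1'(3) f2'] unfolding f y by (simp add: wedge_chain_def)
  qed
  have nerve: "nerve_map ((`) h) n z = (\<lambda>r\<in>{..n}. h ` z r)" for h :: "nat \<Rightarrow> nat" and z
    by (auto simp: nerve_map_def compose_def)
  have fy1_closed: "(\<lambda>r\<in>{..n}. f1 ` y1 r) \<in> chains {0, d} d n"
    using sset_mapD(1)[OF sset_diagram.sd_map[OF sset_diagram_nerve_P T1 simplex_Ob f1], of y1 n] y1
    by (simp add: nerve_P_def nerve)
  have fy2_closed: "(\<lambda>r\<in>{..n}. f2 ` y2 r) \<in> chains U q n"
    using sset_mapD(1)[OF sset_diagram.sd_map[OF sset_diagram_nerve_P T2 wedge.hyps(2) f2], of y2 n] y2
    by (simp add: nerve_P_def nerve)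
  have "nec_word n T (psh_map (nec_psh X a c) (T, p) (wedge {0, d} d U, d + q) f xs) y =
      nec_word n T1 (restr_path X d x T1 f1) y1 @ nec_word n T2 (psh_map (nec_psh X b c) (T2, p2) (U, q) f2 xs') y2"
    unfolding psh unfolding T(1) y by (rule nec_word_wedge[OF T1 T2 _ y1 y2]) (simp add: restr_path_def)
  moreover have "nec_word n (wedge {0, d} d U) xs (\<lambda>r\<in>{..n}. f ` y r) =
      [((d, x), 0, d, \<lambda>r\<in>{..n}. f1 ` y1 r)] @ nec_word n U xs' (\<lambda>r\<in>{..n}. f2 ` y2 r)"
    unfolding xs fy nec_word_simplex[OF \<open>0 < d\<close> fy1_closed, symmetric] using \<open>0 < d\<close>
    by (intro nec_word_wedge[OF simplex_Ob wedge.hyps(2) _ fy1_closed fy2_closed]) (simp add: beads_simplex)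
  moreover have "colim_eq J D n (cv a) (cv b) (nec_word n T1 (restr_path X d x T1 f1) y1)
      [((d, x), 0, d, \<lambda>r\<in>{..n}. f1 ` y1 r)]"
    using nec_word_restr_path[OF T1 f1'(1) x(1) y1] unfolding f1'(2,3) x(2) b_def fy1 .
  moreover have "colim_eq J D n (cv b) (cv c) (nec_word n T2 (psh_map (nec_psh X b c) (T2, p2) (U, q) f2 xs') y2)
      (nec_word n U xs' (\<lambda>r\<in>{..n}. f2 ` y2 r))"
    using wedge.IH[OF T2 f2 b xs'[folded b_def] y2] .
  ultimately show ?case by (simp only: colim_eq.append)
qed

lemma nec_word_closed:
  assumes "(T, p) \<in> Ob Nec" "a \<in> simplices X 0" "xs \<in> nec_simplices X a b T" "y \<in> chains T p n"
  shows "colim_word J D n (cv a) (cv b) (nec_word n T xs y)"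
  using assms
proof (induction T p arbitrary: a xs y rule: Nec_induct)
  case zero
  then have "a = b" by (simp add: nec_simplices_def split: if_splits)
  then show ?case using word_Nil zero(1) by (simp add: nec_word_zero)
next
  case (wedge d T p)
  obtain x xs' where xs: "xs = [x] @ xs'" and x: "x \<in> simplices X d" "vert X d 0 x = a"
    and xs': "xs' \<in> nec_simplices X (vert X d d x) b T"
    using nec_simplices_wedgeE[OF wedge.hyps(2,1) wedge.prems(2)] by auto
  obtain y1 y2 where y1: "y1 \<in> chains {0, d} d n" and y2: "y2 \<in> chains T p n" and y: "y = wedge_chain n d y1 y2"
    using wedge_chain_cases[OF simplex_Ob wedge.hyps(2) wedge.prems(3)] .
  have "nec_word n (wedge {0, d} d T) xs y = ((d, x), 0, d, y1) # nec_word n T xs' y2"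
    unfolding xs y using \<open>0 < d\<close>
    by (subst nec_word_wedge[OF simplex_Ob wedge.hyps(2) _ y1 y2]) (simp_all add: beads_simplex nec_word_simplex[OF _ y1])
  then show ?case
    using word_Cons[of x d 0 d y1 n] x y1 wedge.IH[OF vert_closed[OF x(1) order.refl] xs' y2] by simp
qed

end

section \<open>From words to necklaces\<close>

text \<open>Representatives of simplices of the weighted colimit, in the format expected by
  \<open>wcolim_class\<close>.\<close>

type_synonym 'a cell = "necklace \<times> 'a list \<times> (nat \<Rightarrow> nat set)"

fun wedge_cell :: "nat \<Rightarrow> 'a cell \<Rightarrow> 'a cell \<Rightarrow> 'a cell" where
  "wedge_cell n ((T, p), xs, y) ((U, q), ys, z) = ((wedge T p U, p + q), xs @ ys, wedge_chain n p y z)"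

abbreviation unit_cell :: "nat \<Rightarrow> 'a cell" where
  "unit_cell n \<equiv> (({0}, 0), [], \<lambda>r\<in>{..n}. {0})"

text \<open>For \<open>i = j\<close> the path is empty, so an identity letter gives the unit cell on
  the nose.\<close>

fun letter_cell :: "'a sset \<Rightarrow> (nat \<times> 'a) \<times> nat \<times> nat \<times> (nat \<Rightarrow> nat set) \<Rightarrow> 'a cell" where
  "letter_cell X ((m, x), i, j, g) =
    (({0, j - i}, j - i), simplex_path (j - i) (act X (j - i) m (\<lambda>r\<in>{..j - i}. i + r) x), g)"

fun word_cell :: "'a sset \<Rightarrow> nat \<Rightarrow> (nat \<times> 'a, nat, nat \<Rightarrow> nat set) word \<Rightarrow> 'a cell" where
  "word_cell X n [] = unit_cell n"
| "word_cell X n (l # u) = wedge_cell n (letter_cell X l) (word_cell X n u)"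

definition cells :: "'a sset \<Rightarrow> 'a \<Rightarrow> 'a \<Rightarrow> nat \<Rightarrow> 'a cell set" where
  "cells X a b n = {((T, p), xs, y). (T, p) \<in> Ob Nec \<and> xs \<in> nec_simplices X a b T \<and> y \<in> chains T p n}"

lemma cells_iff:
  "((T, p), xs, y) \<in> cells X a b n \<longleftrightarrow> (T, p) \<in> Ob Nec \<and> xs \<in> nec_simplices X a b T \<and> y \<in> chains T p n"
  by (simp add: cells_def)

lemma wedge_cell_closed: "s \<in> cells X a b n \<Longrightarrow> t \<in> cells X b c n \<Longrightarrow> wedge_cell n s t \<in> cells X a c n"
  by (cases "(n, s, t)" rule: wedge_cell.cases)
    (auto simp: cells_iff wedge_Ob wedge_chain_closed nec_simplices_wedge)

lemma wedge_cell_assoc: "wedge_cell n (wedge_cell n s t) u = wedge_cell n s (wedge_cell n t u)"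
  by (cases "(n, s, t)" rule: wedge_cell.cases; cases "(n, t, u)" rule: wedge_cell.cases)
    (auto simp: wedge_assoc wedge_chain_assoc)

lemma wedge_cell_unit_left: "t \<in> cells X a b n \<Longrightarrow> wedge_cell n (unit_cell n) t = t"
  by (cases "(n, t, t)" rule: wedge_cell.cases)
    (auto simp: cells_iff Nec_Ob wedge_0_left intro: wedge_chain_0_left)

lemma wedge_cell_unit_right: "t \<in> cells X a b n \<Longrightarrow> wedge_cell n t (unit_cell n) = t"
  by (cases "(n, t, t)" rule: wedge_cell.cases)
    (auto simp: cells_iff Nec_Ob wedge_0_right intro: wedge_chain_0_right)

lemma unit_cell_closed: "unit_cell n \<in> cells X a a n"
  by (auto simp: cells_iff Nec_Ob chains_zero nec_simplices_def)

lemma nerve_map_image: "nerve_map ((`) h) n z = (\<lambda>r\<in>{..n}. h ` z r)"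
  by (auto simp: nerve_map_def compose_def)

lemma equivclp_map:
  assumes "equivclp r x y" "\<And>x y. r x y \<Longrightarrow> r' (f x) (f y)"
  shows "equivclp r' (f x) (f y)"
  using assms(1)
proof (induction rule: equivclp_induct)
  case (step y z)
  then have "r' (f y) (f z) \<or> r' (f z) (f y)" using assms(2) by blast
  then show ?case using step(3) by (metis equivclp_into_equivclp)
qed simp

section \<open>The generating relation on cells: wedges, and the relations between words\<close>

context simplicial_set
begin

abbreviation "cell_step a b n \<equiv> wcolim_step Nec (nec_psh X a b) nerve_P n"

lemma cell_step_iff:
  "cell_step a b n ((T, p), xs, y) ((U, q), ys, z) \<longleftrightarrow> (T, p) \<in> Ob Nec \<and> (U, q) \<in> Ob Nec \<and>
    (\<exists>f\<in>Ar Nec (T, p) (U, q). ys \<in> nec_simplices X a b U \<and> y \<in> chains T p n \<and>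
      xs = psh_map (nec_psh X a b) (T, p) (U, q) f ys \<and> z = (\<lambda>r\<in>{..n}. f ` y r))"
  unfolding wcolim_step.simps nerve_map_image[symmetric] by (auto simp: nerve_P_def nec_psh_simps(1))

lemma cell_stepE:
  assumes "cell_step a b n s t"
  obtains T p U q f ys y where "s = ((T, p), psh_map (nec_psh X a b) (T, p) (U, q) f ys, y)"
    "t = ((U, q), ys, \<lambda>r\<in>{..n}. f ` y r)" "(T, p) \<in> Ob Nec" "(U, q) \<in> Ob Nec" "f \<in> Ar Nec (T, p) (U, q)"
    "ys \<in> nec_simplices X a b U" "y \<in> chains T p n"
  using assms by (cases s; cases t) (auto simp: cell_step_iff)

text \<open>The step along the identity necklace map. It lets one wedge factor stay fixed while the
  other one moves.\<close>

lemma cell_step_refl: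
  assumes "a \<in> simplices X 0" "t \<in> cells X a b n"
  shows "cell_step a b n t t"
proof -
  obtain T p xs y where t: "t = ((T, p), xs, y)" by (cases t) auto
  then have c: "(T, p) \<in> Ob Nec" "xs \<in> nec_simplices X a b T" "y \<in> chains T p n" using assms(2) by (simp_all add: cells_iff)
  have "psh_map (nec_psh X a b) (T, p) (T, p) (Id Nec (T, p)) xs = xs"
    using presheaf.psh_Id[OF presheaf_nec_psh[OF simplicial_set_axioms assms(1)] c(1)] c(2) by (simp add: nec_psh_simps(1))
  moreover have "(\<lambda>r\<in>{..n}. Id Nec (T, p) ` y r) = y"
    using sset_diagram.sd_Id[OF sset_diagram_nerve_P c(1), of y n] c(3) by (simp add: nerve_P_def nerve_map_image)
  moreover have "Id Nec (T, p) \<in> Ar Nec (T, p) (T, p)"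
    using small_category.Id_closed[OF small_category_Nec c(1)] .
  ultimately show ?thesis unfolding t cell_step_iff using c by metis
qed

text \<open>The wedge of the two necklace maps performs both steps at once, because paths and chains
  are both compatible with wedges.\<close>

lemma cell_step_wedge:
  assumes a: "a \<in> simplices X 0" and b: "b \<in> simplices X 0"
    and st: "cell_step a b n s t" and st': "cell_step b c n s' t'"
  shows "cell_step a c n (wedge_cell n s s') (wedge_cell n t t')"
  using st
proof (cases rule: cell_stepE)
  case (1 T p U q f ys y)
  note s = this
  from st' show ?thesis
  proof (cases rule: cell_stepE)
    case (1 T' p' U' q' f' ys' y')
    note s' = this
    let ?h = "wedge_map p p' q f f'"
    have ff: "f p = q" "f' 0 = 0" using s(5) s'(5) by (simp_all add: Nec_Ar)
    have "(\<lambda>r\<in>{..n}. ?h ` wedge_chain n p y y' r) = wedge_chain n q (\<lambda>r\<in>{..n}. f ` y r) (\<lambda>r\<in>{..n}. f' ` y' r)"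
      unfolding wedge_chain_def
    proof (rule restrict_ext)
      fix r assume r: "r \<in> {..n}"
      then have "y r \<subseteq> {..p}" "y' r \<subseteq> {..p'}" using s(7) s'(7) by (simp_all add: chains_iff)
      then show "?h ` (\<lambda>r\<in>{..n}. wedge (y r) p (y' r)) r = wedge ((\<lambda>r\<in>{..n}. f ` y r) r) q ((\<lambda>r\<in>{..n}. f' ` y' r) r)"
        using r image_wedge_map[where f = f and g = f', OF ff] by simp
    qed
    then show ?thesis
      using wedge_map_Ar[OF s(5) s'(5) s(3) s'(3)] nec_psh_wedge[OF a b s(3,4) s'(3,4) s(5) s'(5) s(6) s'(6)]
        nec_simplices_wedge[OF s(4) s'(4) s(6) s'(6)] wedge_chain_closed[OF s(7) s'(7)]
      by (auto simp: s(1,2) s'(1,2) cell_step_iff wedge_Ob s(3,4) s'(3,4) intro!: bexI[of _ ?h])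
  qed
qed

text \<open>The factors are changed one after the other, each time against a reflexive step on the
  other factor. Reflexivity holds on actual cells, hence the membership of \<open>t\<close> and
  \<open>s'\<close>.\<close>

lemma cell_equiv_wedge:
  assumes a: "a \<in> simplices X 0" and b: "b \<in> simplices X 0"
    and t: "t \<in> cells X a b n" and s': "s' \<in> cells X b c n"
    and st: "equivclp (cell_step a b n) s t" and st': "equivclp (cell_step b c n) s' t'"
  shows "equivclp (cell_step a c n) (wedge_cell n s s') (wedge_cell n t t')"
proof (rule equivclp_trans)
  show "equivclp (cell_step a c n) (wedge_cell n s s') (wedge_cell n t s')"
    using st cell_step_wedge[OF a b _ cell_step_refl[OF b s']] by (rule equivclp_map)
  show "equivclp (cell_step a c n) (wedge_cell n t s') (wedge_cell n t t')"
    using st' cell_step_wedge[OF a b cell_step_refl[OF a t]] by (rule equivclp_map)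
qed

text \<open>Steps towards a single bead. The composite and arrow relations between words both become
  steps of this kind.\<close>

lemma cell_step_simplex:
  assumes x: "x \<in> simplices X e" "vert X e 0 x = a" "vert X e e x = b"
    and T: "(T, p) \<in> Ob Nec" and f: "f \<in> Ar Nec (T, p) ({0, e}, e)" and y: "y \<in> chains T p n"
  shows "cell_step a b n ((T, p), restr_path X e x T f, y) (({0, e}, e), simplex_path e x, \<lambda>r\<in>{..n}. f ` y r)"
proof -
  have "psh_map (nec_psh X a b) (T, p) ({0, e}, e) f (simplex_path e x) = restr_path X e x T f"
    using f by (intro nec_psh_simplex_path[OF x(1,2) T]) (simp add: Nec_Ar)
  then show ?thesis using T f y simplex_path[OF x(1)] x(2,3) unfolding cell_step_iff
    by (auto simp: simplex_Ob intro!: bexI[of _ f])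
qed

lemma incl_Delta: "i \<le> j \<Longrightarrow> j \<le> m \<Longrightarrow> (\<lambda>r\<in>{..j - i}. i + r) \<in> Delta (j - i) m"
  by (auto simp: Delta_def mono_on_def)

lemma letter_cell_closed:
  assumes "x \<in> simplices X m" "i \<le> j" "j \<le> m" "g \<in> chains {0, j - i} (j - i) n"
  shows "letter_cell X ((m, x), i, j, g) \<in> cells X (vert X m i x) (vert X m j x) n"
proof -
  note D = incl_Delta[OF assms(2,3)]
  show ?thesis
    using simplex_path[OF act_closed[OF D assms(1)]] vert_act[OF D assms(1)] assms(2,4)
    by (simp add: cells_iff simplex_Ob)
qed

text \<open>Words know their end points as objects of the categorification, cells as vertices;
  injectivity translates between the two.\<close>

lemma cv_inj: "a \<in> simplices X 0 \<Longrightarrow> b \<in> simplices X 0 \<Longrightarrow> cv a = cv b \<Longrightarrow> a = b"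
  using bij_betw_cat_vertex[OF simplicial_set_axioms] by (auto simp: bij_betw_def inj_on_def)

lemma word_cell_closed:
  "colim_word J D n A B u \<Longrightarrow> a \<in> simplices X 0 \<Longrightarrow> b \<in> simplices X 0 \<Longrightarrow> A = cv a \<Longrightarrow> B = cv b \<Longrightarrow>
    word_cell X n u \<in> cells X a b n"
proof (induction arbitrary: a rule: colim_word.induct)
  case (Nil j x)
  then have "a = b" using cv_inj by simp
  then show ?case using unit_cell_closed[of n X b] by simp
next
  case (Cons j i k g B u)
  obtain m x where j: "j = (m, x)" by (cases j)
  have x: "x \<in> simplices X m" "i \<le> m" "k \<le> m" "i \<le> k" "g \<in> chains {0, k - i} (k - i) n"
    using Cons.hyps by (simp_all add: j Ob_J D_simps simplex_scat_simps(1) simplex_scat_hom_chains)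
  have "vert X m i x = a"
    using Cons.prems x by (intro cv_inj vert_closed) (simp_all add: j colim_ob_eq_vertex)
  moreover have "word_cell X n u \<in> cells X (vert X m k x) b n"
    using Cons.prems x by (intro Cons.IH vert_closed) (simp_all add: j colim_ob_eq_vertex)
  ultimately show ?case using wedge_cell_closed[OF letter_cell_closed[OF x(1,4,3,5)]] by (simp add: j)
qed

lemma word_cell_append:
  assumes "word_cell X n v \<in> cells X b c n"
  shows "word_cell X n (u @ v) = wedge_cell n (word_cell X n u) (word_cell X n v)"
proof (induction u)
  case Nil
  show ?case using wedge_cell_unit_left[OF assms] by simp
qed (simp add: wedge_cell_assoc)

lemma word_cell_single:
  assumes "x \<in> simplices X m" "i \<le> j" "j \<le> m" "g \<in> chains {0, j - i} (j - i) n"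
  shows "word_cell X n [((m, x), i, j, g)] = letter_cell X ((m, x), i, j, g)"
  using wedge_cell_unit_right[OF letter_cell_closed[OF assms]] by simp

lemma cv_cases:
  assumes "A \<in> obj (scat_colim J D)"
  obtains a where "a \<in> simplices X 0" "A = cv a"
  using bij_betw_cat_vertex[OF simplicial_set_axioms] assms by (auto simp: bij_betw_def categorification_def)

text \<open>Checked on generators: an identity letter gives the unit cell, while the composite and
  arrow relations each give one step between cells. Concatenation is handled by wedging
  equivalences.\<close>

lemma word_cell_eq:
  "colim_eq J D n A B u v \<Longrightarrow> a \<in> simplices X 0 \<Longrightarrow> b \<in> simplices X 0 \<Longrightarrow> A = cv a \<Longrightarrow> B = cv b \<Longrightarrow>
    equivclp (cell_step a b n) (word_cell X n u) (word_cell X n v)"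
proof (induction arbitrary: a b rule: colim_eq.induct)
  case (sym A B u v)
  then show ?case by (blast intro: equivclp_sym)
next
  case (trans A B u v w)
  then show ?case by (blast intro: equivclp_trans)
next
  case (append A B u u' C v v')
  note w = C.eq_word[OF append.hyps(1)] C.eq_word[OF append.hyps(2)]
  \<comment> \<open>The middle object is the image of a vertex, as is every object of the
    categorification.\<close>
  obtain c where c: "c \<in> simplices X 0" "B = cv c"
    using w C.word_ob cv_cases by blast
  have u': "word_cell X n u' \<in> cells X a c n"
    using w append.prems c by (blast intro: word_cell_closed)
  have v: "word_cell X n v \<in> cells X c b n" "word_cell X n v' \<in> cells X c b n"
    using w append.prems c by (blast intro: word_cell_closed)+
  show ?case unfolding word_cell_append[OF v(1)] word_cell_append[OF v(2)]
    using append.prems(1) c(1) u' v(1) append.IH(1)[OF append.prems(1) c(1) append.prems(3) c(2)]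
      append.IH(2)[OF c(1) append.prems(2) c(2) append.prems(4)] by (rule cell_equiv_wedge)
next
  case (identity j i)
  obtain m x where j: "j = (m, x)" by (cases j)
  have "degen (hom (cd_ob D j) i i) n (idn (cd_ob D j) i) = (\<lambda>r\<in>{..n}. {0})"
    by (simp add: j D_simps simplex_scat_simps degen_nerve)
  then have "letter_cell X (j, i, i, degen (hom (cd_ob D j) i i) n (idn (cd_ob D j) i)) = unit_cell n"
    by (simp add: j simplex_path_def)
  then show ?case using wedge_cell_unit_right[OF unit_cell_closed[of n X a]] by simp
next
  case (composite l i j k g h)
  obtain m x where l: "l = (m, x)" by (cases l)
  have x: "x \<in> simplices X m" "i \<le> j" "j \<le> k" "k \<le> m" "g \<in> chains {0, j - i} (j - i) n" "h \<in> chains {0, k - j} (k - j) n"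
    using composite.hyps by (simp_all add: l Ob_J D_simps simplex_scat_simps(1) simplex_scat_hom_chains)
  have ik: "i \<le> k" "j \<le> m" using x by auto
  have ab: "vert X m i x = a" "vert X m k x = b"
    using composite.prems x by (auto intro!: cv_inj vert_closed simp: l colim_ob_eq_vertex)
  let ?incl = "\<lambda>i j. \<lambda>r\<in>{..j - i}. i + r"
  let ?x = "act X (k - i) m (?incl i k) x" and ?T = "wedge {0, j - i} (j - i) {0, k - j}" and ?y = "wedge_chain n (j - i) g h"
  have T: "(?T, k - i) \<in> Ob Nec" using wedge_Ob[OF simplex_Ob[of "j - i"] simplex_Ob[of "k - j"]] x by simp
  have y: "?y \<in> chains ?T (k - i) n" using wedge_chain_closed[OF x(5,6)] x by simp
  note Dik = incl_Delta[OF ik(1) x(4)]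
  have xik: "?x \<in> simplices X (k - i)" using act_closed[OF Dik x(1)] .
  have vx: "vert X (k - i) 0 ?x = a" "vert X (k - i) (k - i) ?x = b"
    using vert_act[OF Dik x(1)] ik ab by simp_all
  \<comment> \<open>Composition forgets the middle joint \<open>j - i\<close>: this is the necklace
    map from the two-fold wedge to a simplex that is the identity on vertices.\<close>
  have f: "idD (k - i) \<in> Ar Nec (?T, k - i) ({0, k - i}, k - i)"
    using T by (auto simp: Nec_Ar Delta_idD Nec_Ob image_iff)
  let ?lo = "\<lambda>r\<in>{..j - i}. r" and ?hi = "\<lambda>r\<in>{..k - j}. (j - i) + r"
  have lo: "?lo \<in> Delta (j - i) (k - i)" and hi: "?hi \<in> Delta (k - j) (k - i)"
    using x ik by (auto simp: Delta_def mono_on_def)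
  \<comment> \<open>Restricting \<open>x|[i,k]\<close> further to its two parts gives
    \<open>x|[i,j]\<close> and \<open>x|[j,k]\<close>, so the source of the step is the wedge of the
    two letter cells.\<close>
  have "compose {..j - i} (?incl i k) ?lo = ?incl i j" "compose {..k - j} (?incl i k) ?hi = ?incl j k"
    using x by (auto simp: compose_def intro!: restrict_ext)
  then have "act X (j - i) (k - i) ?lo ?x = act X (j - i) m (?incl i j) x"
    "act X (k - j) (k - i) ?hi ?x = act X (k - j) m (?incl j k) x"
    using act_compose[OF lo Dik x(1)] act_compose[OF hi Dik x(1)] by simp_all
  moreover have "restr_path X (k - i) ?x ?T (idD (k - i)) =
      restr_path X (k - i) ?x {0, j - i} ?lo @ restr_path X (k - i) ?x {0, k - j} ?hi"
    using x by (intro restr_path_wedge[OF simplex_Ob simplex_Ob]) auto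
  ultimately have "restr_path X (k - i) ?x ?T (idD (k - i)) =
      simplex_path (j - i) (act X (j - i) m (?incl i j) x) @ simplex_path (k - j) (act X (k - j) m (?incl j k) x)"
    by (simp only: restr_path_simplex[OF lo] restr_path_simplex[OF hi])
  then have source: "((?T, k - i), restr_path X (k - i) ?x ?T (idD (k - i)), ?y) =
      wedge_cell n (letter_cell X ((m, x), i, j, g)) (letter_cell X ((m, x), j, k, h))"
    using x by simp
  have "idD (k - i) ` ?y r = ?y r" if "r \<le> n" for r
  proof -
    have "?y r \<subseteq> {..k - i}" using y that by (simp add: chains_iff)
    then show ?thesis by (auto simp: image_iff)
  qed
  then have "(\<lambda>r\<in>{..n}. idD (k - i) ` ?y r) = ?y"
    using y by (intro extensionalityI[of _ "{..n}"]) (simp_all add: chains_iff)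
  then have "cell_step a b n (wedge_cell n (letter_cell X ((m, x), i, j, g)) (letter_cell X ((m, x), j, k, h)))
      (letter_cell X ((m, x), i, k, ?y))"
    using cell_step_simplex[OF xik vx T f y] unfolding source by simp
  moreover have "?y \<in> chains {0, k - i} (k - i) n"
    using y x by (auto simp: chains_iff wedge_def)
  moreover have "?y = cmp (cd_ob D l) i j k n g h"
    by (simp add: l D_simps simplex_scat_simps(4) wedge_chain_def wedge_def)
  ultimately show ?case
    using word_cell_single[of x m j k h n] word_cell_single[of x m i k ?y n] x ik
    by (simp add: l r_into_equivclp del: letter_cell.simps)
next
  case (arrow J1 J2 \<alpha> i j g)
  obtain l y m x where J12: "J1 = (l, y)" "J2 = (m, x)" by (cases J1; cases J2)
  have x: "x \<in> simplices X m" "\<alpha> \<in> Delta l m" "act X l m \<alpha> x = y" "i \<le> j" "j \<le> l" "g \<in> chains {0, j - i} (j - i) n"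
    using arrow.hyps by (simp_all add: J12 Ob_J Ar_J D_simps simplex_scat_simps(1) simplex_scat_hom_chains)
  have y: "y \<in> simplices X l" using act_closed[OF x(2,1)] x(3) by simp
  have le: "\<alpha> i \<le> \<alpha> j" "\<alpha> j \<le> m" using x Delta_mono[OF x(2)] Delta_apply[OF x(2)] by auto
  let ?incl = "\<lambda>i j. \<lambda>r\<in>{..j - i}. i + r"
  define e where "e = \<alpha> j - \<alpha> i"
  \<comment> \<open>\<alpha> on the interval \<open>[i,j]\<close>, with source and target both
    translated to start at 0: the necklace map that relates the two letter cells.\<close>
  define h where "h = (\<lambda>v\<in>{..j - i}. \<alpha> (i + v) - \<alpha> i)"
  define g' where "g' = (\<lambda>r\<in>{..n}. (\<lambda>v. \<alpha> (i + v) - \<alpha> i) ` g r)"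
  let ?x = "act X e m (\<lambda>r\<in>{..e}. \<alpha> i + r) x"
  note Dm = incl_Delta[OF le, folded e_def] and Dl = incl_Delta[OF x(4,5)]
  have ab: "vert X m (\<alpha> i) x = a" "vert X m (\<alpha> j) x = b"
    using arrow.prems x y vert_act[OF x(2,1)]
    by (auto intro!: cv_inj vert_closed simp: J12 colim_ob_eq_vertex Delta_apply[OF x(2)])
  have vx: "vert X e 0 ?x = a" "vert X e e ?x = b"
    using vert_act[OF Dm x(1)] le ab by (simp_all add: e_def)
  have "\<alpha> (i + v) - \<alpha> i \<le> \<alpha> (i + w) - \<alpha> i" if "v \<le> w" "w \<le> j - i" for v w
    using that x by (intro diff_le_mono Delta_mono[OF x(2)]) auto
  moreover from this[of _ "j - i"] have "\<alpha> (i + v) - \<alpha> i \<le> e" if "v \<le> j - i" for v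
    using that x by (simp add: e_def)
  ultimately have h: "h \<in> Delta (j - i) e" by (auto simp: h_def Delta_def mono_on_def)
  have h0: "h 0 = 0" "h (j - i) = e" using x by (simp_all add: h_def e_def)
  then have Ar: "h \<in> Ar Nec ({0, j - i}, j - i) ({0, e}, e)" using h by (simp add: Nec_Ar)
  \<comment> \<open>Restricting \<open>y\<close> to \<open>[i,j]\<close> is the same as restricting
    \<open>x\<close> to the interval from \<open>\<alpha> i\<close> to \<open>\<alpha> j\<close> and
    then along \<open>h\<close>.\<close>
  have "compose {..j - i} (\<lambda>r\<in>{..e}. \<alpha> i + r) h = compose {..j - i} \<alpha> (?incl i j)"
  proof (unfold compose_def, rule restrict_ext)
    fix v assume "v \<in> {..j - i}"
    then show "(\<lambda>r\<in>{..e}. \<alpha> i + r) (h v) = \<alpha> (?incl i j v)"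
      using Delta_apply[OF h, of v] Delta_mono[OF x(2), of i "i + v"] x by (simp add: h_def)
  qed
  then have "act X (j - i) e h ?x = act X (j - i) l (?incl i j) y"
    using act_compose[OF h Dm x(1)] act_compose[OF Dl x(2,1)] x(3) by simp
  then have source: "(({0, j - i}, j - i), restr_path X e ?x {0, j - i} h, g) = letter_cell X ((l, y), i, j, g)"
    by (simp add: restr_path_simplex[OF h])
  have hg: "(\<lambda>r\<in>{..n}. h ` g r) = g'"
    unfolding g'_def
  proof (rule restrict_ext, rule image_cong[OF HOL.refl])
    fix r v assume "r \<in> {..n}" "v \<in> g r"
    then have "v \<le> j - i" using x by (auto simp: chains_iff)
    then show "h v = \<alpha> (i + v) - \<alpha> i" by (simp add: h_def)
  qed
  have "cell_step a b n (letter_cell X ((l, y), i, j, g)) (letter_cell X ((m, x), \<alpha> i, \<alpha> j, g'))"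
    using cell_step_simplex[OF act_closed[OF Dm x(1)] vx simplex_Ob Ar x(6)] unfolding source hg by (simp add: e_def)
  moreover have "g' \<in> chains {0, e} e n"
    using sset_mapD(1)[OF sset_diagram.sd_map[OF sset_diagram_nerve_P simplex_Ob simplex_Ob Ar], of g n] x hg
    by (simp add: nerve_P_def nerve_map_image)
  ultimately show ?case
    using word_cell_single[OF y x(4,5,6)] word_cell_single[OF x(1) le, of g' n]
    by (simp add: J12 D_simps simplex_scat_map_simps g'_def[symmetric] e_def r_into_equivclp
        del: letter_cell.simps word_cell.simps)
qed (simp add: word_cell_closed)

section \<open>The two composites between words and cells\<close>

lemma word_cell_nec_word:
  assumes "(T, p) \<in> Ob Nec" "xs \<in> nec_simplices X a b T" "y \<in> chains T p n"
  shows "word_cell X n (nec_word n T xs y) = ((T, p), xs, y)"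
  using assms
proof (induction T p arbitrary: a xs y rule: Nec_induct)
  case zero
  then show ?case by (auto simp: nec_word_zero nec_simplices_def chains_zero split: if_splits)
next
  case (wedge d T p)
  obtain x xs' where xs: "xs = [x] @ xs'" and x: "x \<in> simplices X d" "vert X d 0 x = a"
    and xs': "xs' \<in> nec_simplices X (vert X d d x) b T"
    using nec_simplices_wedgeE[OF wedge.hyps(2,1) wedge.prems(1)] by auto
  obtain y1 y2 where y1: "y1 \<in> chains {0, d} d n" and y2: "y2 \<in> chains T p n" and y: "y = wedge_chain n d y1 y2"
    using wedge_chain_cases[OF simplex_Ob wedge.hyps(2) wedge.prems(2)] .
  have "nec_word n (wedge {0, d} d T) xs y = ((d, x), 0, d, y1) # nec_word n T xs' y2"
    unfolding xs y using \<open>0 < d\<close>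
    by (subst nec_word_wedge[OF simplex_Ob wedge.hyps(2) _ y1 y2]) (simp_all add: beads_simplex nec_word_simplex[OF _ y1])
  \<comment> \<open>A cut letter spans its whole simplex, so restricting to its interval changes
    nothing and the bead is recovered exactly.\<close>
  moreover have "restrict ((+) 0) {..d} = idD d" by (rule restrict_ext) simp
  ultimately show ?case using wedge.IH[OF xs' y2] act_id[OF x(1)] \<open>0 < d\<close> by (simp add: simplex_path_def xs y)
qed

text \<open>A letter over \<open>x\<close> from \<open>i\<close> to \<open>j\<close> returns as the
  letter over \<open>x|[i,j]\<close> from 0 to \<open>j - i\<close>, or as the empty word if
  \<open>i = j\<close>. Applying \<open>nec_word_restr_path\<close> to the inclusion of the interval
  covers both cases.\<close>

lemma nec_word_letter:
  assumes x: "x \<in> simplices X m" and le: "i \<le> j" "j \<le> m" and g: "g \<in> chains {0, j - i} (j - i) n"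
    and c: "letter_cell X ((m, x), i, j, g) = ((T, p), xs, y)"
  shows "colim_eq J D n (cv (vert X m i x)) (cv (vert X m j x)) (nec_word n T xs y) [((m, x), i, j, g)]"
proof -
  note D = incl_Delta[OF le]
  have "(\<lambda>r\<in>{..n}. (\<lambda>v. (\<lambda>r\<in>{..j - i}. i + r) v - i) ` g r) = g"
  proof (rule extensionalityI[of _ "{..n}"])
    fix r assume r: "r \<in> {..n}"
    then have "(\<lambda>v. (\<lambda>r\<in>{..j - i}. i + r) v - i) ` g r = (\<lambda>v. v) ` g r"
      using g by (intro image_cong) (auto simp: chains_iff)
    then show "(\<lambda>r\<in>{..n}. (\<lambda>v. (\<lambda>r\<in>{..j - i}. i + r) v - i) ` g r) r = g r"
      using r by (simp only: restrict_apply' image_ident)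
  qed (use g in \<open>simp_all add: chains_iff\<close>)
  then show ?thesis
    using nec_word_restr_path[OF simplex_Ob D x g] c le by (auto simp: restr_path_simplex[OF D])
qed

text \<open>Cutting turns the wedge of letter cells back into a concatenation, so the claim reduces
  to single letters because \<open>colim_eq\<close> is a congruence.\<close>

lemma nec_word_word_cell:
  "colim_word J D n A B u \<Longrightarrow> a \<in> simplices X 0 \<Longrightarrow> b \<in> simplices X 0 \<Longrightarrow> A = cv a \<Longrightarrow> B = cv b \<Longrightarrow>
    word_cell X n u = ((T, p), xs, y) \<Longrightarrow> colim_eq J D n A B (nec_word n T xs y) u"
proof (induction arbitrary: a T p xs y rule: colim_word.induct)
  case (Nil j i)
  then show ?case using colim_eq.refl[OF colim_word.Nil[OF Nil(1,2)]] by (auto simp: nec_word_zero)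
next
  case (Cons j i k g B u)
  obtain m x where j: "j = (m, x)" by (cases j)
  have x: "x \<in> simplices X m" "i \<le> m" "k \<le> m" "i \<le> k" "g \<in> chains {0, k - i} (k - i) n"
    using Cons.hyps by (simp_all add: j Ob_J D_simps simplex_scat_simps(1) simplex_scat_hom_chains)
  have v: "colim_ob J D j i = cv (vert X m i x)" "colim_ob J D j k = cv (vert X m k x)"
    using x by (simp_all add: j colim_ob_eq_vertex)
  obtain T1 p1 xs1 y1 where l: "letter_cell X ((m, x), i, k, g) = ((T1, p1), xs1, y1)"
    using prod.exhaust by metis
  obtain T2 p2 xs2 y2 where u: "word_cell X n u = ((T2, p2), xs2, y2)"
    using prod.exhaust by metis
  have c1: "(T1, p1) \<in> Ob Nec" "xs1 \<in> nec_simplices X (vert X m i x) (vert X m k x) T1" "y1 \<in> chains T1 p1 n"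
    using letter_cell_closed[OF x(1,4,3,5)] unfolding l by (simp_all add: cells_iff)
  have c2: "(T2, p2) \<in> Ob Nec" "y2 \<in> chains T2 p2 n"
    using word_cell_closed[OF Cons.hyps(5) vert_closed[OF x(1,3)] Cons.prems(2) v(2) Cons.prems(4)]
    unfolding u by (simp_all add: cells_iff)
  have len: "length xs1 = beads T1"
    using necklace_in.length_xs[OF necklace_in.intro[OF simplicial_set_axioms necklace_in_axioms.intro]]
      vert_closed[OF x(1,2)] c1 by blast
  have "nec_word n T xs y = nec_word n T1 xs1 y1 @ nec_word n T2 xs2 y2"
    using Cons.prems(5) nec_word_wedge[OF c1(1) c2(1) len c1(3) c2(2)] l u by (auto simp: j)
  moreover have "colim_eq J D n (colim_ob J D j i) (colim_ob J D j k) (nec_word n T1 xs1 y1) [(j, i, k, g)]"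
    using nec_word_letter[OF x(1,4,3,5) l] by (simp add: v j[symmetric])
  moreover have "colim_eq J D n (colim_ob J D j k) B (nec_word n T2 xs2 y2) u"
    using Cons.IH[OF vert_closed[OF x(1,3)] Cons.prems(2) v(2) Cons.prems(4) u] .
  ultimately show ?case using colim_eq.append by fastforce
qed

section \<open>Naturality in the simplicial degree, and the isomorphism\<close>

lemma word_act_nec_word:
  assumes "\<alpha> \<in> Delta m n"
  shows "word_act D m n \<alpha> (nec_word n T xs y) = nec_word m T xs (compose {..m} y \<alpha>)"
proof -
  have "compose {..m} (\<lambda>r\<in>{..n}. {v. v \<le> d \<and> t + v \<in> y r}) \<alpha> =
      (\<lambda>r\<in>{..m}. {v. v \<le> d \<and> t + v \<in> compose {..m} y \<alpha> r})" for d t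
    using Delta_apply[OF assms] by (auto simp: compose_def intro!: restrict_ext)
  then show ?thesis by (simp add: word_act_def nec_word_def D_simps simplex_scat_simps nerve_simps)
qed

text \<open>The input for the universal property of the weighted colimit. Cutting acts on each set
  of a chain separately, which makes it simplicial; \<open>nec_word_psh_map\<close> gives
  compatibility with necklace maps.\<close>

lemma nec_word_cocone:
  assumes a: "a \<in> simplices X 0"
  shows "weighted_cocone Nec (nec_psh X a b) nerve_P (hom (scat_colim J D) (cv a) (cv b))
    (\<lambda>(T, p) xs n y. colim_class J D n (cv a) (cv b) (nec_word n T xs y))"
  unfolding weighted_cocone_def
proof (intro conjI ballI allI)
  fix j xs assume "j \<in> Ob Nec" "xs \<in> psh_ob (nec_psh X a b) j"
  moreover obtain T p where j: "j = (T, p)" by (cases j)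
  ultimately have "colim_word J D n (cv a) (cv b) (nec_word n T xs y)" if "y \<in> chains T p n" for y n
    using nec_word_closed[OF _ a _ that] by (simp add: nec_psh_simps)
  then show "sset_map (sd_ob nerve_P j) (hom (scat_colim J D) (cv a) (cv b))
      ((\<lambda>(T, p) xs n y. colim_class J D n (cv a) (cv b) (nec_word n T xs y)) j xs)"
    by (auto simp: sset_map_def nerve_P_def j C.C_simplices C.C_act word_act_nec_word nerve_simps(2))
next
  fix j k f xs n y assume "j \<in> Ob Nec" "k \<in> Ob Nec" "f \<in> Ar Nec j k" "xs \<in> psh_ob (nec_psh X a b) k"
    "y \<in> simplices (sd_ob nerve_P j) n"
  moreover obtain T p U q where j: "j = (T, p)" "k = (U, q)" by (cases j; cases k)
  ultimately show "(\<lambda>(T, p) xs n y. colim_class J D n (cv a) (cv b) (nec_word n T xs y)) j (psh_map (nec_psh X a b) j k f xs) n y =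
      (\<lambda>(T, p) xs n y. colim_class J D n (cv a) (cv b) (nec_word n T xs y)) k xs n (sd_map nerve_P j k f n y)"
    using C.class_eqI[OF nec_word_psh_map[OF _ _ _ a], of U q T p f xs b y n]
    by (simp add: nec_psh_simps(1) nerve_P_def nerve_map_image)
qed

end

text \<open>The inverse of a degreewise bijective simplicial map is automatically simplicial. The
  inverse applied below is the passage from words to cells, so its naturality follows from that of
  cutting.\<close>

lemma sset_isomorphicI:
  assumes X: "simplicial_set X" and Y: "simplicial_set Y" and \<phi>: "sset_map X Y \<phi>"
    and \<psi>: "\<And>n y. y \<in> simplices Y n \<Longrightarrow> \<psi> n y \<in> simplices X n"
      "\<And>n x. x \<in> simplices X n \<Longrightarrow> \<psi> n (\<phi> n x) = x" "\<And>n y. y \<in> simplices Y n \<Longrightarrow> \<phi> n (\<psi> n y) = y"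
  shows "sset_isomorphic Y X"
proof -
  have "\<psi> m (act Y m n \<alpha> y) = act X m n \<alpha> (\<psi> n y)" if "\<alpha> \<in> Delta m n" "y \<in> simplices Y n" for m n \<alpha> y
    using sset_mapD(2)[OF \<phi> \<psi>(1)[OF that(2)] that(1)] \<psi>(2)[OF simplicial_set.act_closed[OF X that(1) \<psi>(1)[OF that(2)]]]
      \<psi>(3)[OF that(2)] by simp
  then have "sset_map Y X \<psi>" using \<psi>(1) by (simp add: sset_map_def)
  then show ?thesis using \<phi> \<psi>(2,3) unfolding sset_isomorphic_def by blast
qed

theorem proposition4p6:
  fixes K :: "'a sset" and a b :: 'a
  assumes "simplicial_set K" and "a \<in> simplices K 0" and "b \<in> simplices K 0"
  shows "sset_isomorphic (hom (categorification K) (cat_vertex K a) (cat_vertex K b))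
           (weighted_colimit Nec (nec_psh K a b) nerve_P)"
proof -
  interpret simplicial_set K by fact
  interpret W: weighted_diagram Nec "nec_psh K a b" nerve_P
    by (intro weighted_diagram.intro presheaf_nec_psh sset_diagram_nerve_P assms)
  let ?W = "weighted_colimit Nec (nec_psh K a b) nerve_P" and ?C = "hom (scat_colim J D) (cv a) (cv b)"
  let ?class = "\<lambda>n. wcolim_class Nec (nec_psh K a b) nerve_P n"
  \<comment> \<open>Cutting, extended from cells to the weighted colimit.\<close>
  obtain \<psi> where \<psi>: "sset_map ?W ?C \<psi>"
    and \<psi>_class: "\<And>T p xs n y. \<lbrakk>(T, p) \<in> Ob Nec; xs \<in> nec_simplices K a b T; y \<in> chains T p n\<rbrakk> \<Longrightarrow>
      \<psi> n (?class n ((T, p), xs, y)) = colim_class J D n (cv a) (cv b) (nec_word n T xs y)"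
    using W.weighted_colimit_universal(1)[OF nec_word_cocone[OF assms(2)]]
    by (fastforce simp: nec_psh_simps(1) nerve_P_def)
  \<comment> \<open>All words in one class have equivalent cells by \<open>word_cell_eq\<close>, so
    the union is over equal classes and is itself that class.\<close>
  define \<phi> where "\<phi> n c = (\<Union>u\<in>c. ?class n (word_cell K n u))" for n c
  have \<phi>_class: "\<phi> n (colim_class J D n (cv a) (cv b) u) = ?class n (word_cell K n u)"
    if "colim_word J D n (cv a) (cv b) u" for n u
    unfolding \<phi>_def
    by (rule C.class_UN[OF that], rule wcolim_class_eqI, rule equivclp_sym, rule word_cell_eq[OF _ assms(2,3)]) simp_all
  have sd_ob: "sd_ob nerve_P j = nerve (nec_poset j)" for j by (simp add: nerve_P_def)
  have W_iff: "c \<in> simplices ?W n \<longleftrightarrow> (\<exists>T p xs y. c = ?class n ((T, p), xs, y) \<and> ((T, p), xs, y) \<in> cells K a b n)" for c n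
    by (auto simp: W.colim_simplices cells_iff nec_psh_simps(1) sd_ob)
  have C_iff: "c \<in> simplices ?C n \<longleftrightarrow> (\<exists>u. c = colim_class J D n (cv a) (cv b) u \<and> colim_word J D n (cv a) (cv b) u)" for c n
    by (simp add: C.C_simplices)
  have cell: "word_cell K n u \<in> cells K a b n" if "colim_word J D n (cv a) (cv b) u" for n u
    using word_cell_closed[OF that assms(2,3)] by simp
  show ?thesis unfolding categorification_def
  proof (rule sset_isomorphicI[OF W.simplicial_set_weighted_colimit C.C_hom_sset \<psi>])
    fix n c assume "c \<in> simplices ?C n"
    then obtain u where u: "c = colim_class J D n (cv a) (cv b) u" "colim_word J D n (cv a) (cv b) u"
      by (auto simp: C_iff)
    obtain T p xs y where t: "word_cell K n u = ((T, p), xs, y)" using prod.exhaust by metis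
    show "\<phi> n c \<in> simplices ?W n" using cell[OF u(2)] t by (auto simp: u(1) \<phi>_class[OF u(2)] W_iff)
    \<comment> \<open>The composite on words holds only up to the relations, hence the passage to
      classes.\<close>
    show "\<psi> n (\<phi> n c) = c"
      using cell[OF u(2)] C.class_eqI[OF nec_word_word_cell[OF u(2) assms(2,3) HOL.refl HOL.refl t]]
      by (simp add: u(1) \<phi>_class[OF u(2)] t cells_iff \<psi>_class)
  next
    fix n c assume "c \<in> simplices ?W n"
    then obtain T p xs y where c: "c = ?class n ((T, p), xs, y)"
      and t: "(T, p) \<in> Ob Nec" "xs \<in> nec_simplices K a b T" "y \<in> chains T p n"
      by (auto simp: W_iff cells_iff)
    \<comment> \<open>Here the representing cells already agree.\<close>
    show "\<phi> n (\<psi> n c) = c"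
      unfolding c \<psi>_class[OF t] \<phi>_class[OF nec_word_closed[OF t(1) assms(2) t(2,3)]] word_cell_nec_word[OF t] ..
  qed
qed

end
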